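(* Let $N\in\mathbb{N}$, $\alpha\in(0,2)$. Let $D_0,D_1\subset\mathbb{R}^N$ be open bounded sets such that $0\in D_1$ and $\overline{D}_1\subset D_0$. Assume that $D_0$ and $D_1$ are uniformly starshaped and that $D_0\setminus\overline{D}_1$ is a $C^{1,1}$ domain. Let $u$ be a solution of $$(P)\qquad (-\Delta)^{\alpha/2}u=0\ \text{ in } D_0\setminus\overline{D}_1,\qquad u=0\ \text{ in }\mathbb{R}^N\setminus D_0,\qquad u=1\ \text{ in }\overline{D}_1 .$$ Then for every $\ell\in(0,1)$ the superlevel set $U(\ell)=\{x\in\mathbb{R}^N:u(x)\ge\ell\}$ is uniformly starshaped.
   Context: Let $\mathcal{L}^1_\alpha$ be the space of Borel functions $u:\mathbb{R}^N\to\mathbb{R}\cup\{\infty\}$ with $\int_{\mathbb{R}^N}\frac{|u(x)|}{(1+|x|)^{N+\alpha}}\,dx<\infty$. For $u\in\mathcal{L}^1_\alpha$ and $x\in\mathbb{R}^N$, the fractional Laplacian is $$(-\Delta)^{\alpha/2}u(x)=c_{N,\alpha}\lim_{\varepsilon\downarrow0}\int_{|x-y|>\varepsilon}\frac{u(x)-u(y)}{|x-y|^{N+\alpha}}\,dy$$ whenever the limit exists, with $c_{N,\alpha}=2^{\alpha-2}\pi^{-N/2}\alpha(2-\alpha)\Gamma(\frac{N+\alpha}{2})/\Gamma(2-\frac{\alpha}{2})$. It exists everywhere for functions in $C_c^2(\mathbb{R}^N)$. For $u\in\mathcal{L}^1_\alpha$ the distribution $(-\Delta)^{\alpha/2}u$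 is defined by $\langle(-\Delta)^{\alpha/2}u,\varphi\rangle=\int_{\mathbb{R}^N}u\,(-\Delta)^{\alpha/2}\varphi\,dx$ for $\varphi\in C_c^\infty(\mathbb{R}^N)$. A solution of $(P)$ is a function $u$ that is continuous and bounded on $\mathbb{R}^N$, with $u=0$ in $\mathbb{R}^N\setminus D_0$, $u=1$ in $\overline{D}_1$, and $(-\Delta)^{\alpha/2}u=0$ as distributions in $D_0\setminus\overline{D}_1$, i.e. $\langle(-\Delta)^{\alpha/2}u,\varphi\rangle=0$ for all $\varphi\in C_c^\infty(D_0\setminus\overline{D}_1)$. A set $A\subset\mathbb{R}^N$ is uniformly starshaped if the exterior unit normal $\nu(x)$ exists at each $x\in\partial A$ and there exists $\epsilon>0$ such that $\langle x,\nu(x)\rangle\ge\epsilon$ for every $x\in\partial A$. *)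

theory Defs
  imports "HOL-Analysis.Analysis"
begin

primrec Ck :: "nat \<Rightarrow> ('a::euclidean_space \<Rightarrow> real) \<Rightarrow> bool" where
  "Ck 0 f \<longleftrightarrow> continuous_on UNIV f"
| "Ck (Suc k) f \<longleftrightarrow>
     f differentiable_on UNIV \<and> (\<forall>i\<in>Basis. Ck k (\<lambda>x. frechet_derivative f (at x) i))"

definition test_function :: "'a::euclidean_space set \<Rightarrow> ('a \<Rightarrow> real) \<Rightarrow> bool" where
  "test_function \<Omega> \<phi> \<longleftrightarrow>
     (\<forall>k. Ck k \<phi>) \<and> compact (closure {x. \<phi> x \<noteq> 0}) \<and> closure {x. \<phi> x \<noteq> 0} \<subseteq> \<Omega>"

definition frac_laplacian_const :: "nat \<Rightarrow> real \<Rightarrow> real" where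
  "frac_laplacian_const N \<alpha> =
     2 powr (\<alpha> - 2) * pi powr (- (real N / 2)) * \<alpha> * (2 - \<alpha>) *
     Gamma ((real N + \<alpha>) / 2) / Gamma (2 - \<alpha> / 2)"

(* Meaningful only where the limit exists, which is everywhere for compactly
   supported C^2 functions; elsewhere Lim returns an arbitrary value. *)
definition frac_laplacian :: "real \<Rightarrow> ('a::euclidean_space \<Rightarrow> real) \<Rightarrow> 'a \<Rightarrow> real" where
  "frac_laplacian \<alpha> u x =
     frac_laplacian_const DIM('a) \<alpha> *
     Lim (at_right 0) (\<lambda>\<epsilon>. LINT y:{y. norm (x - y) > \<epsilon>}|lborel.
       (u x - u y) / norm (x - y) powr (real DIM('a) + \<alpha>))"

(* The distribution (-Delta)^(alpha/2) u applied to phi. *)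
definition frac_laplacian_distr ::
    "real \<Rightarrow> ('a::euclidean_space \<Rightarrow> real) \<Rightarrow> ('a \<Rightarrow> real) \<Rightarrow> real" where
  "frac_laplacian_distr \<alpha> u \<phi> = (LINT x|lborel. u x * frac_laplacian \<alpha> \<phi> x)"

(* A continuous bounded u is in L^1_alpha, so the distribution is well defined. *)
definition solution_P ::
    "real \<Rightarrow> 'a::euclidean_space set \<Rightarrow> 'a set \<Rightarrow> ('a \<Rightarrow> real) \<Rightarrow> bool" where
  "solution_P \<alpha> D0 D1 u \<longleftrightarrow>
     continuous_on UNIV u \<and> bounded (range u) \<and>
     (\<forall>x. x \<notin> D0 \<longrightarrow> u x = 0) \<and>
     (\<forall>x\<in>closure D1. u x = 1) \<and>
     (\<forall>\<phi>. test_function (D0 - closure D1) \<phi> \<longrightarrow> frac_laplacian_distr \<alpha> u \<phi> = 0)"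

(* nu is the exterior normal of the tangent plane at x: near x, and off any cone
   around the plane orthogonal to nu, the set A is the half-space on the side of -nu. *)
definition exterior_unit_normal :: "'a::euclidean_space set \<Rightarrow> 'a \<Rightarrow> 'a \<Rightarrow> bool" where
  "exterior_unit_normal A x \<nu> \<longleftrightarrow>
     norm \<nu> = 1 \<and>
     (\<forall>\<delta>>0. \<exists>r>0. \<forall>y\<in>ball x r.
        ((y - x) \<bullet> \<nu> < - \<delta> * norm (y - x) \<longrightarrow> y \<in> A) \<and>
        ((y - x) \<bullet> \<nu> > \<delta> * norm (y - x) \<longrightarrow> y \<notin> A))"

lemma exterior_unit_normal_unique:
  assumes "exterior_unit_normal A x \<nu>" and "exterior_unit_normal A x \<mu>"
  shows "\<nu> = \<mu>"
proof (rule ccontr)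
  assume neq: "\<nu> \<noteq> \<mu>"
  define w where "w = \<mu> - \<nu>"
  have w: "norm w > 0" using neq by (simp add: w_def)
  have unit: "\<nu> \<bullet> \<nu> = 1" "\<mu> \<bullet> \<mu> = 1"
    using assms by (simp_all add: exterior_unit_normal_def dot_square_norm)
  have "w \<bullet> w = 2 - 2 * (\<mu> \<bullet> \<nu>)"
    by (simp add: w_def inner_diff_left inner_diff_right unit inner_commute)
  moreover have "w \<bullet> w > 0" using w by simp
  ultimately have c: "1 - \<mu> \<bullet> \<nu> > 0" by linarith
  define \<delta> where "\<delta> = (1 - \<mu> \<bullet> \<nu>) / (2 * norm w)"
  have \<delta>: "\<delta> > 0" using c w by (simp add: \<delta>_def)
  have \<delta>w: "\<delta> * norm w = (1 - \<mu> \<bullet> \<nu>) / 2" using w by (simp add: \<delta>_def)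
  obtain r where r: "r > 0"
    "\<And>y. y \<in> ball x r \<Longrightarrow> (y - x) \<bullet> \<nu> < - \<delta> * norm (y - x) \<Longrightarrow> y \<in> A"
    using assms(1) \<delta> unfolding exterior_unit_normal_def by blast
  obtain s where s: "s > 0"
    "\<And>y. y \<in> ball x s \<Longrightarrow> (y - x) \<bullet> \<mu> > \<delta> * norm (y - x) \<Longrightarrow> y \<notin> A"
    using assms(2) \<delta> unfolding exterior_unit_normal_def by blast
  define t where "t = min r s / (2 * norm w)"
  have t: "t > 0" using r(1) s(1) w by (simp add: t_def)
  have tw: "t * norm w < r" "t * norm w < s" using r(1) s(1) w by (auto simp: t_def)
  define y where "y = x + t *\<^sub>R w"
  have ny: "norm (y - x) = t * norm w" using t by (simp add: y_def)
  have in_balls: "y \<in> ball x r" "y \<in> ball x s"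
    using tw ny by (simp_all add: dist_norm norm_minus_commute)
  have \<delta>y: "\<delta> * norm (y - x) = t * ((1 - \<mu> \<bullet> \<nu>) / 2)"
    unfolding ny \<delta>w[symmetric] by simp
  have less: "t * ((1 - \<mu> \<bullet> \<nu>) / 2) < t * (1 - \<mu> \<bullet> \<nu>)" using t c by simp
  have "(y - x) \<bullet> \<nu> = - (t * (1 - \<mu> \<bullet> \<nu>))"
    by (simp add: y_def w_def inner_diff_left unit algebra_simps)
  then have "(y - x) \<bullet> \<nu> < - \<delta> * norm (y - x)" using less \<delta>y by simp
  moreover have "(y - x) \<bullet> \<mu> = t * (1 - \<mu> \<bullet> \<nu>)"
    by (simp add: y_def w_def inner_diff_left inner_diff_right unit inner_commute)
  then have "(y - x) \<bullet> \<mu> > \<delta> * norm (y - x)" using less \<delta>y by simp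
  ultimately show False using r(2) s(2) in_balls by blast
qed

definition uniformly_starshaped :: "'a::euclidean_space set \<Rightarrow> bool" where
  "uniformly_starshaped A \<longleftrightarrow>
     (\<exists>\<nu>. (\<forall>x\<in>frontier A. exterior_unit_normal A x (\<nu> x)) \<and>
          (\<exists>\<epsilon>>0. \<forall>x\<in>frontier A. x \<bullet> \<nu> x \<ge> \<epsilon>))"

(* Near each boundary point, in suitable orthonormal coordinates with last axis e, the set
   is the strict subgraph of a function g of the remaining N - 1 coordinates
   y - (y . e) e, with Lipschitz gradient G. As is usual for this notion,
   connectedness is not required: the set between D1 and D0 is disconnected if N = 1. *)
definition C11_domain :: "'a::euclidean_space set \<Rightarrow> bool" where
  "C11_domain \<Omega> \<longleftrightarrow>
     open \<Omega> \<and>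
     (\<forall>x\<in>frontier \<Omega>. \<exists>r>0. \<exists>e g G L.
        norm e = 1 \<and>
        (\<forall>z. (g has_derivative (\<lambda>h. G z \<bullet> h)) (at z)) \<and>
        L-lipschitz_on UNIV G \<and>
        \<Omega> \<inter> ball x r = {y \<in> ball x r. y \<bullet> e < g (y - (y \<bullet> e) *\<^sub>R e)})"

end

(* Idea: for t > 1 the function u(x) - u(tx) is nonnegative where x or tx leaves the ring, because D0
   and D1 are starshaped, and it is alpha-harmonic elsewhere; so it is nonnegative by the maximum
   principle. Its integral grows linearly in t - 1, hence by Harnack's inequality so does its value at
   each point of the ring, which gives <x, grad u(x)> < 0 there. A level set {u = l} with 0 < l < 1 is a
   compact subset of the ring, so this inequality is uniform on it. Interior C^1 regularity of u comes
   from a Hoelder estimate by doubling of variables, applied to the difference quotients of mollified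
   solutions. *)
theory Submission
  imports Defs
begin

subsection \<open>Integrals over dyadic shells\<close>

text \<open>The distributional equation is used only once: tested with translates of a bump, it
  shows that a mollification of \<open>u\<close> solves the equation pointwise wherever a small ball
  lies in the ring. \<open>weakly_harmonic\<close> records this; the estimates are proved for such
  approximants with constants independent of the approximation and then pass to the limit. The
  obstacle is regularity. Difference quotients solve the equation inside the ring, but away from a
  small ball they have no bound uniform in the increment, while the operator sees the whole space.
  The kernel is therefore split into a part supported in the unit ball, for which a Hoelder estimate
  from local bounds suffices, and a bounded Lipschitz part, to which the increment is transferred.
  Nonlocality also helps: Harnack's inequality is needed only as a bound of the mass on an annulus
  by the value at its centre, and one ball suffices in place of a chain of balls.\<close>

lemma
  fixes f :: "'a::euclidean_space \<Rightarrow> real"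
  assumes [measurable]: "f \<in> borel_measurable borel" and c: "c \<noteq> 0"
  shows lborel_integral_affine:
      "(LINT x|lborel. f x) = \<bar>c\<bar> ^ DIM('a) * (LINT x|lborel. f (t + c *\<^sub>R x))"
    and lborel_integrable_affine_iff:
      "integrable lborel (\<lambda>x. f (t + c *\<^sub>R x)) \<longleftrightarrow> integrable lborel f"
proof -
  let ?T = "\<lambda>x::'a. t + c *\<^sub>R x"
  have [measurable]: "?T \<in> borel_measurable borel" by measurable
  have eq: "(lborel :: 'a measure) = density (distr lborel borel ?T) (\<lambda>_. ennreal (\<bar>c\<bar> ^ DIM('a)))"
    using lborel_affine[OF c, of t] by (simp add: ennreal_power)
  show "(LINT x|lborel. f x) = \<bar>c\<bar> ^ DIM('a) * (LINT x|lborel. f (?T x))"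
    by (subst eq, subst integral_density) (auto simp: integral_distr)
  have "integrable lborel f \<longleftrightarrow> integrable (density (distr lborel borel ?T) (\<lambda>_. ennreal (\<bar>c\<bar> ^ DIM('a)))) f"
    using eq by simp
  also have "\<dots> \<longleftrightarrow> integrable (distr lborel borel ?T) (\<lambda>x. \<bar>c\<bar> ^ DIM('a) * f x)"
    by (subst integrable_density) auto
  also have "\<dots> \<longleftrightarrow> integrable lborel (\<lambda>x. \<bar>c\<bar> ^ DIM('a) * f (?T x))"
    by (subst integrable_distr_eq) auto
  also have "\<dots> \<longleftrightarrow> integrable lborel (\<lambda>x. f (?T x))"
    using c by simp
  finally show "integrable lborel (\<lambda>x. f (?T x)) \<longleftrightarrow> integrable lborel f" by simp
qed

lemma
  fixes f :: "'a::euclidean_space \<Rightarrow> real"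
  assumes [measurable]: "f \<in> borel_measurable borel"
  shows lborel_integral_shift: "(LINT x|lborel. f (t + x)) = (LINT x|lborel. f x)"
    and lborel_integrable_shift: "integrable lborel (\<lambda>x. f (t + x)) \<longleftrightarrow> integrable lborel f"
    and lborel_integral_reflect: "(LINT x|lborel. f (- x)) = (LINT x|lborel. f x)"
    and lborel_integrable_reflect: "integrable lborel (\<lambda>x. f (- x)) \<longleftrightarrow> integrable lborel f"
  using lborel_integral_affine[of f 1 t] lborel_integrable_affine_iff[of f 1 t]
    lborel_integral_affine[of f "-1" 0] lborel_integrable_affine_iff[of f "-1" 0] assms
  by auto

lemma integrable_bound_measurable:
  fixes f g :: "'a::euclidean_space \<Rightarrow> real"
  assumes "integrable lborel g" and "f \<in> borel_measurable borel"
    and "\<And>x. \<bar>f x\<bar> \<le> g x"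
  shows "integrable lborel f"
proof (rule Bochner_Integration.integrable_bound[OF assms(1)])
  show "f \<in> borel_measurable lborel" using assms(2) by simp
  show "AE x in lborel. norm (f x) \<le> norm (g x)"
    using assms(3) by (intro AE_I2) (metis abs_ge_self order_trans real_norm_def)
qed

text \<open>By the covering hypothesis \<open>f\<close> lies below the sum of \<open>c j\<close>
  times the indicator of the ball of radius \<open>R j\<close>. Whole balls are used in place of
  shells: their volume is known exactly and the loss is a constant factor.\<close>

lemma shell_integral_bound:
  fixes f :: "'a::euclidean_space \<Rightarrow> real"
  assumes [measurable]: "f \<in> borel_measurable borel"
    and nonneg: "\<And>z. 0 \<le> f z" "\<And>j::nat. 0 \<le> c j" "\<And>j. 0 \<le> R j"
    and cover: "\<And>z. f z \<noteq> 0 \<Longrightarrow> \<exists>j. norm z \<le> R j \<and> f z \<le> c j"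
    and sums: "(\<lambda>j. c j * R j ^ DIM('a)) sums s"
  shows "integrable lborel f \<and> (LINT z|lborel. f z) \<le> unit_ball_vol (real DIM('a)) * s"
proof -
  let ?V = "unit_ball_vol (real DIM('a))"
  have V: "0 \<le> ?V" by (simp add: less_imp_le)
  have [measurable]: "cball (0::'a) (R j) \<in> sets borel" for j
    by (simp add: borel_closed)
  have s: "0 \<le> s"
    by (rule sums_le[OF _ sums_zero sums]) (simp add: nonneg)
  have "(\<integral>\<^sup>+z. ennreal (f z) \<partial>lborel)
      \<le> (\<integral>\<^sup>+z. (\<Sum>j. ennreal (c j) * indicator (cball (0::'a) (R j)) z) \<partial>lborel)"
  proof (intro nn_integral_mono)
    fix z :: 'a
    show "ennreal (f z) \<le> (\<Sum>j. ennreal (c j) * indicator (cball (0::'a) (R j)) z)"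
    proof (cases "f z = 0")
      case False
      then obtain j where j: "norm z \<le> R j" "f z \<le> c j" using cover by blast
      have "ennreal (f z) \<le> (\<Sum>i\<in>{j}. ennreal (c i) * indicator (cball (0::'a) (R i)) z)"
        using j by (simp add: ennreal_leI indicator_def)
      also have "\<dots> \<le> (\<Sum>j. ennreal (c j) * indicator (cball (0::'a) (R j)) z)"
        by (rule sum_le_suminf) auto
      finally show ?thesis .
    qed simp
  qed
  also have "\<dots> = (\<Sum>j. \<integral>\<^sup>+z. ennreal (c j) * indicator (cball (0::'a) (R j)) z \<partial>lborel)"
    by (rule nn_integral_suminf) measurable
  also have "\<dots> = (\<Sum>j. ennreal (?V * (c j * R j ^ DIM('a))))"
  proof (intro suminf_cong)
    fix j
    have "(\<integral>\<^sup>+z. ennreal (c j) * indicator (cball (0::'a) (R j)) z \<partial>lborel)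
        = ennreal (c j) * ennreal (?V * R j ^ DIM('a))"
      using nonneg by (simp add: nn_integral_cmult_indicator emeasure_cball)
    also have "\<dots> = ennreal (c j * (?V * R j ^ DIM('a)))"
      using nonneg V by (intro ennreal_mult[symmetric]) auto
    finally show "(\<integral>\<^sup>+z. ennreal (c j) * indicator (cball (0::'a) (R j)) z \<partial>lborel)
        = ennreal (?V * (c j * R j ^ DIM('a)))"
      by (simp only: mult.left_commute)
  qed
  also have "\<dots> = ennreal (?V * s)"
    using sums_mult[OF sums, of ?V] V nonneg
    by (subst suminf_ennreal_eq[of _ "?V * s"]) auto
  finally have le: "(\<integral>\<^sup>+z. ennreal (f z) \<partial>lborel) \<le> ennreal (?V * s)" .
  have int: "integrable lborel f"
    using le nonneg by (intro integrableI_nonneg) (auto simp: less_top[symmetric] top_unique)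
  moreover have "(LINT z|lborel. f z) \<le> ?V * s"
    using le int nonneg V s
    by (subst (asm) nn_integral_eq_integral) (auto simp: ennreal_le_iff)
  ultimately show ?thesis by blast
qed

lemma dyadic_scale:
  fixes t :: real
  assumes "1 \<le> t"
  obtains j :: nat where "2 ^ j \<le> t" "t < 2 ^ Suc j"
proof -
  let ?P = "\<lambda>j::nat. t < 2 ^ j"
  obtain n where n: "?P n" using real_arch_pow[of 2 t] by auto
  have "?P (LEAST j. ?P j)" using n by (rule LeastI)
  moreover have "(LEAST j. ?P j) \<noteq> 0" using calculation assms by (intro notI) simp
  then obtain j where j: "(LEAST j. ?P j) = Suc j" using not0_implies_Suc by blast
  ultimately have "?P (Suc j)" by simp
  moreover have "\<not> ?P j" using j not_less_Least[of j ?P] by simp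
  ultimately show ?thesis using that by (simp add: not_less)
qed

text \<open>Dyadic shells starting at radius \<open>r\<close> contribute a geometric series with
  ratio \<open>2 powr - \<beta>\<close>, and the dependence on \<open>r\<close> factors out as
  \<open>r powr - \<beta>\<close>.\<close>

lemma powr_tail_integral:
  assumes \<beta>: "0 < \<beta>"
  shows "\<exists>C>0. \<forall>r>0. integrable lborel
       (\<lambda>z::'a::euclidean_space. indicator {z. r \<le> norm z} z * norm z powr - (real DIM('a) + \<beta>))
     \<and> (LINT z|lborel. indicator {z::'a. r \<le> norm z} z * norm z powr - (real DIM('a) + \<beta>))
         \<le> C * r powr - \<beta>"
proof -
  let ?N = "DIM('a)"
  let ?V = "unit_ball_vol (real ?N)"
  let ?q = "2 powr - \<beta> :: real"
  have q: "0 < ?q" "?q < 1" using \<beta> by (auto simp: powr_less_one)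
  define C where "C = ?V * (2 ^ ?N / (1 - ?q))"
  have C: "C > 0" using q by (simp add: C_def)
  moreover have "integrable lborel (\<lambda>z::'a. indicator {z. r \<le> norm z} z * norm z powr - (real ?N + \<beta>))
     \<and> (LINT z|lborel. indicator {z::'a. r \<le> norm z} z * norm z powr - (real ?N + \<beta>)) \<le> C * r powr - \<beta>"
    if r: "r > 0" for r
  proof -
    let ?f = "\<lambda>z::'a. indicator {z. r \<le> norm z} z * norm z powr - (real ?N + \<beta>)"
    define c where "c = (\<lambda>j::nat. (2 ^ j * r) powr - (real ?N + \<beta>))"
    define R where "R = (\<lambda>j::nat. 2 ^ Suc j * r)"
    have "c j * R j ^ ?N = r powr - \<beta> * 2 ^ ?N * ?q ^ j" for j
    proof -
      have 1: "R j ^ ?N = 2 ^ ?N * (2 ^ j * r) powr real ?N"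
        using r by (simp add: R_def powr_realpow power_mult_distrib)
      have "c j * R j ^ ?N = 2 ^ ?N * (2 ^ j * r) powr - \<beta>"
        unfolding 1 c_def using r by (simp add: powr_add[symmetric])
      also have "(2 ^ j * r) powr - \<beta> = ?q ^ j * r powr - \<beta>"
        using r by (simp add: powr_mult powr_realpow[symmetric] powr_powr mult.commute)
      finally show ?thesis by simp
    qed
    moreover have "(\<lambda>j. r powr - \<beta> * 2 ^ ?N * ?q ^ j) sums (r powr - \<beta> * 2 ^ ?N * (1 / (1 - ?q)))"
      using q by (intro sums_mult geometric_sums) auto
    ultimately have sums: "(\<lambda>j. c j * R j ^ ?N) sums (r powr - \<beta> * 2 ^ ?N * (1 / (1 - ?q)))"
      by simp
    have "integrable lborel ?f \<and> (LINT z|lborel. ?f z) \<le> ?V * (r powr - \<beta> * 2 ^ ?N * (1 / (1 - ?q)))"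
    proof (rule shell_integral_bound[OF _ _ _ _ _ sums])
      show "?f \<in> borel_measurable borel" by measurable
      fix z :: 'a
      assume "?f z \<noteq> 0"
      then have z: "r \<le> norm z" by (auto simp: indicator_def split: if_splits)
      obtain j where j: "2 ^ j \<le> norm z / r" "norm z / r < 2 ^ Suc j"
        using dyadic_scale[of "norm z / r"] z r by auto
      have "norm z \<le> R j" using j r by (simp add: R_def field_simps)
      moreover have "?f z \<le> c j"
        using z j r \<beta> by (auto simp: c_def field_simps intro!: powr_mono2')
      ultimately show "\<exists>j. norm z \<le> R j \<and> ?f z \<le> c j" by blast
    qed (use r in \<open>auto simp: c_def R_def indicator_def\<close>)
    moreover have "?V * (r powr - \<beta> * 2 ^ ?N * (1 / (1 - ?q))) = C * r powr - \<beta>"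
      by (simp add: C_def)
    ultimately show ?thesis by simp
  qed
  ultimately show ?thesis by blast
qed

text \<open>Dyadic shells shrinking to the origin contribute multiples of
  \<open>2 powr ((\<alpha> - 2) * j)\<close>; thus \<open>\<alpha> < 2\<close> is what lets the
  factor \<open>(norm z)\<^sup>2\<close> compensate the singularity.\<close>

lemma powr_core_integrable:
  assumes \<alpha>: "0 < \<alpha>" "\<alpha> < 2"
  shows "integrable lborel (\<lambda>z::'a::euclidean_space.
           indicator {z. norm z < 1} z * ((norm z)\<^sup>2 * norm z powr - (real DIM('a) + \<alpha>)))"
    (is "integrable _ ?f")
proof -
  let ?N = "DIM('a)"
  let ?p = "real ?N + \<alpha>"
  let ?q = "2 powr (\<alpha> - 2) :: real"
  have q: "0 < ?q" "?q < 1" using \<alpha> by (auto simp: powr_less_one)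
  \<comment> \<open>On the shell between \<open>1 / 2 ^ Suc j\<close> and \<open>1 / 2 ^ j\<close>
    the square is taken at the outer radius and the decreasing power at the inner one.\<close>
  define c where "c = (\<lambda>j::nat. (1 / 2 ^ j)\<^sup>2 * (1 / 2 ^ Suc j) powr - ?p)"
  define R where "R = (\<lambda>j::nat. 1 / 2 ^ j :: real)"
  have "c j * R j ^ ?N = 2 powr ?p * ?q ^ j" for j
  proof -
    have pow: "1 / 2 ^ i = (2::real) powr (- real i)" for i
      by (simp only: powr_minus powr_realpow divide_inverse zero_less_numeral mult_1)
    have powp: "((2::real) powr x) ^ i = 2 powr (x * real i)" for x i
      by (subst powr_realpow[symmetric]) (simp_all only: powr_powr powr_gt_zero)
    have a: "(1 / 2 ^ j)\<^sup>2 = (2::real) powr (- 2 * real j)"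
      unfolding pow powp by (simp add: mult.commute)
    have b: "(1 / 2 ^ Suc j) powr - ?p = (2::real) powr ((real j + 1) * ?p)"
      unfolding pow powr_powr by (simp add: algebra_simps)
    have c: "(1 / 2 ^ j) ^ ?N = (2::real) powr (- real j * real ?N)"
      unfolding pow powp by simp
    have d: "?q ^ j = 2 powr ((\<alpha> - 2) * real j)"
      by (rule powp)
    show ?thesis unfolding c_def R_def a b c d
      by (simp add: powr_add[symmetric] algebra_simps)
  qed
  moreover have "(\<lambda>j. 2 powr ?p * ?q ^ j) sums (2 powr ?p * (1 / (1 - ?q)))"
    using q by (intro sums_mult geometric_sums) auto
  ultimately have sums: "(\<lambda>j. c j * R j ^ ?N) sums (2 powr ?p * (1 / (1 - ?q)))" by simp
  have "integrable lborel ?f \<and> (LINT z|lborel. ?f z) \<le> unit_ball_vol (real ?N) * (2 powr ?p * (1 / (1 - ?q)))"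
  proof (rule shell_integral_bound[OF _ _ _ _ _ sums])
    show "?f \<in> borel_measurable borel" by measurable
    fix z :: 'a
    assume "?f z \<noteq> 0"
    then have z: "norm z < 1" "norm z > 0" by (auto simp: indicator_def split: if_splits)
    obtain j where j: "2 ^ j \<le> 1 / norm z" "1 / norm z < 2 ^ Suc j"
      using dyadic_scale[of "1 / norm z"] z by auto
    have j1: "norm z \<le> 1 / 2 ^ j" using j z by (simp add: field_simps)
    have j2: "1 / 2 ^ Suc j \<le> norm z" using j z by (simp add: field_simps)
    have "norm z \<le> R j" using j1 by (simp add: R_def)
    moreover have "?f z \<le> c j"
      unfolding c_def using z j1 j2 \<alpha>
      by (auto intro!: mult_mono power_mono powr_mono2')
    ultimately show "\<exists>j. norm z \<le> R j \<and> ?f z \<le> c j" by blast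
  qed (auto simp: c_def R_def indicator_def)
  then show ?thesis by blast
qed

subsection \<open>Second differences and jump kernels\<close>

definition second_diff :: "('a::euclidean_space \<Rightarrow> real) \<Rightarrow> 'a \<Rightarrow> 'a \<Rightarrow> real" where
  "second_diff w x z = w (x + z) + w (x - z) - 2 * w x"

definition riesz :: "real \<Rightarrow> 'a::euclidean_space \<Rightarrow> real" where
  "riesz \<alpha> z = norm z powr - (real DIM('a) + \<alpha>)"

text \<open>Pairing the jumps \<open>z\<close> and \<open>- z\<close> makes the singular integral
  absolutely convergent, so no principal value is needed. For \<open>riesz\<close> it is a negative
  multiple of the fractional Laplacian (\<open>frac_laplacian_tame\<close>), hence nonnegative at a
  global minimum.\<close>

definition jump_op ::
    "('a::euclidean_space \<Rightarrow> real) \<Rightarrow> ('a \<Rightarrow> real) \<Rightarrow> 'a \<Rightarrow> real" where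
  "jump_op \<kappa> w x = (LINT z|lborel. second_diff w x z * \<kappa> z)"

text \<open>The quadratic bound stands in for bounded second derivatives. It is what the integral
  needs near \<open>z = 0\<close>, and it passes to sums, dilations, translations and convolutions
  without calculus.\<close>

definition tame :: "('a::euclidean_space \<Rightarrow> real) \<Rightarrow> bool" where
  "tame w \<longleftrightarrow> continuous_on UNIV w \<and> bounded (range w) \<and>
     (\<exists>C. \<forall>x z. \<bar>second_diff w x z\<bar> \<le> C * (norm z)\<^sup>2)"

text \<open>Integrability and linearity are needed for the full kernel and for its local part
  \<open>riesz_core\<close>; this domination serves both.\<close>

definition below_riesz :: "real \<Rightarrow> ('a::euclidean_space \<Rightarrow> real) \<Rightarrow> bool" where
  "below_riesz \<alpha> \<kappa> \<longleftrightarrow>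
     \<kappa> \<in> borel_measurable borel \<and> (\<forall>z. 0 \<le> \<kappa> z \<and> \<kappa> z \<le> riesz \<alpha> z)"

lemma riesz_measurable [measurable]: "riesz \<alpha> \<in> borel_measurable borel"
  unfolding riesz_def by measurable

lemma riesz_nonneg [simp]: "0 \<le> riesz \<alpha> z"
  by (simp add: riesz_def)

lemma riesz_minus [simp]: "riesz \<alpha> (- z) = riesz \<alpha> z"
  by (simp add: riesz_def)

lemma riesz_scale:
  fixes z :: "'a::euclidean_space"
  shows "0 < c \<Longrightarrow> riesz \<alpha> (c *\<^sub>R z) = c powr - (real DIM('a) + \<alpha>) * riesz \<alpha> z"
  by (simp add: riesz_def powr_mult)

lemma below_riesz_self: "below_riesz \<alpha> (riesz \<alpha>)"
  by (simp add: below_riesz_def riesz_measurable)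

lemma riesz_tail:
  assumes "0 < \<alpha>" "0 < r"
  shows "integrable lborel (\<lambda>z::'a::euclidean_space. indicator {z. r \<le> norm z} z * riesz \<alpha> z)"
  using powr_tail_integral[OF assms(1), where 'a='a] assms(2) unfolding riesz_def by blast

lemma riesz_truncated_integrable:
  assumes "0 < \<alpha>" "\<alpha> < 2"
  shows "integrable lborel (\<lambda>z::'a::euclidean_space. min 1 ((norm z)\<^sup>2) * riesz \<alpha> z)"
proof -
  have "integrable lborel (\<lambda>z::'a. indicator {z. norm z < 1} z * ((norm z)\<^sup>2 * riesz \<alpha> z)
      + indicator {z. 1 \<le> norm z} z * riesz \<alpha> z)"
    using powr_core_integrable[OF assms, where 'a='a] riesz_tail[OF assms(1), of 1]
    by (intro Bochner_Integration.integrable_add) (simp_all add: riesz_def)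
  then show ?thesis
  proof (rule integrable_bound_measurable)
    show "(\<lambda>z::'a. min 1 ((norm z)\<^sup>2) * riesz \<alpha> z) \<in> borel_measurable borel" by measurable
    fix z :: 'a
    show "\<bar>min 1 ((norm z)\<^sup>2) * riesz \<alpha> z\<bar> \<le> indicator {z. norm z < 1} z * ((norm z)\<^sup>2 * riesz \<alpha> z)
      + indicator {z. 1 \<le> norm z} z * riesz \<alpha> z"
      by (auto simp: indicator_def abs_mult intro!: mult_right_mono mult_left_le_one_le)
  qed
qed

lemma continuous_borel: "continuous_on UNIV w \<Longrightarrow> w \<in> borel_measurable borel"
  by (rule borel_measurable_continuous_onI)

lemma tame_continuous: "tame w \<Longrightarrow> continuous_on UNIV w"
  by (simp add: tame_def)

lemma tame_measurable: "tame w \<Longrightarrow> w \<in> borel_measurable borel"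
  by (simp add: tame_def continuous_borel)

lemma tame_bounded:
  assumes "tame w" obtains M where "\<And>x. \<bar>w x\<bar> \<le> M"
  using assms unfolding tame_def bounded_iff by auto

lemma second_diff_measurable:
  assumes "w \<in> borel_measurable borel"
  shows "second_diff w x \<in> borel_measurable borel"
  using assms unfolding second_diff_def[abs_def] by measurable

lemma tame_second_diff:
  assumes "tame w"
  obtains C where "0 \<le> C" "\<And>x z. \<bar>second_diff w x z\<bar> \<le> C * min 1 ((norm z)\<^sup>2)"
proof -
  obtain M where M: "\<And>x. \<bar>w x\<bar> \<le> M" using tame_bounded[OF assms] by blast
  obtain C where C: "\<And>x z. \<bar>second_diff w x z\<bar> \<le> C * (norm z)\<^sup>2"
    using assms unfolding tame_def by blast
  let ?C = "max (4 * M) (max C 0)"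
  have "\<bar>second_diff w x z\<bar> \<le> ?C * min 1 ((norm z)\<^sup>2)" for x z
  proof (cases "(norm z)\<^sup>2 \<le> 1")
    case True
    then have "\<bar>second_diff w x z\<bar> \<le> C * min 1 ((norm z)\<^sup>2)"
      using C[of x z] by (simp add: min_absorb2)
    also have "\<dots> \<le> ?C * min 1 ((norm z)\<^sup>2)" by (intro mult_right_mono) auto
    finally show ?thesis .
  next
    case False
    then show ?thesis
      using M[of "x + z"] M[of "x - z"] M[of x] by (simp add: second_diff_def)
  qed
  moreover have "0 \<le> ?C" by simp
  ultimately show ?thesis using that by blast
qed

lemma jump_op_integrable:
  fixes w :: "'a::euclidean_space \<Rightarrow> real"
  assumes \<alpha>: "0 < \<alpha>" "\<alpha> < 2" and w: "tame w" and \<kappa>: "below_riesz \<alpha> \<kappa>"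
  shows "integrable lborel (\<lambda>z. second_diff w x z * \<kappa> z)"
proof -
  obtain C where C: "0 \<le> C" "\<And>x z. \<bar>second_diff w x z\<bar> \<le> C * min 1 ((norm z)\<^sup>2)"
    using tame_second_diff[OF w] by blast
  have [measurable]: "\<kappa> \<in> borel_measurable borel" "w \<in> borel_measurable borel"
    using \<kappa> tame_measurable[OF w] by (simp_all add: below_riesz_def)
  have "integrable lborel (\<lambda>z::'a. C * (min 1 ((norm z)\<^sup>2) * riesz \<alpha> z))"
    using riesz_truncated_integrable[OF \<alpha>, where 'a='a] by simp
  then show ?thesis
  proof (rule integrable_bound_measurable)
    show "(\<lambda>z. second_diff w x z * \<kappa> z) \<in> borel_measurable borel"
      unfolding second_diff_def by measurable
    fix z
    have "0 \<le> \<kappa> z" "\<kappa> z \<le> riesz \<alpha> z" using \<kappa> by (auto simp: below_riesz_def)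
    then have "\<bar>second_diff w x z\<bar> * \<kappa> z \<le> (C * min 1 ((norm z)\<^sup>2)) * riesz \<alpha> z"
      using C by (intro mult_mono) auto
    then show "\<bar>second_diff w x z * \<kappa> z\<bar> \<le> C * (min 1 ((norm z)\<^sup>2) * riesz \<alpha> z)"
      using \<open>0 \<le> \<kappa> z\<close> by (simp add: abs_mult)
  qed
qed

lemma second_diff_combine:
  "second_diff (\<lambda>x. a * v x + b * w x + c) x z = a * second_diff v x z + b * second_diff w x z"
  by (simp add: second_diff_def algebra_simps)

lemma tame_combine:
  assumes "tame v" "tame w"
  shows "tame (\<lambda>x. a * v x + b * w x + c)"
proof -
  obtain M where M: "\<And>x. \<bar>v x\<bar> \<le> M" using tame_bounded[OF assms(1)] by blast
  obtain K where K: "\<And>x. \<bar>w x\<bar> \<le> K" using tame_bounded[OF assms(2)] by blast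
  obtain C where C: "\<And>x z. \<bar>second_diff v x z\<bar> \<le> C * (norm z)\<^sup>2"
    using assms(1) unfolding tame_def by blast
  obtain D where D: "\<And>x z. \<bar>second_diff w x z\<bar> \<le> D * (norm z)\<^sup>2"
    using assms(2) unfolding tame_def by blast
  have "continuous_on UNIV (\<lambda>x. a * v x + b * w x + c)"
    by (intro continuous_intros tame_continuous assms)
  moreover have "bounded (range (\<lambda>x. a * v x + b * w x + c))"
  proof (unfold bounded_iff, intro exI ballI)
    fix y assume "y \<in> range (\<lambda>x. a * v x + b * w x + c)"
    then obtain x where y: "y = a * v x + b * w x + c" by blast
    have "\<bar>a * v x\<bar> \<le> \<bar>a\<bar> * M" "\<bar>b * w x\<bar> \<le> \<bar>b\<bar> * K"
      using M[of x] K[of x] by (auto simp: abs_mult intro: mult_left_mono)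
    then show "norm y \<le> \<bar>a\<bar> * M + \<bar>b\<bar> * K + \<bar>c\<bar>" unfolding y real_norm_def by linarith
  qed
  moreover have "\<bar>second_diff (\<lambda>x. a * v x + b * w x + c) x z\<bar>
      \<le> (\<bar>a\<bar> * C + \<bar>b\<bar> * D) * (norm z)\<^sup>2" for x z
  proof -
    have "\<bar>a * second_diff v x z\<bar> \<le> \<bar>a\<bar> * (C * (norm z)\<^sup>2)"
      "\<bar>b * second_diff w x z\<bar> \<le> \<bar>b\<bar> * (D * (norm z)\<^sup>2)"
      using C[of x z] D[of x z] by (auto simp: abs_mult intro: mult_left_mono)
    then show ?thesis unfolding second_diff_combine by (simp add: algebra_simps)
  qed
  ultimately show ?thesis unfolding tame_def by blast
qed

lemma jump_op_combine:
  assumes "0 < \<alpha>" "\<alpha> < 2" "below_riesz \<alpha> \<kappa>" "tame v" "tame w"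
  shows "jump_op \<kappa> (\<lambda>x. a * v x + b * w x + c) x = a * jump_op \<kappa> v x + b * jump_op \<kappa> w x"
proof -
  have "jump_op \<kappa> (\<lambda>x. a * v x + b * w x + c) x
      = (LINT z|lborel. a * (second_diff v x z * \<kappa> z) + b * (second_diff w x z * \<kappa> z))"
    unfolding jump_op_def second_diff_combine by (simp add: algebra_simps)
  also have "\<dots> = a * jump_op \<kappa> v x + b * jump_op \<kappa> w x"
    unfolding jump_op_def
    using jump_op_integrable[OF assms(1,2,4,3)] jump_op_integrable[OF assms(1,2,5,3)]
    by (subst Bochner_Integration.integral_add) simp_all
  finally show ?thesis .
qed

lemma second_diff_affine:
  "second_diff (\<lambda>x. w (t + c *\<^sub>R x)) x z = second_diff w (t + c *\<^sub>R x) (c *\<^sub>R z)"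
  by (simp add: second_diff_def algebra_simps)

lemma tame_affine:
  assumes "tame w"
  shows "tame (\<lambda>x. w (t + c *\<^sub>R x))"
proof -
  obtain C where C: "\<And>x z. \<bar>second_diff w x z\<bar> \<le> C * (norm z)\<^sup>2"
    using assms unfolding tame_def by blast
  have "continuous_on UNIV (\<lambda>x. w (t + c *\<^sub>R x))"
    by (rule continuous_on_compose2[OF tame_continuous[OF assms]]) (auto intro!: continuous_intros)
  moreover have "bounded (range (\<lambda>x. w (t + c *\<^sub>R x)))"
    using assms by (auto simp: tame_def intro: bounded_subset)
  moreover have "\<bar>second_diff (\<lambda>x. w (t + c *\<^sub>R x)) x z\<bar> \<le> (C * c\<^sup>2) * (norm z)\<^sup>2" for x z
    unfolding second_diff_affine using C[of "t + c *\<^sub>R x" "c *\<^sub>R z"]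
    by (simp add: power_mult_distrib mult.assoc)
  ultimately show ?thesis unfolding tame_def by blast
qed

text \<open>The operator has order \<open>\<alpha>\<close>: expressing \<open>riesz\<close> at the
  dilated jump costs \<open>c powr (?N + \<alpha>)\<close>, and the change of variables gives back
  \<open>c powr ?N\<close>.\<close>

lemma jump_op_affine:
  fixes w :: "'a::euclidean_space \<Rightarrow> real"
  assumes w: "tame w" and c: "0 < c"
  shows "jump_op (riesz \<alpha>) (\<lambda>x. w (t + c *\<^sub>R x)) x = c powr \<alpha> * jump_op (riesz \<alpha>) w (t + c *\<^sub>R x)"
proof -
  let ?N = "real DIM('a)"
  let ?y = "t + c *\<^sub>R x"
  let ?f = "\<lambda>z. second_diff w ?y z * riesz \<alpha> z"
  have [measurable]: "?f \<in> borel_measurable borel"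
    using second_diff_measurable[OF tame_measurable[OF w], of ?y] by measurable
  have eq: "second_diff (\<lambda>x. w (t + c *\<^sub>R x)) x z * riesz \<alpha> z = c powr (?N + \<alpha>) * ?f (c *\<^sub>R z)" for z
  proof -
    have "c powr (?N + \<alpha>) * c powr - (?N + \<alpha>) = 1"
      using c by (simp only: powr_add[symmetric] add.right_inverse powr_zero_eq_one) simp
    then show ?thesis
      unfolding second_diff_affine riesz_scale[OF c] by (metis mult.assoc mult.commute mult_1)
  qed
  have "jump_op (riesz \<alpha>) (\<lambda>x. w (t + c *\<^sub>R x)) x
      = c powr (?N + \<alpha>) * (LINT z|lborel. ?f (c *\<^sub>R z))"
    unfolding jump_op_def eq by simp
  moreover have "jump_op (riesz \<alpha>) w ?y = c powr ?N * (LINT z|lborel. ?f (c *\<^sub>R z))"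
    unfolding jump_op_def using lborel_integral_affine[of ?f c 0] c by (simp add: powr_realpow)
  ultimately show ?thesis by (simp add: powr_add)
qed

lemma jump_op_shift:
  "jump_op \<kappa> (\<lambda>x. w (x + t)) x = jump_op \<kappa> w (x + t)"
  unfolding jump_op_def second_diff_def by (simp add: algebra_simps)

lemma tame_shift: "tame w \<Longrightarrow> tame (\<lambda>x. w (x + t))"
  using tame_affine[of w t 1] by (simp add: add.commute)

subsection \<open>Maximum principle and Harnack inequality\<close>

text \<open>This replaces the distributional equation by uniform approximation with functions on
  which the operator acts pointwise. Closeness is required on the whole space because the operator
  is nonlocal; one \<open>\<delta>\<close> measures both the error and the margin inside
  \<open>G\<close>, as for mollification at that scale.\<close>

definition weakly_harmonic :: "real \<Rightarrow> 'a::euclidean_space set \<Rightarrow> ('a \<Rightarrow> real) \<Rightarrow> bool" where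
  "weakly_harmonic \<alpha> G v \<longleftrightarrow>
     (\<forall>\<delta>>0. \<exists>w. tame w \<and> (\<forall>x. \<bar>w x - v x\<bar> \<le> \<delta>) \<and>
        (\<forall>x. cball x \<delta> \<subseteq> G \<longrightarrow> jump_op (riesz \<alpha>) w x = 0))"

lemma weakly_harmonic_mono:
  "weakly_harmonic \<alpha> G v \<Longrightarrow> H \<subseteq> G \<Longrightarrow> weakly_harmonic \<alpha> H v"
  unfolding weakly_harmonic_def by (metis (no_types, lifting) order_trans)

lemma weakly_harmonic_combine:
  assumes \<alpha>: "0 < \<alpha>" "\<alpha> < 2"
    and u: "weakly_harmonic \<alpha> G u" and v: "weakly_harmonic \<alpha> H v"
  shows "weakly_harmonic \<alpha> (G \<inter> H) (\<lambda>x. a * u x + b * v x + c)"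
  unfolding weakly_harmonic_def
proof (intro allI impI)
  fix \<delta> :: real assume \<delta>: "\<delta> > 0"
  define \<eta> where "\<eta> = \<delta> / (\<bar>a\<bar> + \<bar>b\<bar> + 1)"
  have \<eta>: "0 < \<eta>" "(\<bar>a\<bar> + \<bar>b\<bar> + 1) * \<eta> = \<delta>"
  proof -
    have "\<bar>a\<bar> + \<bar>b\<bar> + 1 > 0" by linarith
    then show "0 < \<eta>" "(\<bar>a\<bar> + \<bar>b\<bar> + 1) * \<eta> = \<delta>"
      using \<delta> by (simp_all add: \<eta>_def)
  qed
  have "0 \<le> \<bar>a\<bar> * \<eta>" "0 \<le> \<bar>b\<bar> * \<eta>" using \<eta>(1) by simp_all
  moreover have "\<bar>a\<bar> * \<eta> + \<bar>b\<bar> * \<eta> + \<eta> = \<delta>"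
    using \<eta>(2) by (simp add: algebra_simps)
  ultimately have \<eta>\<delta>: "\<eta> \<le> \<delta>" "\<bar>a\<bar> * \<eta> + \<bar>b\<bar> * \<eta> \<le> \<delta>"
    using \<eta>(1) by linarith+
  obtain w where w: "tame w" "\<And>x. \<bar>w x - u x\<bar> \<le> \<eta>"
    "\<And>x. cball x \<eta> \<subseteq> G \<Longrightarrow> jump_op (riesz \<alpha>) w x = 0"
    using u \<eta>(1) unfolding weakly_harmonic_def by blast
  obtain w' where w': "tame w'" "\<And>x. \<bar>w' x - v x\<bar> \<le> \<eta>"
    "\<And>x. cball x \<eta> \<subseteq> H \<Longrightarrow> jump_op (riesz \<alpha>) w' x = 0"
    using v \<eta>(1) unfolding weakly_harmonic_def by blast
  let ?w = "\<lambda>x. a * w x + b * w' x + c"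
  show "\<exists>w. tame w \<and> (\<forall>x. \<bar>w x - (a * u x + b * v x + c)\<bar> \<le> \<delta>) \<and>
        (\<forall>x. cball x \<delta> \<subseteq> G \<inter> H \<longrightarrow> jump_op (riesz \<alpha>) w x = 0)"
  proof (intro exI[of _ ?w] conjI allI impI)
    show "tame ?w" by (rule tame_combine[OF w(1) w'(1)])
    fix x
    have "\<bar>?w x - (a * u x + b * v x + c)\<bar> = \<bar>a * (w x - u x) + b * (w' x - v x)\<bar>"
      by (simp add: algebra_simps)
    also have "\<dots> \<le> \<bar>a\<bar> * \<bar>w x - u x\<bar> + \<bar>b\<bar> * \<bar>w' x - v x\<bar>"
      by (metis abs_mult abs_triangle_ineq)
    also have "\<dots> \<le> \<bar>a\<bar> * \<eta> + \<bar>b\<bar> * \<eta>"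
      using w(2) w'(2) by (intro add_mono mult_left_mono) auto
    finally show "\<bar>?w x - (a * u x + b * v x + c)\<bar> \<le> \<delta>" using \<eta>\<delta> by linarith
    assume "cball x \<delta> \<subseteq> G \<inter> H"
    then have "cball x \<eta> \<subseteq> G" "cball x \<eta> \<subseteq> H"
      using subset_cball[OF \<eta>\<delta>(1), of x] by auto
    then show "jump_op (riesz \<alpha>) ?w x = 0"
      using jump_op_combine[OF \<alpha> below_riesz_self w(1) w'(1)] w(3) w'(3) by simp
  qed
qed

text \<open>For \<open>t \<ge> 1\<close> the image of a ball of radius \<open>\<delta>\<close>
  contains the ball of radius \<open>\<delta>\<close> around the image point, so the approximant for
  \<open>u\<close> can be dilated without adjusting the margin.\<close>

lemma weakly_harmonic_scale:
  assumes u: "weakly_harmonic \<alpha> G u" and t: "1 \<le> t"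
  shows "weakly_harmonic \<alpha> {x. t *\<^sub>R x \<in> G} (\<lambda>x. u (t *\<^sub>R x))"
  unfolding weakly_harmonic_def
proof (intro allI impI)
  fix \<delta> :: real assume \<delta>: "\<delta> > 0"
  obtain w where w: "tame w" "\<And>x. \<bar>w x - u x\<bar> \<le> \<delta>"
    "\<And>x. cball x \<delta> \<subseteq> G \<Longrightarrow> jump_op (riesz \<alpha>) w x = 0"
    using u \<delta> unfolding weakly_harmonic_def by blast
  let ?w = "\<lambda>x. w (0 + t *\<^sub>R x)"
  show "\<exists>w. tame w \<and> (\<forall>x. \<bar>w x - u (t *\<^sub>R x)\<bar> \<le> \<delta>) \<and>
        (\<forall>x. cball x \<delta> \<subseteq> {x. t *\<^sub>R x \<in> G} \<longrightarrow> jump_op (riesz \<alpha>) w x = 0)"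
  proof (intro exI[of _ ?w] conjI allI impI)
    show "tame ?w" by (rule tame_affine[OF w(1)])
    show "\<bar>?w x - u (t *\<^sub>R x)\<bar> \<le> \<delta>" for x using w(2) by simp
    fix x assume sub: "cball x \<delta> \<subseteq> {x. t *\<^sub>R x \<in> G}"
    have "cball (t *\<^sub>R x) \<delta> \<subseteq> G"
    proof
      fix y assume y: "y \<in> cball (t *\<^sub>R x) \<delta>"
      let ?z = "(1 / t) *\<^sub>R y"
      have yz: "y = t *\<^sub>R ?z" using t by simp
      then have "dist (t *\<^sub>R x) y = t * dist x ?z"
        using t by (metis abs_of_nonneg dist_norm norm_scaleR order_trans scaleR_right_diff_distrib
            zero_le_one)
      then have "t * dist x ?z \<le> \<delta>" using y by simp
      moreover have "1 * dist x ?z \<le> t * dist x ?z" using t by (intro mult_right_mono) auto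
      ultimately have "?z \<in> cball x \<delta>" by simp
      then show "y \<in> G" using sub yz by auto
    qed
    then show "jump_op (riesz \<alpha>) ?w x = 0"
      using jump_op_affine[OF w(1), of t \<alpha> 0 x] w(3) t by simp
  qed
qed

lemma ball_not_AE_excluded:
  fixes c :: "'a::euclidean_space"
  assumes "AE z in lborel. z \<notin> ball c 1"
  shows False
proof -
  have "ball c 1 \<in> null_sets lborel"
    using assms by (subst AE_iff_null_sets) auto
  then have "emeasure lborel (ball c 1) = 0" by auto
  then show False using unit_ball_vol_pos[of "real DIM('a)"]
    by (simp add: emeasure_ball del: unit_ball_vol_pos)
qed

text \<open>At a global minimum all second differences are nonnegative, so a vanishing integral
  forces them to vanish almost everywhere. But long jumps end outside \<open>G\<close>, where the
  values lie strictly above a negative minimum. The operator can be evaluated on an approximant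
  only, so the argument runs there.\<close>

lemma weakly_harmonic_minimum:
  fixes v :: "'a::euclidean_space \<Rightarrow> real"
  assumes \<alpha>: "0 < \<alpha>" "\<alpha> < 2"
    and G: "open G" "bounded G" and cont: "continuous_on UNIV v"
    and outside: "\<And>x. x \<notin> G \<Longrightarrow> 0 \<le> v x" and harm: "weakly_harmonic \<alpha> G v"
  shows "0 \<le> v y"
proof (rule ccontr)
  assume neg: "\<not> 0 \<le> v y"
  then have yG: "y \<in> G" using outside by blast
  have "compact (closure G)" using G by (simp add: compact_closure)
  moreover have "closure G \<noteq> {}" using yG closure_subset by blast
  moreover have "continuous_on (closure G) v" using cont continuous_on_subset by blast
  ultimately obtain x where x: "x \<in> closure G" "\<And>z. z \<in> closure G \<Longrightarrow> v x \<le> v z"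
    using continuous_attains_inf by metis
  define m where "m = - v x"
  have m: "m > 0" using x(2)[of y] yG closure_subset neg by (force simp: m_def)
  have vm: "- m \<le> v z" for z
    using x(2)[of z] outside[of z] m closure_subset[of G] by (cases "z \<in> G") (auto simp: m_def)
  \<comment> \<open>\<open>K\<close> is compact in \<open>G\<close>, so a small
    \<open>\<delta>\<close> makes the approximant solve the equation on all of \<open>K\<close>;
    \<open>\<delta> \<le> m / 8\<close> makes its minimum over \<open>K\<close> a minimum over the
    whole space.\<close>
  define K where "K = {z. v z \<le> - m / 2}"
  have KG: "K \<subseteq> G" using outside m by (force simp: K_def)
  have "closed K" unfolding K_def by (intro closed_Collect_le cont continuous_intros)
  then have K: "compact K" using KG G(2) bounded_subset compact_eq_bounded_closed by blast
  obtain \<rho> where \<rho>: "\<rho> > 0" "(\<Union>x\<in>K. ball x \<rho>) \<subseteq> G"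
    using compact_subset_open_imp_ball_epsilon_subset[OF K G(1) KG] by blast
  define \<delta> where "\<delta> = min (\<rho> / 2) (m / 8)"
  have \<delta>: "\<delta> > 0" "\<delta> < \<rho>" "\<delta> \<le> m / 8" using \<rho> m by (auto simp: \<delta>_def)
  obtain w where w: "tame w" "\<And>x. \<bar>w x - v x\<bar> \<le> \<delta>"
    "\<And>x. cball x \<delta> \<subseteq> G \<Longrightarrow> jump_op (riesz \<alpha>) w x = 0"
    using harm \<delta>(1) unfolding weakly_harmonic_def by blast
  have xK: "x \<in> K" using m by (simp add: K_def m_def)
  have "continuous_on K w" using tame_continuous[OF w(1)] continuous_on_subset by blast
  then obtain a where a: "a \<in> K" "\<And>z. z \<in> K \<Longrightarrow> w a \<le> w z"
    using continuous_attains_inf[OF K] xK by blast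
  have wa: "w a \<le> - m + \<delta>" using a(2)[OF xK] w(2)[of x] by (simp add: m_def)
  have min: "w a \<le> w z" for z
  proof (cases "z \<in> K")
    case False
    then have "- m / 2 < v z" by (simp add: K_def)
    then show ?thesis using w(2)[of z] wa \<delta>(3) m by linarith
  qed (rule a(2))
  have "cball a \<delta> \<subseteq> ball a \<rho>" using \<delta>(2) by auto
  then have "cball a \<delta> \<subseteq> G" using \<rho>(2) a(1) by blast
  then have "jump_op (riesz \<alpha>) w a = 0" by (rule w(3))
  moreover have nonneg: "0 \<le> second_diff w a z * riesz \<alpha> z" for z
    using min[of "a + z"] min[of "a - z"] by (simp add: second_diff_def)
  ultimately have AE0: "AE z in lborel. second_diff w a z * riesz \<alpha> z = 0"
    using jump_op_integrable[OF \<alpha> w(1) below_riesz_self, of a]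
    by (subst (asm) jump_op_def, subst (asm) integral_nonneg_eq_0_iff_AE) auto
  obtain R where R: "R > 0" "G \<subseteq> ball 0 R"
    using bounded_subset_ballD[OF G(2)] by blast
  \<comment> \<open>So far out that \<open>a + z\<close> and \<open>a - z\<close> are both outside
    \<open>G\<close> for every \<open>z\<close> in the unit ball around \<open>c\<close>.\<close>
  define c where "c = (R + norm a + 2) *\<^sub>R (SOME i. i \<in> (Basis::'a set))"
  have nc: "norm c = R + norm a + 2"
    using R by (simp add: c_def some_in_eq)
  have "second_diff w a z * riesz \<alpha> z \<noteq> 0" if "z \<in> ball c 1" for z
  proof -
    have nz: "norm z > R + norm a"
      using that nc norm_triangle_ineq2[of c z] by (simp add: dist_norm)
    have "norm (a + z) \<ge> R"  "norm (a - z) \<ge> R"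
      using nz norm_triangle_ineq2[of z "- a"] norm_triangle_ineq2[of z a]
      by (simp_all add: norm_minus_commute add.commute)
    then have "a + z \<notin> G" "a - z \<notin> G" using R(2) by auto
    then have "w (a + z) \<ge> - \<delta>" "w (a - z) \<ge> - \<delta>"
      using outside[of "a + z"] outside[of "a - z"] w(2)[of "a + z"] w(2)[of "a - z"] by auto
    then have "second_diff w a z > 0" using wa \<delta>(3) m unfolding second_diff_def by linarith
    moreover have "norm z > 0" using nz R(1) norm_ge_zero[of a] by linarith
    ultimately show ?thesis by (simp add: riesz_def)
  qed
  then have "AE z in lborel. z \<notin> ball c 1" using AE0 by (auto elim!: eventually_mono)
  then show False by (rule ball_not_AE_excluded)
qed

section \<open>Harnack inequality between an annulus and its centre\<close>

lemma bounded_indicator_integrable: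
  fixes w :: "'a::euclidean_space \<Rightarrow> real"
  assumes "S \<in> sets borel" "bounded S" "w \<in> borel_measurable borel"
    and "\<And>x. x \<in> S \<Longrightarrow> \<bar>w x\<bar> \<le> M"
  shows "integrable lborel (\<lambda>y. indicator S y * w y)"
proof (rule integrable_bound_measurable)
  have "emeasure lborel S < \<infinity>" using assms(2) by (rule emeasure_bounded_finite)
  then have "integrable lborel (indicator S :: 'a \<Rightarrow> real)"
    using assms(1) by (intro integrable_real_indicator) auto
  then show "integrable lborel (\<lambda>y. indicator S y * M)" by simp
  show "(\<lambda>y. indicator S y * w y) \<in> borel_measurable borel"
    using assms(1,3) by measurable
  show "\<bar>indicator S y * w y\<bar> \<le> indicator S y * M" for y
    using assms(4) by (auto simp: indicator_def)
qed

text \<open>Slide a paraboloid under \<open>w\<close>: adding a multiple of the squared distance to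
  \<open>x0\<close> produces a minimum point \<open>a\<close> well inside the ball, with
  \<open>w a\<close> controlled by \<open>w x0\<close>. Short jumps from \<open>a\<close> lose at
  most the opening of the paraboloid, and jumps into the annulus gain the mass of \<open>w\<close>;
  the equation at \<open>a\<close> balances the two.\<close>

lemma tame_harnack:
  assumes \<alpha>: "0 < \<alpha>" "\<alpha> < 2" and r: "0 < r" "0 < R"
  shows "\<exists>C\<ge>0. \<forall>w (x0::'a::euclidean_space). tame w \<longrightarrow> (\<forall>x. 0 \<le> w x) \<longrightarrow>
     (\<forall>x\<in>ball x0 r. jump_op (riesz \<alpha>) w x = 0) \<longrightarrow>
     (LINT y|lborel. indicator {y. r \<le> dist x0 y \<and> dist x0 y \<le> R} y * w y) \<le> C * w x0"
proof -
  let ?N = "DIM('a)"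
  define J where "J = (LINT z|lborel. min 1 ((norm (z::'a))\<^sup>2) * riesz \<alpha> z)"
  \<comment> \<open>\<open>k\<close> bounds the kernel from below on jumps of length at most
    \<open>R + r\<close>. The first summand of \<open>A\<close> pays for jumps shorter than
    \<open>r / 4\<close>, the second for all others.\<close>
  define k where "k = (R + r) powr - (real ?N + \<alpha>)"
  define A where "A = 4 * (1 + r\<^sup>2) / r\<^sup>2 + 2 / min 1 (r\<^sup>2 / 16)"
  have k: "k > 0" using r by (simp add: k_def)
  have A: "A \<ge> 0" using r by (auto simp: A_def intro!: add_nonneg_nonneg divide_nonneg_nonneg)
  have J: "J \<ge> 0" unfolding J_def by (intro integral_nonneg_AE AE_I2) simp
  have "(LINT y|lborel. indicator {y. r \<le> dist x0 y \<and> dist x0 y \<le> R} y * w y) \<le> A * J / k * w x0"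
    if w: "tame w" "\<And>x. 0 \<le> w x" "\<And>x. x \<in> ball x0 r \<Longrightarrow> jump_op (riesz \<alpha>) w x = 0"
    for w and x0 :: 'a
  proof -
    define S where "S = {y. r \<le> dist x0 y \<and> dist x0 y \<le> R}"
    have [measurable]: "w \<in> borel_measurable borel" by (rule tame_measurable[OF w(1)])
    obtain B where B: "\<And>x. \<bar>w x\<bar> \<le> B" using tame_bounded[OF w(1)] by blast
    have S: "S \<in> sets borel" "bounded S"
    proof -
      have "closed S" unfolding S_def
        by (intro closed_Collect_conj closed_Collect_le continuous_intros)
      then show "S \<in> sets borel" by (rule borel_closed)
      show "bounded S" by (rule bounded_subset[OF bounded_cball[of x0 R]]) (auto simp: S_def)
    qed
    have intS: "integrable lborel (\<lambda>y. indicator S y * w y)"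
      by (rule bounded_indicator_integrable[OF S]) (auto intro: B)
    \<comment> \<open>A number \<open>m > w x0\<close> keeps the opening of the paraboloid positive
      even if \<open>w x0 = 0\<close>; \<open>m\<close> tends to \<open>w x0\<close> at the
      end.\<close>
    have "(LINT y|lborel. indicator S y * w y) \<le> A * J / k * m" if m: "w x0 < m" for m
    proof -
      have m0: "m > 0" using m w(2)[of x0] by linarith
      \<comment> \<open>A minimum value below \<open>m\<close> then forces
        \<open>(dist x0 a)\<^sup>2 < r\<^sup>2 / 2\<close>, so that jumps shorter than
        \<open>r / 4\<close> from \<open>a\<close> stay in the ball.\<close>
      define M where "M = 2 * m / r\<^sup>2"
      have M: "M > 0" "M * r\<^sup>2 = 2 * m" using m0 r by (simp_all add: M_def)
      let ?\<Phi> = "\<lambda>x. w x + M * (dist x0 x)\<^sup>2"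
      have "continuous_on (cball x0 r) ?\<Phi>"
        by (intro continuous_intros continuous_on_subset[OF tame_continuous[OF w(1)]]) auto
      then obtain a where a: "a \<in> cball x0 r" "\<And>z. z \<in> cball x0 r \<Longrightarrow> ?\<Phi> a \<le> ?\<Phi> z"
        using continuous_attains_inf[of "cball x0 r" ?\<Phi>] r by force
      have \<Phi>a: "?\<Phi> a < m" using a(2)[of x0] m r by simp
      have "0 \<le> M * (dist x0 a)\<^sup>2" using M by simp
      then have wa: "w a \<le> m" using \<Phi>a by linarith
      have "M * (dist x0 a)\<^sup>2 < M * (r\<^sup>2 / 2)" using \<Phi>a w(2)[of a] M(2) by linarith
      then have "(dist x0 a)\<^sup>2 < r\<^sup>2 / 2" using M(1) by simp
      also have "\<dots> \<le> (3 * r / 4)\<^sup>2" by (simp add: power2_eq_square)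
      finally have da: "dist x0 a < 3 * r / 4" by (rule power2_less_imp_less) (use r in auto)
      have pointwise: "k * (indicator S (a + z) * w (a + z)) - A * m * (min 1 ((norm z)\<^sup>2) * riesz \<alpha> z)
          \<le> second_diff w a z * riesz \<alpha> z" for z
      proof (cases "norm z < r / 4")
        case True
        then have "a + z \<in> cball x0 r" "a - z \<in> cball x0 r"
          using da norm_triangle_ineq4[of "x0 - a" z] norm_triangle_ineq[of "x0 - a" z]
          by (auto simp: dist_norm algebra_simps)
        then have "?\<Phi> a \<le> ?\<Phi> (a + z)" "?\<Phi> a \<le> ?\<Phi> (a - z)" using a(2) by blast+
        \<comment> \<open>Parallelogram law: the second difference of the squared distance is
          exactly \<open>2 * (norm z)\<^sup>2\<close>.\<close>
        moreover have "(dist x0 (a + z))\<^sup>2 + (dist x0 (a - z))\<^sup>2 = 2 * (dist x0 a)\<^sup>2 + 2 * (norm z)\<^sup>2"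
          by (simp add: dist_norm power2_norm_eq_inner inner_diff_left inner_diff_right
              inner_add_left inner_add_right inner_commute)
        then have "M * (dist x0 (a + z))\<^sup>2 + M * (dist x0 (a - z))\<^sup>2
            = 2 * (M * (dist x0 a)\<^sup>2) + 2 * M * (norm z)\<^sup>2"
          by (metis distrib_left mult.assoc mult.left_commute)
        ultimately have "- (2 * M * (norm z)\<^sup>2) \<le> second_diff w a z"
          unfolding second_diff_def by linarith
        moreover have "2 * M * (norm z)\<^sup>2 \<le> A * m * min 1 ((norm z)\<^sup>2)"
        proof -
          have "(norm z)\<^sup>2 \<le> r\<^sup>2" using True r by (intro power_mono) auto
          then have "(norm z)\<^sup>2 \<le> (1 + r\<^sup>2) * min 1 ((norm z)\<^sup>2)"
            by (cases "(norm z)\<^sup>2 \<le> 1") (auto simp: min_def algebra_simps)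
          then have "2 * M * (norm z)\<^sup>2 \<le> 2 * M * ((1 + r\<^sup>2) * min 1 ((norm z)\<^sup>2))"
            using M by (intro mult_left_mono) auto
          also have "\<dots> = (4 * (1 + r\<^sup>2) / r\<^sup>2) * m * min 1 ((norm z)\<^sup>2)"
            by (simp add: M_def)
          also have "\<dots> \<le> A * m * min 1 ((norm z)\<^sup>2)"
            using m0 r by (intro mult_right_mono) (auto simp: A_def)
          finally show ?thesis .
        qed
        moreover have "a + z \<notin> S"
          using True da dist_triangle[of x0 "a + z" a] by (auto simp: S_def dist_norm)
        ultimately have "- (A * m * min 1 ((norm z)\<^sup>2)) * riesz \<alpha> z \<le> second_diff w a z * riesz \<alpha> z"
          by (intro mult_right_mono) auto
        then show ?thesis using \<open>a + z \<notin> S\<close> by simp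
      next
        case False
        have 1: "2 * m \<le> A * m * min 1 ((norm z)\<^sup>2)"
        proof -
          let ?q = "min 1 (r\<^sup>2 / 16)"
          have q: "?q > 0" using r by simp
          have "(r / 4)\<^sup>2 \<le> (norm z)\<^sup>2" using False r by (intro power_mono) auto
          then have "?q \<le> min 1 ((norm z)\<^sup>2)" by (auto simp: power_divide)
          moreover have "2 / ?q \<le> A" using r by (simp add: A_def)
          ultimately have "2 / ?q * ?q \<le> A * min 1 ((norm z)\<^sup>2)"
            using A q by (intro mult_mono) auto
          then have "m * 2 \<le> m * (A * min 1 ((norm z)\<^sup>2))" using q m0 by (intro mult_left_mono) auto
          then show ?thesis by (simp add: mult.commute mult.left_commute)
        qed
        have 2: "k * (indicator S (a + z) * w (a + z)) \<le> w (a + z) * riesz \<alpha> z"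
        proof (cases "a + z \<in> S")
          case True
          have "norm z \<le> dist x0 (a + z) + dist x0 a"
            using norm_triangle_ineq4[of "a + z - x0" "a - x0"] by (simp add: dist_norm norm_minus_commute)
          then have "norm z \<le> R + r" using True da r by (auto simp: S_def)
          moreover have "norm z > 0" using False r by linarith
          ultimately have "k \<le> riesz \<alpha> z"
            unfolding k_def riesz_def using \<alpha> by (intro powr_mono2') auto
          then have "k * w (a + z) \<le> riesz \<alpha> z * w (a + z)" by (intro mult_right_mono w)
          then show ?thesis using True by (simp add: mult.commute)
        qed (simp add: w)
        \<comment> \<open>For long jumps the nonnegative value at \<open>a - z\<close> is
          dropped.\<close>
        have "w (a + z) - 2 * m \<le> second_diff w a z"
          using wa w(2)[of "a - z"] unfolding second_diff_def by linarith
        then have "w (a + z) - A * m * min 1 ((norm z)\<^sup>2) \<le> second_diff w a z" using 1 by linarith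
        then have "(w (a + z) - A * m * min 1 ((norm z)\<^sup>2)) * riesz \<alpha> z \<le> second_diff w a z * riesz \<alpha> z"
          by (intro mult_right_mono) auto
        then show ?thesis using 2 by (simp add: left_diff_distrib mult.assoc)
      qed
      have intS': "integrable lborel (\<lambda>z. indicator S (a + z) * w (a + z))"
        and eqS: "(LINT z|lborel. indicator S (a + z) * w (a + z)) = (LINT y|lborel. indicator S y * w y)"
        using intS lborel_integrable_shift[of "\<lambda>y. indicator S y * w y" a]
          lborel_integral_shift[of "\<lambda>y. indicator S y * w y" a] S(1) by simp_all
      have "k * (LINT y|lborel. indicator S y * w y) - A * m * J
          = (LINT z|lborel. k * (indicator S (a + z) * w (a + z)) - A * m * (min 1 ((norm z)\<^sup>2) * riesz \<alpha> z))"
        unfolding eqS[symmetric] J_def using intS' riesz_truncated_integrable[OF \<alpha>, where 'a='a]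
        by (subst Bochner_Integration.integral_diff) auto
      also have "\<dots> \<le> jump_op (riesz \<alpha>) w a"
        unfolding jump_op_def
        using intS' riesz_truncated_integrable[OF \<alpha>, where 'a='a] jump_op_integrable[OF \<alpha> w(1) below_riesz_self]
        by (intro integral_mono pointwise) auto
      also have "\<dots> = 0" using da r by (intro w(3)) auto
      finally show ?thesis using k by (simp add: field_simps)
    qed
    then have "(LINT y|lborel. indicator S y * w y) \<le> A * J / k * w x0 + e" if "e > 0" for e
    proof -
      define c where "c = A * J / k"
      have c: "c \<ge> 0" using A J k by (simp add: c_def)
      have "(LINT y|lborel. indicator S y * w y) \<le> c * (w x0 + e / (c + 1))"
        using c that \<open>\<And>m. w x0 < m \<Longrightarrow> (LINT y|lborel. indicator S y * w y) \<le> A * J / k * m\<close>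
        by (simp add: c_def add_nonneg_pos)
      also have "c * (e / (c + 1)) \<le> e"
        using c that by (simp add: field_simps)
      then have "c * (w x0 + e / (c + 1)) \<le> c * w x0 + e"
        by (simp add: distrib_left)
      finally show ?thesis unfolding c_def .
    qed
    then show ?thesis unfolding S_def[symmetric] by (rule field_le_epsilon)
  qed
  moreover have "A * J / k \<ge> 0" using A J k by simp
  ultimately show ?thesis by blast
qed

lemma weakly_harmonic_harnack:
  assumes \<alpha>: "0 < \<alpha>" "\<alpha> < 2" and r: "0 < r" "0 < R"
  shows "\<exists>C\<ge>0. \<forall>v (x0::'a::euclidean_space). continuous_on UNIV v \<longrightarrow> (\<forall>x. 0 \<le> v x) \<longrightarrow>
     weakly_harmonic \<alpha> (ball x0 (2 * r)) v \<longrightarrow>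
     (LINT y|lborel. indicator {y. r \<le> dist x0 y \<and> dist x0 y \<le> R} y * v y) \<le> C * v x0"
proof -
  obtain C where C: "C \<ge> 0" "\<forall>w (x0::'a). tame w \<longrightarrow> (\<forall>x. 0 \<le> w x) \<longrightarrow>
     (\<forall>x\<in>ball x0 r. jump_op (riesz \<alpha>) w x = 0) \<longrightarrow>
     (LINT y|lborel. indicator {y. r \<le> dist x0 y \<and> dist x0 y \<le> R} y * w y) \<le> C * w x0"
    using tame_harnack[OF \<alpha> r, where 'a='a] by blast
  have "(LINT y|lborel. indicator {y. r \<le> dist x0 y \<and> dist x0 y \<le> R} y * v y) \<le> C * v x0"
    if v: "continuous_on UNIV v" "\<And>x. 0 \<le> v x" "weakly_harmonic \<alpha> (ball x0 (2 * r)) v"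
    for v and x0 :: 'a
  proof (rule field_le_epsilon)
    fix e :: real assume e: "e > 0"
    let ?S = "{y. r \<le> dist x0 y \<and> dist x0 y \<le> R}"
    define \<delta> where "\<delta> = min (r / 2) (e / (2 * C + 1))"
    have \<delta>: "\<delta> > 0" "\<delta> < r" "\<delta> \<le> e / (2 * C + 1)" using r e C(1) by (auto simp: \<delta>_def)
    obtain w where w: "tame w" "\<And>x. \<bar>w x - v x\<bar> \<le> \<delta>"
      "\<And>x. cball x \<delta> \<subseteq> ball x0 (2 * r) \<Longrightarrow> jump_op (riesz \<alpha>) w x = 0"
      using v(3) \<delta>(1) unfolding weakly_harmonic_def by blast
    \<comment> \<open>Adding \<open>\<delta>\<close> restores nonnegativity, which
      \<open>tame_harnack\<close> requires; the trivial combination is the form that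
      \<open>tame_combine\<close> covers.\<close>
    let ?w = "\<lambda>x. 1 * w x + 0 * w x + \<delta>"
    have tw: "tame ?w" by (rule tame_combine[OF w(1) w(1)])
    obtain B where B: "\<And>x. \<bar>?w x\<bar> \<le> B" using tame_bounded[OF tw] by blast
    have vw: "v x \<le> ?w x" for x using w(2)[of x] by simp
    have w0: "0 \<le> ?w x" for x using vw[of x] v(2)[of x] by linarith
    have "closed ?S" by (intro closed_Collect_conj closed_Collect_le continuous_intros)
    then have S: "?S \<in> sets borel" by (rule borel_closed)
    have S': "bounded ?S" by (rule bounded_subset[OF bounded_cball[of x0 R]]) auto
    have vB: "\<bar>v x\<bar> \<le> B" for x using vw[of x] v(2)[of x] B[of x] by linarith
    have "(LINT y|lborel. indicator ?S y * v y) \<le> (LINT y|lborel. indicator ?S y * ?w y)"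
      using vB B
      by (intro integral_mono bounded_indicator_integrable[OF S S'] tame_measurable[OF tw]
          continuous_borel v(1) mult_left_mono vw) auto
    also have "\<dots> \<le> C * ?w x0"
    proof (rule C(2)[rule_format, OF tw w0])
      fix x assume x: "x \<in> ball x0 r"
      have "cball x \<delta> \<subseteq> ball x0 (2 * r)"
      proof
        fix y assume "y \<in> cball x \<delta>"
        then show "y \<in> ball x0 (2 * r)"
          using x \<delta>(2) dist_triangle[of x0 y x] by auto
      qed
      then show "jump_op (riesz \<alpha>) ?w x = 0"
        using jump_op_combine[OF \<alpha> below_riesz_self w(1) w(1), of 1 0] w(3) by simp
    qed
    also have "\<dots> \<le> C * (v x0 + 2 * \<delta>)"
      using C(1) w(2)[of x0] by (intro mult_left_mono) auto
    also have "\<dots> \<le> C * v x0 + e"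
    proof -
      have "(2 * C + 1) * \<delta> \<le> e" using \<delta>(3) C(1) by (simp add: field_simps)
      then show ?thesis using \<delta>(1) by (simp add: algebra_simps)
    qed
    finally show "(LINT y|lborel. indicator ?S y * v y) \<le> C * v x0 + e" .
  qed
  then show ?thesis using C(1) by blast
qed

subsection \<open>A Hoelder estimate by doubling of variables\<close>

text \<open>The subtracted \<open>1\<close> is the value of \<open>riesz\<close> on the unit sphere:
  the result is supported in the unit ball, and the remainder \<open>riesz_flat\<close> is
  Lipschitz, which a sharp cutoff of the kernel would not achieve.\<close>

definition riesz_core :: "real \<Rightarrow> 'a::euclidean_space \<Rightarrow> real" where
  "riesz_core \<alpha> z = max 0 (riesz \<alpha> z - 1)"

lemma riesz_core_below: "below_riesz \<alpha> (riesz_core \<alpha>)"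
  unfolding below_riesz_def riesz_core_def[abs_def] by (auto simp: riesz_measurable)

lemma riesz_core_far:
  fixes z :: "'a::euclidean_space"
  assumes "0 < \<alpha>" "1 \<le> norm z" shows "riesz_core \<alpha> z = 0"
  using powr_mono2'[of "- (real DIM('a) + \<alpha>)" 1 "norm z"] assms
  by (simp add: riesz_core_def riesz_def)

text \<open>Up to radius \<open>1 / 2\<close> the kernel is at least \<open>2\<close>, because its
  exponent is at least \<open>1\<close>, so subtracting \<open>1\<close> costs at most half of
  it.\<close>

lemma riesz_core_lower:
  fixes z :: "'a::euclidean_space"
  assumes "0 < \<alpha>" "0 < norm z" "norm z \<le> r" "r \<le> 1 / 2"
  shows "r powr - (real DIM('a) + \<alpha>) / 2 \<le> riesz_core \<alpha> z"
proof -
  let ?p = "real DIM('a) + \<alpha>"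
  have p: "1 \<le> ?p" using DIM_positive[where 'a='a] assms(1) by linarith
  have r: "r powr - ?p \<le> riesz \<alpha> z"
    unfolding riesz_def using assms by (intro powr_mono2') auto
  have "(2::real) powr 1 \<le> 2 powr ?p" using p by (intro powr_mono) auto
  also have "2 powr ?p = (1 / 2) powr - ?p"
    using powr_powr[of "2::real" "- 1" "- ?p"] by (simp add: powr_minus inverse_eq_divide add.commute)
  also have "\<dots> \<le> r powr - ?p"
    using p assms less_le_trans[OF assms(2,3)] by (intro powr_mono2') auto
  finally have "2 \<le> r powr - ?p" by simp
  then show ?thesis using r unfolding riesz_core_def by linarith
qed

lemma powr_le_tangent:
  fixes s \<theta> :: real
  assumes "0 \<le> \<theta>" "\<theta> \<le> 1" "0 < s"
  shows "s powr \<theta> \<le> 1 + \<theta> * (s - 1)"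
  using Youngs_inequality_0[of \<theta> "1 - \<theta>" s 1] assms by (simp add: algebra_simps)

text \<open>The point is the prefactor \<open>\<gamma> / \<beta>\<close>: concavity compares with
  the fixed exponent \<open>\<beta>\<close>, so the loss from long jumps becomes small with
  \<open>\<gamma>\<close>. The \<open>6\<close> comes from
  \<open>1 + 2 * \<tau> \<le> 6 * \<tau>\<close> for \<open>\<tau> \<ge> 1 / 4\<close>.\<close>

lemma powr_increment_le:
  fixes \<tau> :: real
  assumes "0 < \<gamma>" "\<gamma> \<le> \<beta>" "1 / 4 \<le> \<tau>"
  shows "(1 + 2 * \<tau>) powr \<gamma> - 1 \<le> \<gamma> / \<beta> * (6 powr \<beta> * \<tau> powr \<beta>)"
proof -
  let ?s = "(1 + 2 * \<tau>) powr \<beta>"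
  have "(1 + 2 * \<tau>) powr \<gamma> = ?s powr (\<gamma> / \<beta>)" using assms by (simp add: powr_powr)
  also have "\<dots> \<le> 1 + \<gamma> / \<beta> * (?s - 1)" using assms by (intro powr_le_tangent) auto
  also have "?s - 1 \<le> 6 powr \<beta> * \<tau> powr \<beta>"
  proof -
    have "?s \<le> (6 * \<tau>) powr \<beta>" using assms by (intro powr_mono2) auto
    then show ?thesis using assms by (simp add: powr_mult)
  qed
  then have "1 + \<gamma> / \<beta> * (?s - 1) \<le> 1 + \<gamma> / \<beta> * (6 powr \<beta> * \<tau> powr \<beta>)"
    using assms by (intro add_left_mono mult_left_mono) auto
  finally show ?thesis by simp
qed

text \<open>The doubling argument: at a maximum \<open>(x, y)\<close> of
  \<open>w x - w y - C * |x - y| powr \<gamma> - 2 * |x|\<^sup>2\<close>, jumps shorter than a quarter of \<open>|x - y|\<close> are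
  coupled synchronously, and longer ones by \<open>z \<mapsto> -z\<close>, except that the jumps from \<open>x\<close> and from \<open>y\<close>
  into a small ball around the midpoint are coupled so that the two end points coincide.
  For small \<open>\<gamma>\<close> the gain from this coalescence exceeds the loss from all other jumps.\<close>

lemma doubling_pointwise:
  fixes w :: "'a::euclidean_space \<Rightarrow> real" and x y z :: 'a and \<alpha> \<gamma> C :: real
  defines "a \<equiv> x - y"
  defines "\<rho> \<equiv> norm a"
  defines "F \<equiv> \<lambda>z. (w (x + z) - w (y - z)) - (w x - w y)"
  defines "Q \<equiv> ball (- (1 / 2) *\<^sub>R a) (\<rho> / 8)"
  defines "q \<equiv> \<rho> powr - (real DIM('a) + \<alpha>) / 2"
  assumes \<alpha>: "0 < \<alpha>" and \<gamma>: "0 < \<gamma>" and C: "0 \<le> C" and \<rho>: "0 < \<rho>" "\<rho> \<le> 1 / 2"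
    and x: "norm x \<le> 1"
    and max: "\<And>z z'. norm z < 1 \<Longrightarrow> norm z' < 1 \<Longrightarrow>
       w (x + z) - w (y + z') - C * norm (a + z - z') powr \<gamma> - 2 * (norm (x + z))\<^sup>2
       \<le> w x - w y - C * \<rho> powr \<gamma> - 2 * (norm x)\<^sup>2"
  shows "(second_diff w x z - second_diff w y z) * riesz_core \<alpha> z
    \<le> 4 * (min 1 ((norm z)\<^sup>2) * riesz \<alpha> z)
      + 2 * C * \<rho> powr \<gamma> * (indicator {z. \<rho> / 4 \<le> norm z} z
           * (((1 + 2 * (norm z / \<rho>)) powr \<gamma> - 1) * riesz \<alpha> z))
      + q * (indicator Q z * (F z + 4 * \<rho>) + indicator Q (- z) * (F (- z) + 4 * \<rho>))"
    (is "?L \<le> ?A + ?B + ?D")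
proof -
  let ?\<kappa> = "riesz_core \<alpha> :: 'a \<Rightarrow> real"
  have \<kappa>: "0 \<le> ?\<kappa> z" "?\<kappa> z \<le> riesz \<alpha> z" for z
    using riesz_core_below[of \<alpha>, where 'a='a] by (auto simp: below_riesz_def)
  have even: "?\<kappa> (- z) = ?\<kappa> z" by (simp add: riesz_core_def)
  \<comment> \<open>Jumps in \<open>Q\<close> lie beyond the synchronous range and are short enough
    for \<open>riesz_core_lower\<close>.\<close>
  have Q: "3 * \<rho> / 8 < norm z \<and> norm z < 5 * \<rho> / 8" if "z \<in> Q" for z
  proof -
    have h: "norm (- (1 / 2) *\<^sub>R a) = \<rho> / 2" by (simp add: \<rho>_def)
    have "norm (- (1 / 2) *\<^sub>R a - z) < \<rho> / 8" using that by (simp add: Q_def dist_norm)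
    then show ?thesis
      using h norm_triangle_ineq2[of "- (1 / 2) *\<^sub>R a" z]
        norm_triangle_ineq2[of z "- (1 / 2) *\<^sub>R a"]
      by (simp only: norm_minus_commute[of z]) linarith
  qed
  have q: "0 \<le> q" by (simp add: q_def)
  have Q\<kappa>: "q * indicator Q z \<le> ?\<kappa> z" for z
  proof (cases "z \<in> Q")
    case True
    then have "q \<le> ?\<kappa> z"
      unfolding q_def using \<alpha> \<rho> Q[OF True] by (intro riesz_core_lower) auto
    then show ?thesis using True by simp
  qed (simp add: \<kappa>)
  have sq: "(norm (x + z))\<^sup>2 - (norm x)\<^sup>2 = 2 * (x \<bullet> z) + (norm z)\<^sup>2" for z
    by (simp add: power2_norm_eq_inner inner_add_left inner_add_right inner_commute)
  have pos: "0 \<le> ((1 + 2 * (norm z / \<rho>)) powr \<gamma> - 1) * riesz \<alpha> z" for z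
    using \<rho> \<gamma> by (intro mult_nonneg_nonneg) (auto intro: ge_one_powr_ge_zero)
  have B0: "0 \<le> ?B"
    by (rule mult_nonneg_nonneg[OF _ mult_nonneg_nonneg[OF _ pos]]) (use C in simp_all)
  consider "1 \<le> norm z" | "norm z < \<rho> / 4" | "\<rho> / 4 \<le> norm z" "norm z < 1" by linarith
  then show ?thesis
  proof cases
    case 1
    then have "z \<notin> Q" "- z \<notin> Q" using Q[of z] Q[of "- z"] \<rho> by auto
    then have "?D = 0" by simp
    moreover have "?L = 0" using riesz_core_far[OF \<alpha> 1] by simp
    moreover have "0 \<le> ?A" by simp
    moreover note B0
    ultimately show ?thesis by linarith
  next
    case 2
    then have z1: "norm z < 1" using \<rho> by linarith
    \<comment> \<open>A common jump leaves \<open>a\<close> unchanged, so the terms with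
      \<open>C\<close> cancel and only the localizing term \<open>2 * (norm x)\<^sup>2\<close>
      contributes its second difference.\<close>
    have "second_diff w x z - second_diff w y z \<le> 4 * (norm z)\<^sup>2"
      using max[OF z1 z1] max[of "- z" "- z"] z1 sq[of z] sq[of "- z"]
      by (simp add: second_diff_def \<rho>_def)
    then have "?L \<le> 4 * (norm z)\<^sup>2 * ?\<kappa> z" using \<kappa> by (intro mult_right_mono) auto
    also have "\<dots> \<le> 4 * (norm z)\<^sup>2 * riesz \<alpha> z" using \<kappa> by (intro mult_left_mono) auto
    also have "\<dots> = ?A" using z1 by (simp add: min_absorb2 power_le_one)
    moreover note B0
    moreover have "z \<notin> Q" "- z \<notin> Q" using Q[of z] Q[of "- z"] 2 \<rho> by auto
    then have "?D = 0" by simp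
    ultimately show ?thesis by linarith
  next
    case 3
    define P where "P = C * \<rho> powr \<gamma> * ((1 + 2 * (norm z / \<rho>)) powr \<gamma> - 1)"
    \<comment> \<open>Opposite jumps lengthen the distance to at most
      \<open>\<rho> + 2 * norm z\<close>; \<open>P\<close> is the resulting growth of the
      penalty.\<close>
    have FU: "F s \<le> P + 4 * (x \<bullet> s) + 2 * (norm z)\<^sup>2" if s: "s = z \<or> s = - z" for s
    proof -
      have ns: "norm s = norm z" using s by auto
      have "norm (a + s - - s) \<le> \<rho> + 2 * norm z"
      proof -
        have eq: "a + s - - s = a + 2 *\<^sub>R s" by (simp add: scaleR_2)
        show ?thesis unfolding eq using norm_triangle_ineq[of a "2 *\<^sub>R s"] ns by (simp add: \<rho>_def)
      qed
      then have "norm (a + s - - s) powr \<gamma> \<le> (\<rho> * (1 + 2 * (norm z / \<rho>))) powr \<gamma>"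
        using \<gamma> \<rho> by (intro powr_mono2) (auto simp: distrib_left)
      also have "\<dots> = \<rho> powr \<gamma> * (1 + 2 * (norm z / \<rho>)) powr \<gamma>"
        using \<rho> by (intro powr_mult)
      finally have "C * norm (a + s - - s) powr \<gamma> \<le> C * (\<rho> powr \<gamma> * (1 + 2 * (norm z / \<rho>)) powr \<gamma>)"
        using C by (rule mult_left_mono)
      then have "C * norm (a + s - - s) powr \<gamma> \<le> P + C * \<rho> powr \<gamma>"
        by (simp add: P_def algebra_simps)
      moreover have "norm s < 1" "norm (- s) < 1" using ns 3 by auto
      note max[OF this]
      ultimately show ?thesis using sq[of s] ns by (simp add: F_def)
    qed
    have P0: "0 \<le> P" unfolding P_def using C \<rho> \<gamma>
      by (intro mult_nonneg_nonneg) (auto intro: ge_one_powr_ge_zero)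
    \<comment> \<open>The shares \<open>i\<close> and \<open>j\<close> of the kernel are reserved
      for coalescence: there \<open>F\<close> is kept unestimated, to be integrated exactly by
      \<open>mirror_integral\<close>.\<close>
    define i where "i = q * indicator Q z"
    define j where "j = q * indicator Q (- z)"
    have ij: "0 \<le> i" "0 \<le> j" "i \<le> ?\<kappa> z" "j \<le> ?\<kappa> z"
      using q Q\<kappa>[of z] Q\<kappa>[of "- z"] even by (auto simp: i_def j_def)
    have xz: "\<bar>x \<bullet> z\<bar> \<le> \<rho>" if "z \<in> Q \<or> - z \<in> Q"
    proof -
      have "norm z \<le> \<rho>" using that Q[of z] Q[of "- z"] \<rho> by auto
      then have "norm x * norm z \<le> 1 * \<rho>" using x \<rho> by (intro mult_mono) auto
      then show ?thesis using Cauchy_Schwarz_ineq2[of x z] by linarith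
    qed
    \<comment> \<open>The linear terms cancel between \<open>z\<close> and \<open>- z\<close> except
      on the shares \<open>i\<close> and \<open>j\<close>, where jumps are no longer than
      \<open>\<rho>\<close>.\<close>
    have ix: "- (i * (4 * (x \<bullet> z))) \<le> i * (4 * \<rho>)" "j * (4 * (x \<bullet> z)) \<le> j * (4 * \<rho>)"
    proof -
      have "i * (- (4 * (x \<bullet> z))) \<le> i * (4 * \<rho>)"
      proof (cases "z \<in> Q")
        case True
        then have "- (4 * (x \<bullet> z)) \<le> 4 * \<rho>" using xz by linarith
        then show ?thesis by (rule mult_left_mono[OF _ ij(1)])
      qed (simp add: i_def)
      then show "- (i * (4 * (x \<bullet> z))) \<le> i * (4 * \<rho>)" by simp
      show "j * (4 * (x \<bullet> z)) \<le> j * (4 * \<rho>)"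
      proof (cases "- z \<in> Q")
        case True
        then have "4 * (x \<bullet> z) \<le> 4 * \<rho>" using xz by linarith
        then show ?thesis by (rule mult_left_mono[OF _ ij(2)])
      qed (simp add: j_def)
    qed
    have "?L = (F z + F (- z)) * ?\<kappa> z"
      by (simp add: F_def second_diff_def algebra_simps)
    also have "\<dots> = F z * (?\<kappa> z - i) + F (- z) * (?\<kappa> z - j) + (i * F z + j * F (- z))"
      by (simp add: algebra_simps)
    also have "F z * (?\<kappa> z - i) \<le> (P + 4 * (x \<bullet> z) + 2 * (norm z)\<^sup>2) * (?\<kappa> z - i)"
      using FU[of z] ij by (intro mult_right_mono) auto
    also have "F (- z) * (?\<kappa> z - j) \<le> (P + 4 * (x \<bullet> - z) + 2 * (norm z)\<^sup>2) * (?\<kappa> z - j)"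
      using FU[of "- z"] ij by (intro mult_right_mono) auto
    finally have "?L \<le> (P + 2 * (norm z)\<^sup>2) * (?\<kappa> z - i) + (P + 2 * (norm z)\<^sup>2) * (?\<kappa> z - j)
        - i * (4 * (x \<bullet> z)) + j * (4 * (x \<bullet> z)) + (i * F z + j * F (- z))"
      by (simp add: algebra_simps)
    also have "\<dots> \<le> (P + 2 * (norm z)\<^sup>2) * riesz \<alpha> z + (P + 2 * (norm z)\<^sup>2) * riesz \<alpha> z
        + i * (4 * \<rho>) + j * (4 * \<rho>) + (i * F z + j * F (- z))"
    proof -
      have "(P + 2 * (norm z)\<^sup>2) * (?\<kappa> z - i) \<le> (P + 2 * (norm z)\<^sup>2) * riesz \<alpha> z"
        "(P + 2 * (norm z)\<^sup>2) * (?\<kappa> z - j) \<le> (P + 2 * (norm z)\<^sup>2) * riesz \<alpha> z"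
        using ij \<kappa>[of z] P0 by (auto intro!: mult_left_mono)
      then show ?thesis using ix by linarith
    qed
    also have "\<dots> = ?A + ?B + ?D"
      using 3 by (simp add: P_def i_def j_def min_absorb2 power_le_one algebra_simps)
    finally show ?thesis .
  qed
qed


text \<open>The reflection \<open>z \<mapsto> (y - x) - z\<close> fixes the centre of
  \<open>Q\<close>, preserves \<open>Q\<close> and exchanges \<open>x + z\<close> with
  \<open>y - z\<close>. The two jump terms thus cancel in the integral, and the full difference
  \<open>w x - w y\<close> is gained.\<close>

lemma mirror_integral:
  fixes w :: "'a::euclidean_space \<Rightarrow> real" and x y :: 'a and r e M :: real
  defines "Q \<equiv> ball (- (1 / 2) *\<^sub>R (x - y)) r"
  assumes w: "continuous_on UNIV w" "\<And>x. \<bar>w x\<bar> \<le> M" and r: "0 \<le> r"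
  shows "integrable lborel (\<lambda>z. indicator Q z * ((w (x + z) - w (y - z)) - (w x - w y) + e))"
    and "(LINT z|lborel. indicator Q z * ((w (x + z) - w (y - z)) - (w x - w y) + e))
      = unit_ball_vol (real DIM('a)) * r ^ DIM('a) * (e - (w x - w y))"
proof -
  have [measurable]: "w \<in> borel_measurable borel" by (rule continuous_borel[OF w(1)])
  have Q: "Q \<in> sets borel" "bounded Q" by (simp_all add: Q_def borel_open)
  note [measurable] = Q(1)
  have 1: "integrable lborel (\<lambda>z. indicator Q z * w (x + z))"
    by (rule bounded_indicator_integrable[OF Q _ w(2)]) measurable
  have 2: "integrable lborel (\<lambda>z. indicator Q z * w (y - z))"
    by (rule bounded_indicator_integrable[OF Q _ w(2)]) measurable
  have 3: "integrable lborel (\<lambda>z. indicator Q z * (e - (w x - w y)))"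
    by (rule bounded_indicator_integrable[OF Q]) auto
  have eq: "indicator Q z * ((w (x + z) - w (y - z)) - (w x - w y) + e)
      = indicator Q z * w (x + z) - indicator Q z * w (y - z) + indicator Q z * (e - (w x - w y))" for z
    by (simp add: algebra_simps)
  show "integrable lborel (\<lambda>z. indicator Q z * ((w (x + z) - w (y - z)) - (w x - w y) + e))"
    unfolding eq using 1 2 3 by simp
  have "(y - x) + - 1 *\<^sub>R z \<in> Q \<longleftrightarrow> z \<in> Q" for z
  proof -
    have "- (1 / 2) *\<^sub>R (x - y) - ((y - x) + - 1 *\<^sub>R z) = - (- (1 / 2) *\<^sub>R (x - y) - z)"
      by (simp add: algebra_simps flip: scaleR_add_left)
    then show ?thesis unfolding Q_def mem_ball dist_norm by (simp only: norm_minus_cancel)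
  qed
  then have "(LINT z|lborel. indicator Q z * w (x + z)) = (LINT z|lborel. indicator Q z * w (y - z))"
    using lborel_integral_affine[of "\<lambda>z. indicator Q z * w (x + z)" "- 1" "y - x"]
    by (simp add: indicator_def)
  then show "(LINT z|lborel. indicator Q z * ((w (x + z) - w (y - z)) - (w x - w y) + e))
      = unit_ball_vol (real DIM('a)) * r ^ DIM('a) * (e - (w x - w y))"
    unfolding eq using 1 2 3 r by (simp add: Q_def content_ball)
qed

text \<open>If the bound fails, the doubled function has a positive maximum at two distinct points.
  Integrating \<open>doubling_pointwise\<close> there, coalescence gains and the other long jumps
  lose a multiple of \<open>C * \<rho> powr (\<gamma> - \<alpha>)\<close>. Only the loss carries a
  factor \<open>\<gamma>\<close>, so a small \<open>\<gamma>\<close> lets the gain win, and a large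
  \<open>C\<close> contradicts the bound on the operator.\<close>

lemma holder_one_sided:
  assumes \<alpha>: "0 < \<alpha>" "\<alpha> < 2"
  shows "\<exists>C \<gamma>. 0 < C \<and> 0 < \<gamma> \<and> \<gamma> \<le> 1 \<and> (\<forall>w::'a::euclidean_space \<Rightarrow> real. tame w \<longrightarrow>
     (\<forall>x\<in>cball 0 3. \<bar>w x\<bar> \<le> 1) \<longrightarrow> (\<forall>x\<in>cball 0 2. \<bar>jump_op (riesz_core \<alpha>) w x\<bar> \<le> 1) \<longrightarrow>
     (\<forall>y\<in>cball 0 3. w 0 - w y \<le> C * norm y powr \<gamma>))"
proof -
  let ?N = "DIM('a)"
  \<comment> \<open>An exponent below \<open>\<alpha>\<close> keeps the kernel integrable at
    infinity after multiplication by \<open>norm z powr \<beta>\<close>; with the half, the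
    remaining decay is again governed by \<open>\<beta>\<close>.\<close>
  define \<beta> where "\<beta> = \<alpha> / 2"
  have \<beta>: "0 < \<beta>" using \<alpha> by (simp add: \<beta>_def)
  define J where "J = (LINT z|lborel. min 1 ((norm (z::'a))\<^sup>2) * riesz \<alpha> z)"
  have J: "0 \<le> J" unfolding J_def by (intro integral_nonneg_AE AE_I2) simp
  obtain T where T: "T > 0" "\<And>r. r > 0 \<Longrightarrow> integrable lborel
       (\<lambda>z::'a. indicator {z. r \<le> norm z} z * norm z powr - (real ?N + \<beta>))"
     "\<And>r. r > 0 \<Longrightarrow> (LINT z|lborel. indicator {z::'a. r \<le> norm z} z * norm z powr - (real ?N + \<beta>))
         \<le> T * r powr - \<beta>"
    using powr_tail_integral[OF \<beta>, where 'a='a] by blast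
  \<comment> \<open>\<open>c\<close> measures the gain: \<open>2 * q\<close> times the volume of a
    ball of radius \<open>\<rho> / 8\<close> is \<open>c * \<rho> powr - \<alpha>\<close>.
    \<open>K\<close> measures the loss, and \<open>\<gamma> * K \<le> c / 2\<close> lets it consume
    at most half of the gain.\<close>
  define c where "c = unit_ball_vol (real ?N) / 8 ^ ?N"
  have c: "0 < c" by (simp add: c_def)
  define K where "K = 2 * 6 powr \<beta> * T * 4 powr \<beta> / \<beta>"
  have K: "0 < K" using T(1) \<beta> by (simp add: K_def)
  define \<gamma> where "\<gamma> = min (min 1 \<beta>) (c / (2 * K))"
  have \<gamma>: "0 < \<gamma>" "\<gamma> \<le> 1" "\<gamma> \<le> \<beta>" using \<beta> c K by (auto simp: \<gamma>_def)
  have "\<gamma> \<le> c / (2 * K)" by (simp add: \<gamma>_def)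
  then have \<gamma>K: "\<gamma> * K \<le> c / 2" using K by (simp add: field_simps)
  \<comment> \<open>The \<open>8\<close> confines the maximum to \<open>\<rho> \<le> 1 / 2\<close>;
    the other summand brings the final bound to \<open>- 3\<close>, below the \<open>- 2\<close>
    that the hypothesis on the operator permits.\<close>
  define C where "C = 8 + 2 * (4 * J + 3) / c"
  have C: "8 \<le> C" "4 * J + c * (4 - C / 2) < - 2" using c J by (auto simp: C_def field_simps)
  have "w 0 - w y0 \<le> C * norm y0 powr \<gamma>"
    if w: "tame w" "\<And>x. x \<in> cball 0 3 \<Longrightarrow> \<bar>w x\<bar> \<le> 1"
      "\<And>x. x \<in> cball 0 2 \<Longrightarrow> \<bar>jump_op (riesz_core \<alpha>) w x\<bar> \<le> 1"
      and y0: "y0 \<in> cball 0 3" for w :: "'a \<Rightarrow> real" and y0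
  proof (rule ccontr)
    assume neg: "\<not> w 0 - w y0 \<le> C * norm y0 powr \<gamma>"
    let ?\<Phi> = "\<lambda>p. w (fst p) - w (snd p) - C * norm (fst p - snd p) powr \<gamma> - 2 * (norm (fst p))\<^sup>2"
    let ?S = "cball (0::'a) 3 \<times> cball (0::'a) 3"
    have "compact ?S" by (intro compact_Times) auto
    moreover have "?S \<noteq> {}" using y0 by auto
    moreover have "continuous_on ?S ?\<Phi>"
      using \<gamma>(1)
      by (intro continuous_intros continuous_on_powr'
          continuous_on_compose2[OF tame_continuous[OF w(1)]]) auto
    ultimately obtain p where p: "p \<in> ?S" "\<And>s. s \<in> ?S \<Longrightarrow> ?\<Phi> s \<le> ?\<Phi> p"
      using continuous_attains_sup[of ?S ?\<Phi>] by blast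
    define x where "x = fst p"
    define y where "y = snd p"
    define a where "a = x - y"
    define \<rho> where "\<rho> = norm a"
    have max: "w s - w t - C * norm (s - t) powr \<gamma> - 2 * (norm s)\<^sup>2
        \<le> w x - w y - C * \<rho> powr \<gamma> - 2 * (norm x)\<^sup>2" if "norm s \<le> 3" "norm t \<le> 3" for s t
      using p(2)[of "(s, t)"] that by (simp add: x_def y_def a_def \<rho>_def)
    have xy: "norm x \<le> 3" "norm y \<le> 3" using p(1) by (auto simp: x_def y_def)
    have pos: "0 < w x - w y - C * \<rho> powr \<gamma> - 2 * (norm x)\<^sup>2"
      using max[of 0 y0] neg y0 by simp
    have w2: "w x - w y \<le> 2" using w(2)[of x] w(2)[of y] xy by auto
    have nn: "0 \<le> C * \<rho> powr \<gamma>" "0 \<le> (norm x)\<^sup>2" using C by auto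
    have "(norm x)\<^sup>2 < 1\<^sup>2" using pos w2 nn by simp
    then have x1: "norm x < 1" by (rule power2_less_imp_less) simp
    have \<rho>0: "0 < \<rho>"
    proof (rule ccontr)
      assume "\<not> 0 < \<rho>"
      then have "w x - w y = 0" by (simp add: \<rho>_def a_def)
      then show False using pos nn by linarith
    qed
    have \<rho>1: "\<rho> \<le> 1 / 2"
    proof (rule ccontr)
      assume "\<not> \<rho> \<le> 1 / 2"
      then have "(1 / 2) powr \<gamma> \<le> \<rho> powr \<gamma>" using \<gamma> by (intro powr_mono2) auto
      moreover have "(1 / 2 :: real) powr 1 \<le> (1 / 2) powr \<gamma>" using \<gamma> by (intro powr_mono') auto
      ultimately have "8 * (1 / 2) \<le> C * \<rho> powr \<gamma>" using C by (intro mult_mono) auto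
      then show False using pos w2 nn by linarith
    qed
    have y1: "norm y \<le> 3 / 2"
      using x1 \<rho>1 norm_triangle_ineq4[of x a] by (simp add: \<rho>_def a_def)
    have maxz: "w (x + z) - w (y + z') - C * norm (a + z - z') powr \<gamma> - 2 * (norm (x + z))\<^sup>2
       \<le> w x - w y - C * \<rho> powr \<gamma> - 2 * (norm x)\<^sup>2" if "norm z < 1" "norm z' < 1" for z z'
    proof -
      have "norm (x + z) \<le> 3" "norm (y + z') \<le> 3"
        using that x1 y1 norm_triangle_ineq[of x z] norm_triangle_ineq[of y z'] by linarith+
      note max[OF this]
      moreover have "x + z - (y + z') = a + z - z'" by (simp add: a_def)
      ultimately show ?thesis by (simp only:)
    qed
    define F where "F = (\<lambda>z. (w (x + z) - w (y - z)) - (w x - w y))"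
    define Q where "Q = ball (- (1 / 2) *\<^sub>R a) (\<rho> / 8)"
    define q where "q = \<rho> powr - (real ?N + \<alpha>) / 2"
    define f1 where "f1 = (\<lambda>z::'a. min 1 ((norm z)\<^sup>2) * riesz \<alpha> z)"
    define f2 where "f2 = (\<lambda>z::'a. indicator {z. \<rho> / 4 \<le> norm z} z * norm z powr - (real ?N + \<beta>))"
    define f3 where "f3 = (\<lambda>z. indicator Q z * (F z + 4 * \<rho>))"
    define e2 where "e2 = 2 * C * \<rho> powr \<gamma> * (\<gamma> / \<beta> * 6 powr \<beta> * \<rho> powr - \<beta>)"
    have e2: "0 \<le> e2" using C \<gamma> \<beta> by (simp add: e2_def)
    have pw: "(second_diff w x z - second_diff w y z) * riesz_core \<alpha> z
        \<le> 4 * f1 z + e2 * f2 z + q * (f3 z + f3 (- z))" for z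
    proof -
      have "indicator {z. \<rho> / 4 \<le> norm z} z * (((1 + 2 * (norm z / \<rho>)) powr \<gamma> - 1) * riesz \<alpha> z)
          \<le> \<gamma> / \<beta> * 6 powr \<beta> * \<rho> powr - \<beta> * f2 z"
      proof (cases "\<rho> / 4 \<le> norm z")
        case True
        then have z: "0 < norm z" using \<rho>0 by linarith
        have "(1 + 2 * (norm z / \<rho>)) powr \<gamma> - 1 \<le> \<gamma> / \<beta> * (6 powr \<beta> * (norm z / \<rho>) powr \<beta>)"
          using \<gamma> True \<rho>0 by (intro powr_increment_le) (auto simp: field_simps)
        then have "((1 + 2 * (norm z / \<rho>)) powr \<gamma> - 1) * riesz \<alpha> z
            \<le> \<gamma> / \<beta> * (6 powr \<beta> * (norm z / \<rho>) powr \<beta>) * riesz \<alpha> z"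
          by (rule mult_right_mono) simp
        also have "(norm z / \<rho>) powr \<beta> = norm z powr \<beta> * \<rho> powr - \<beta>"
          using z \<rho>0 by (simp add: powr_divide powr_minus_divide)
        also have "\<gamma> / \<beta> * (6 powr \<beta> * (norm z powr \<beta> * \<rho> powr - \<beta>)) * riesz \<alpha> z
            = \<gamma> / \<beta> * 6 powr \<beta> * \<rho> powr - \<beta> * (norm z powr \<beta> * riesz \<alpha> z)"
          by simp
        also have "norm z powr \<beta> * riesz \<alpha> z = f2 z"
        proof -
          have "\<beta> + - (real ?N + \<alpha>) = - (real ?N + \<beta>)" by (simp add: \<beta>_def)
          then show ?thesis
            using True by (simp only: f2_def riesz_def powr_add[symmetric]) simp
        qed
        finally show ?thesis using True by simp
      qed (simp add: f2_def)
      then have "2 * C * \<rho> powr \<gamma> * (indicator {z. \<rho> / 4 \<le> norm z} z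
           * (((1 + 2 * (norm z / \<rho>)) powr \<gamma> - 1) * riesz \<alpha> z))
          \<le> 2 * C * \<rho> powr \<gamma> * (\<gamma> / \<beta> * 6 powr \<beta> * \<rho> powr - \<beta> * f2 z)"
        using C by (intro mult_left_mono) auto
      also have "\<dots> = e2 * f2 z" by (simp add: e2_def)
      finally show ?thesis
        using doubling_pointwise[of \<alpha> \<gamma> C x y w z] \<alpha> \<gamma>(1) C \<rho>0 \<rho>1 x1 maxz
        unfolding f1_def f3_def F_def Q_def q_def a_def[symmetric] \<rho>_def[symmetric]
        by fastforce
    qed
    obtain M where M: "\<And>x. \<bar>w x\<bar> \<le> M" using tame_bounded[OF w(1)] by blast
    have f1: "integrable lborel f1" unfolding f1_def by (rule riesz_truncated_integrable[OF \<alpha>])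
    have f2: "integrable lborel f2" "(LINT z|lborel. f2 z) \<le> T * (\<rho> / 4) powr - \<beta>"
      unfolding f2_def using T(2,3)[of "\<rho> / 4"] \<rho>0 by auto
    have f3: "integrable lborel f3"
      "(LINT z|lborel. f3 z) = unit_ball_vol (real ?N) * (\<rho> / 8) ^ ?N * (4 * \<rho> - (w x - w y))"
      unfolding f3_def F_def Q_def a_def
      using mirror_integral[OF tame_continuous[OF w(1)] M, of "\<rho> / 8"] \<rho>0 by auto
    have [measurable]: "f3 \<in> borel_measurable borel"
      using borel_measurable_integrable[OF f3(1)] by simp
    have f3': "integrable lborel (\<lambda>z. f3 (- z))" "(LINT z|lborel. f3 (- z)) = (LINT z|lborel. f3 z)"
      using lborel_integrable_reflect[of f3] lborel_integral_reflect[of f3] f3(1) by auto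
    have "- 2 \<le> jump_op (riesz_core \<alpha>) w x - jump_op (riesz_core \<alpha>) w y"
      using w(3)[of x] w(3)[of y] x1 y1 by auto
    also have "\<dots> = (LINT z|lborel. (second_diff w x z - second_diff w y z) * riesz_core \<alpha> z)"
      using jump_op_integrable[OF \<alpha> w(1) riesz_core_below] by (simp add: jump_op_def left_diff_distrib)
    also have "\<dots> \<le> (LINT z|lborel. 4 * f1 z + e2 * f2 z + q * (f3 z + f3 (- z)))"
      using jump_op_integrable[OF \<alpha> w(1) riesz_core_below] f1 f2 f3 f3' pw
      by (intro integral_mono) (auto simp: left_diff_distrib)
    also have "\<dots> = 4 * J + e2 * (LINT z|lborel. f2 z) + q * (2 * (LINT z|lborel. f3 z))"
      using f1 f2 f3 f3' by (simp add: J_def f1_def)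
    also have "\<dots> \<le> 4 * J + C * (\<gamma> * K) * \<rho> powr (\<gamma> - \<alpha>) + c * \<rho> powr (\<gamma> - \<alpha>) * (4 - C)"
    proof -
      have "e2 * (LINT z|lborel. f2 z) \<le> e2 * (T * (\<rho> / 4) powr - \<beta>)"
        by (rule mult_left_mono[OF f2(2) e2])
      also have "(\<rho> / 4) powr - \<beta> = 4 powr \<beta> * \<rho> powr - \<beta>"
        using \<rho>0 by (simp add: powr_divide powr_minus_divide)
      also have "e2 * (T * (4 powr \<beta> * \<rho> powr - \<beta>))
          = C * (\<gamma> * K) * (\<rho> powr \<gamma> * \<rho> powr - \<beta> * \<rho> powr - \<beta>)"
        by (simp add: e2_def K_def)
      also have "\<rho> powr \<gamma> * \<rho> powr - \<beta> * \<rho> powr - \<beta> = \<rho> powr (\<gamma> - \<alpha>)"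
        by (simp add: powr_add[symmetric] \<beta>_def)
      finally have A: "e2 * (LINT z|lborel. f2 z) \<le> C * (\<gamma> * K) * \<rho> powr (\<gamma> - \<alpha>)" .
      have "\<rho> powr 1 \<le> \<rho> powr \<gamma>" using \<gamma> \<rho>0 \<rho>1 by (intro powr_mono') auto
      then have "\<rho> \<le> \<rho> powr \<gamma>" using \<rho>0 by simp
      moreover have "\<rho> powr \<gamma> * (4 - C) = 4 * \<rho> powr \<gamma> - C * \<rho> powr \<gamma>"
        by (simp add: algebra_simps)
      \<comment> \<open>Positivity of the maximum turns the gain \<open>w x - w y\<close> into at
        least \<open>C * \<rho> powr \<gamma>\<close>.\<close>
      ultimately have "4 * \<rho> - (w x - w y) \<le> \<rho> powr \<gamma> * (4 - C)"
        using pos nn by linarith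
      moreover have "q * (2 * (unit_ball_vol (real ?N) * (\<rho> / 8) ^ ?N)) = c * \<rho> powr - \<alpha>"
      proof -
        have "(\<rho> / 8) ^ ?N = \<rho> powr real ?N / 8 ^ ?N"
          using \<rho>0 by (simp add: power_divide powr_realpow)
        moreover have "\<rho> powr - (real ?N + \<alpha>) * \<rho> powr real ?N = \<rho> powr - \<alpha>"
          by (simp add: powr_add[symmetric])
        ultimately show ?thesis by (simp add: q_def c_def)
      qed
      ultimately have "c * \<rho> powr - \<alpha> * (4 * \<rho> - (w x - w y)) \<le> c * \<rho> powr - \<alpha> * (\<rho> powr \<gamma> * (4 - C))"
        using c by (intro mult_left_mono) auto
      moreover have "q * (2 * (LINT z|lborel. f3 z)) = c * \<rho> powr - \<alpha> * (4 * \<rho> - (w x - w y))"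
        unfolding f3(2) \<open>q * (2 * (unit_ball_vol (real ?N) * (\<rho> / 8) ^ ?N)) = c * \<rho> powr - \<alpha>\<close>[symmetric]
        by (simp only: mult.assoc)
      moreover have "c * \<rho> powr - \<alpha> * (\<rho> powr \<gamma> * (4 - C)) = c * \<rho> powr (\<gamma> - \<alpha>) * (4 - C)"
        by (simp add: diff_conv_add_uminus powr_add del: add_uminus_conv_diff)
      ultimately show ?thesis using A by linarith
    qed
    also have "\<dots> \<le> 4 * J + c * (4 - C / 2)"
    proof -
      have "1 \<le> \<rho> powr (\<gamma> - \<alpha>)"
        using powr_mono'[of "\<gamma> - \<alpha>" 0 \<rho>] \<gamma> \<rho>0 \<rho>1 \<alpha> by (simp add: \<beta>_def)
      have "C * (\<gamma> * K) \<le> C * (c / 2)" using C \<gamma>K by (intro mult_left_mono) auto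
      then have "C * (\<gamma> * K) * \<rho> powr (\<gamma> - \<alpha>) \<le> C * (c / 2) * \<rho> powr (\<gamma> - \<alpha>)"
        by (rule mult_right_mono) simp
      moreover have "C * (c / 2) * \<rho> powr (\<gamma> - \<alpha>) + c * \<rho> powr (\<gamma> - \<alpha>) * (4 - C)
          = - (c * (C / 2 - 4) * \<rho> powr (\<gamma> - \<alpha>))"
        by (simp add: algebra_simps)
      moreover have "c * (C / 2 - 4) * 1 \<le> c * (C / 2 - 4) * \<rho> powr (\<gamma> - \<alpha>)"
        using c C \<open>1 \<le> \<rho> powr (\<gamma> - \<alpha>)\<close> by (intro mult_left_mono) auto
      ultimately show ?thesis by (simp add: algebra_simps)
    qed
    finally show False using C(2) by linarith
  qed
  then show ?thesis using \<gamma> C(1) by (intro exI[of _ C] exI[of _ \<gamma>]) auto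
qed

subsection \<open>Interior bounds for difference quotients\<close>

definition diff_quot :: "('a::euclidean_space \<Rightarrow> real) \<Rightarrow> 'a \<Rightarrow> 'a \<Rightarrow> real" where
  "diff_quot w v x = (w (x + v) - w x) / norm v"

text \<open>Away from \<open>0\<close> this is the kernel cut at height \<open>1\<close>, the
  complement of \<open>riesz_core\<close>.\<close>

definition riesz_flat :: "real \<Rightarrow> 'a::euclidean_space \<Rightarrow> real" where
  "riesz_flat \<alpha> z = max 1 (norm z) powr - (real DIM('a) + \<alpha>)"

text \<open>The kernels alone do not add up at \<open>z = 0\<close>, where \<open>riesz\<close> is
  \<open>0\<close> by the convention for \<open>powr\<close> and \<open>riesz_flat\<close> is
  \<open>1\<close>; the second difference vanishes there, so the products do.\<close>

lemma riesz_split: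
  assumes "0 < \<alpha>"
  shows "second_diff w x z * riesz \<alpha> z
    = second_diff w x z * riesz_core \<alpha> z + second_diff w x z * riesz_flat \<alpha> z"
proof (cases "z = 0")
  case False
  have p: "0 < real DIM('a) + \<alpha>" using assms by (simp add: add_pos_pos)
  have "riesz \<alpha> z = riesz_core \<alpha> z + riesz_flat \<alpha> z"
  proof (cases "norm z \<le> 1")
    case True
    then show ?thesis
      using False p powr_mono2'[of "- (real DIM('a) + \<alpha>)" "norm z" 1]
      by (simp add: riesz_core_def riesz_flat_def riesz_def)
  next
    case F: False
    then show ?thesis
      using riesz_core_far[OF assms, of z] by (simp add: riesz_flat_def riesz_def)
  qed
  then show ?thesis by (simp add: distrib_left)
qed (simp add: second_diff_def)

lemma riesz_flat_measurable [measurable]: "riesz_flat \<alpha> \<in> borel_measurable borel"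
  unfolding riesz_flat_def[abs_def] by measurable

lemma riesz_flat_nonneg [simp]: "0 \<le> riesz_flat \<alpha> z"
  by (simp add: riesz_flat_def)

lemma riesz_flat_integrable:
  assumes "0 < \<alpha>"
  shows "integrable lborel (riesz_flat \<alpha> :: 'a::euclidean_space \<Rightarrow> real)"
proof (rule integrable_bound_measurable)
  have "integrable lborel (\<lambda>z::'a. indicator (ball 0 1) z * (1::real))"
    by (rule bounded_indicator_integrable) (auto simp: borel_open)
  then show "integrable lborel (\<lambda>z::'a. indicator (ball 0 1) z * 1 + indicator {z. 1 \<le> norm z} z * riesz \<alpha> z)"
    using riesz_tail[OF assms, of 1, where 'a='a] by (intro Bochner_Integration.integrable_add) auto
  show "\<bar>riesz_flat \<alpha> z\<bar> \<le> indicator (ball 0 1) z * 1 + indicator {z. 1 \<le> norm z} z * riesz \<alpha> z" for z :: 'a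
    by (auto simp: riesz_flat_def riesz_def indicator_def)
qed measurable

lemma powr_neg_lipschitz:
  fixes a b p :: real
  assumes p: "0 < p" and ab: "0 < a" "a \<le> b"
  shows "\<bar>b powr - p - a powr - p\<bar> \<le> p * a powr (- p - 1) * (b - a)"
proof (cases "a = b")
  case False
  then have "a < b" using ab by simp
  have "\<exists>z. a < z \<and> z < b \<and> b powr - p - a powr - p = (b - a) * (- p * z powr (- p - 1))"
  proof (rule MVT2[OF \<open>a < b\<close>])
    show "((\<lambda>x. x powr - p) has_real_derivative - p * x powr (- p - 1)) (at x)" if "a \<le> x" for x
      using ab that by (auto intro!: derivative_eq_intros)
  qed
  then obtain z where z: "a < z" "b powr - p - a powr - p = (b - a) * (- p * z powr (- p - 1))"
    by blast
  have "z powr (- p - 1) \<le> a powr (- p - 1)" using z ab p by (intro powr_mono2') auto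
  then have "(b - a) * (p * z powr (- p - 1)) \<le> (b - a) * (p * a powr (- p - 1))"
    using ab p by (intro mult_left_mono) auto
  then show ?thesis using ab p by (simp add: z(2) abs_mult mult.commute mult.left_commute)
qed simp

text \<open>The kernel itself stands on the right, so the error stays integrable. A shift of length
  at most \<open>1\<close> lowers \<open>max 1 (norm z)\<close> by at most a factor
  \<open>2\<close>, the source of the power of \<open>2\<close>.\<close>

lemma riesz_flat_lipschitz:
  fixes v z :: "'a::euclidean_space"
  assumes \<alpha>: "0 < \<alpha>" and v: "norm v \<le> 1"
  defines "p \<equiv> real DIM('a) + \<alpha>"
  shows "\<bar>riesz_flat \<alpha> (z - v) - riesz_flat \<alpha> z\<bar> \<le> p * 2 powr (p + 1) * norm v * riesz_flat \<alpha> z"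
proof -
  have p: "0 < p" using \<alpha> by (simp add: p_def add_pos_pos)
  define m where "m = max 1 (norm z)"
  define m' where "m' = max 1 (norm (z - v))"
  have d: "\<bar>m - m'\<bar> \<le> norm v"
    using norm_triangle_ineq3[of z "z - v"] by (auto simp: m_def m'_def max_def)
  have m: "1 \<le> m" "m / 2 \<le> m'" "1 \<le> m'" using d v by (auto simp: m_def m'_def max_def)
  have "\<bar>m' powr - p - m powr - p\<bar> \<le> p * (min m m') powr (- p - 1) * \<bar>m - m'\<bar>"
    using powr_neg_lipschitz[OF p, of m m'] powr_neg_lipschitz[OF p, of m' m] m
    by (cases "m \<le> m'") (auto simp: min_def abs_minus_commute)
  also have "\<dots> \<le> p * (m / 2) powr (- p - 1) * norm v"
    using m p d by (intro mult_mono mult_left_mono powr_mono2') auto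
  also have "(m / 2) powr (- p - 1) = 2 powr (p + 1) * m powr (- p - 1)"
  proof -
    have "2 powr (- p - 1) * 2 powr (p + 1) = (1::real)"
      by (simp only: powr_add[symmetric]) simp
    then show ?thesis using m by (simp add: powr_divide field_simps)
  qed
  also have "m powr (- p - 1) \<le> m powr - p" using m by (intro powr_mono) auto
  then have "p * (2 powr (p + 1) * m powr (- p - 1)) * norm v \<le> p * (2 powr (p + 1) * m powr - p) * norm v"
    using p by (intro mult_left_mono mult_right_mono) auto
  finally show ?thesis
    by (simp add: riesz_flat_def m_def m'_def p_def mult.assoc mult.commute mult.left_commute)
qed

text \<open>Normalizing by \<open>E\<close> and using both signs of \<open>w\<close> makes the
  one-sided unit estimate two-sided and homogeneous.\<close>

lemma holder_core:
  assumes \<alpha>: "0 < \<alpha>" "\<alpha> < 2"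
  shows "\<exists>C \<gamma>. 0 < C \<and> 0 < \<gamma> \<and> (\<forall>(w::'a::euclidean_space \<Rightarrow> real) E. tame w \<longrightarrow> 0 < E \<longrightarrow>
     (\<forall>x\<in>cball 0 3. \<bar>w x\<bar> \<le> E) \<longrightarrow> (\<forall>x\<in>cball 0 2. \<bar>jump_op (riesz_core \<alpha>) w x\<bar> \<le> E) \<longrightarrow>
     (\<forall>y\<in>cball 0 3. \<bar>w y - w 0\<bar> \<le> C * E * norm y powr \<gamma>))"
proof -
  obtain C \<gamma> where C: "0 < C" "0 < \<gamma>" and H: "\<forall>w::'a \<Rightarrow> real. tame w \<longrightarrow>
     (\<forall>x\<in>cball 0 3. \<bar>w x\<bar> \<le> 1) \<longrightarrow> (\<forall>x\<in>cball 0 2. \<bar>jump_op (riesz_core \<alpha>) w x\<bar> \<le> 1) \<longrightarrow>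
     (\<forall>y\<in>cball 0 3. w 0 - w y \<le> C * norm y powr \<gamma>)"
    using holder_one_sided[OF \<alpha>, where 'a='a] by blast
  have "\<bar>w y - w 0\<bar> \<le> C * E * norm y powr \<gamma>"
    if w: "tame w" and E: "0 < E" and b: "\<forall>x\<in>cball 0 3. \<bar>w x\<bar> \<le> E"
      "\<forall>x\<in>cball 0 2. \<bar>jump_op (riesz_core \<alpha>) w x\<bar> \<le> E" and y: "y \<in> cball 0 3"
    for w :: "'a \<Rightarrow> real" and E y
  proof -
    have s: "s * (w 0 - w y) \<le> C * norm y powr \<gamma>" if s: "\<bar>s\<bar> = 1 / E" for s
    proof -
      let ?w = "\<lambda>x. s * w x + 0 * w x + 0"
      have le: "\<bar>s * t\<bar> \<le> 1" if "\<bar>t\<bar> \<le> E" for t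
        using mult_left_mono[OF that, of "1 / E"] E s by (simp add: abs_mult)
      have "tame ?w" by (rule tame_combine[OF w w])
      moreover have "\<forall>x\<in>cball 0 3. \<bar>?w x\<bar> \<le> 1"
        using b(1) le by simp
      moreover have "\<forall>x\<in>cball 0 2. \<bar>jump_op (riesz_core \<alpha>) ?w x\<bar> \<le> 1"
        using b(2) le
        by (subst jump_op_combine[OF \<alpha> riesz_core_below w w]) simp
      ultimately have "?w 0 - ?w y \<le> C * norm y powr \<gamma>" using H y by blast
      then show ?thesis by (simp add: right_diff_distrib)
    qed
    show ?thesis using s[of "1 / E"] s[of "- 1 / E"] E by (simp add: abs_le_iff field_simps)
  qed
  then show ?thesis using C by blast
qed

lemma diff_quot_combine:
  "diff_quot w v = (\<lambda>x. 1 / norm v * w (x + v) + (- 1 / norm v) * w x + 0)"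
  by (simp add: fun_eq_iff diff_quot_def diff_divide_distrib)

lemma tame_diff_quot: "tame w \<Longrightarrow> tame (diff_quot w v)"
  unfolding diff_quot_combine by (intro tame_combine tame_shift)

lemma jump_op_diff_quot:
  assumes "0 < \<alpha>" "\<alpha> < 2" "tame w"
    and "jump_op (riesz \<alpha>) w x = 0" "jump_op (riesz \<alpha>) w (x + v) = 0"
  shows "jump_op (riesz \<alpha>) (diff_quot w v) x = 0"
  unfolding diff_quot_combine
  by (subst jump_op_combine[OF assms(1,2) below_riesz_self tame_shift[OF assms(3)] assms(3)])
    (simp add: jump_op_shift assms)

text \<open>Only the bound \<open>M\<close> of \<open>w\<close> itself enters through the far jumps: there the difference
  quotient is moved to the kernel.\<close>

lemma diff_quot_core_bound:
  assumes \<alpha>: "0 < \<alpha>" "\<alpha> < 2"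
  shows "\<exists>K>0. \<forall>(w::'a::euclidean_space \<Rightarrow> real) v x M A. tame w \<longrightarrow> (\<forall>x. \<bar>w x\<bar> \<le> M) \<longrightarrow>
     v \<noteq> 0 \<longrightarrow> norm v \<le> 1 \<longrightarrow> jump_op (riesz \<alpha>) (diff_quot w v) x = 0 \<longrightarrow>
     \<bar>diff_quot w v x\<bar> \<le> A \<longrightarrow> \<bar>jump_op (riesz_core \<alpha>) (diff_quot w v) x\<bar> \<le> K * (A + M)"
proof -
  let ?k = "riesz_flat \<alpha> :: 'a \<Rightarrow> real"
  let ?p = "real DIM('a) + \<alpha>"
  define L where "L = ?p * 2 powr (?p + 1)"
  have L: "0 \<le> L" using \<alpha> by (simp add: L_def)
  define I where "I = (LINT z|lborel. ?k z)"
  have I: "0 \<le> I" unfolding I_def by (intro integral_nonneg_AE AE_I2) simp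
  have k: "integrable lborel ?k" by (rule riesz_flat_integrable[OF \<alpha>(1)])
  have "\<bar>jump_op (riesz_core \<alpha>) (diff_quot w v) x\<bar> \<le> 2 * (1 + L) * I * (A + M)"
    if w: "tame w" and M: "\<And>x. \<bar>w x\<bar> \<le> M" and v: "v \<noteq> 0" "norm v \<le> 1"
      and 0: "jump_op (riesz \<alpha>) (diff_quot w v) x = 0" and A: "\<bar>diff_quot w v x\<bar> \<le> A"
    for w :: "'a \<Rightarrow> real" and v x M A
  proof -
    let ?h = "diff_quot w v"
    have M0: "0 \<le> M" using M[of 0] by linarith
    have A0: "0 \<le> A" using A by linarith
    have [measurable]: "w \<in> borel_measurable borel" by (rule tame_measurable[OF w])
    have th: "tame ?h" by (rule tame_diff_quot[OF w])
    have [measurable]: "?h \<in> borel_measurable borel" by (rule tame_measurable[OF th])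
    have wk: "integrable lborel (\<lambda>z. f z * ?k z)"
      if "f \<in> borel_measurable borel" "\<And>z. \<bar>f z\<bar> \<le> B" for f B
    proof (rule integrable_bound_measurable)
      show "integrable lborel (\<lambda>z. B * ?k z)" using k by simp
      show "(\<lambda>z. f z * ?k z) \<in> borel_measurable borel" using that(1) by measurable
      show "\<bar>f z * ?k z\<bar> \<le> B * ?k z" for z
        using that(2)[of z] by (simp add: abs_mult mult_right_mono)
    qed
    \<comment> \<open>This translation moves the increment from \<open>w\<close> to the
      kernel.\<close>
    have shift: "(LINT z|lborel. w (x + v + z) * ?k z) = (LINT z|lborel. w (x + z) * ?k (z - v))"
      using lborel_integral_shift[of "\<lambda>z. w (x + z) * ?k (z - v)" v] by (simp add: algebra_simps)
    have shifti: "integrable lborel (\<lambda>z. w (x + z) * ?k (z - v))"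
      using lborel_integrable_shift[of "\<lambda>z. w (x + z) * ?k (z - v)" v] wk[of "\<lambda>z. w (x + v + z)" M] M
      by (simp add: algebra_simps)
    obtain B where B: "\<And>x. \<bar>?h x\<bar> \<le> B" using tame_bounded[OF th] by blast
    have hplus: "integrable lborel (\<lambda>z. ?h (x + z) * ?k z)" by (rule wk[OF _ B]) measurable
    have hminus: "integrable lborel (\<lambda>z. ?h (x - z) * ?k z)" by (rule wk[OF _ B]) measurable
    have refl: "(LINT z|lborel. ?h (x - z) * ?k z) = (LINT z|lborel. ?h (x + z) * ?k z)"
      using lborel_integral_reflect[of "\<lambda>z. ?h (x + z) * ?k z"] by (simp add: riesz_flat_def)
    have "norm v * (LINT z|lborel. ?h (x + z) * ?k z)
        = (LINT z|lborel. norm v * (?h (x + z) * ?k z))" by simp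
    also have "\<dots> = (LINT z|lborel. w (x + v + z) * ?k z - w (x + z) * ?k z)"
      using v by (intro Bochner_Integration.integral_cong) (auto simp: diff_quot_def field_simps)
    also have "\<dots> = (LINT z|lborel. w (x + v + z) * ?k z) - (LINT z|lborel. w (x + z) * ?k z)"
      by (intro Bochner_Integration.integral_diff wk[OF _ M]) measurable
    also have "\<dots> = (LINT z|lborel. w (x + z) * (?k (z - v) - ?k z))"
      unfolding shift right_diff_distrib
      by (intro Bochner_Integration.integral_diff[symmetric] shifti wk[OF _ M]) measurable
    finally have eq: "norm v * (LINT z|lborel. ?h (x + z) * ?k z)
      = (LINT z|lborel. w (x + z) * (?k (z - v) - ?k z))" .
    have nb: "norm (LINT z|lborel. w (x + z) * (?k (z - v) - ?k z)) \<le> (LINT z|lborel. M * (L * norm v) * ?k z)"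
    proof (rule Bochner_Integration.integral_norm_bound_integral)
      show "integrable lborel (\<lambda>z. w (x + z) * (?k (z - v) - ?k z))"
        unfolding right_diff_distrib
        by (intro Bochner_Integration.integrable_diff shifti wk[OF _ M]) measurable
      show "integrable lborel (\<lambda>z. M * (L * norm v) * ?k z)" using k by simp
      fix z
      have "\<bar>w (x + z)\<bar> * \<bar>?k (z - v) - ?k z\<bar> \<le> M * (L * norm v * ?k z)"
        using M M0 riesz_flat_lipschitz[OF \<alpha>(1) v(2), of z] by (intro mult_mono) (auto simp: L_def)
      then show "norm (w (x + z) * (?k (z - v) - ?k z)) \<le> M * (L * norm v) * ?k z"
        by (simp add: abs_mult mult.assoc)
    qed
    have "norm v * \<bar>LINT z|lborel. ?h (x + z) * ?k z\<bar> \<le> norm v * (M * L * I)"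
    proof -
      have "(LINT z|lborel. M * (L * norm v) * ?k z) = norm v * (M * L * I)" by (simp add: I_def)
      moreover have "norm (norm v * (LINT z|lborel. ?h (x + z) * ?k z))
          = norm v * \<bar>LINT z|lborel. ?h (x + z) * ?k z\<bar>"
        by (simp only: norm_mult real_norm_def abs_norm_cancel abs_mult)
      ultimately show ?thesis using nb[unfolded eq[symmetric]] by (simp only:)
    qed
    then have P: "\<bar>LINT z|lborel. ?h (x + z) * ?k z\<bar> \<le> M * L * I" using v by simp
    have sk: "second_diff ?h x z * ?k z = ?h (x + z) * ?k z + ?h (x - z) * ?k z - 2 * ?h x * ?k z" for z
      by (simp add: second_diff_def algebra_simps)
    have "(LINT z|lborel. second_diff ?h x z * riesz \<alpha> z)
        = jump_op (riesz_core \<alpha>) ?h x + (LINT z|lborel. second_diff ?h x z * ?k z)"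
      unfolding riesz_split[OF \<alpha>(1)] jump_op_def
      by (intro Bochner_Integration.integral_add jump_op_integrable[OF \<alpha> th riesz_core_below])
        (use hplus hminus k in \<open>simp add: sk\<close>)
    moreover have "(LINT z|lborel. second_diff ?h x z * ?k z)
        = (LINT z|lborel. ?h (x + z) * ?k z + ?h (x - z) * ?k z - 2 * ?h x * ?k z)"
      by (simp only: sk)
    moreover have "\<dots> = 2 * (LINT z|lborel. ?h (x + z) * ?k z) - 2 * ?h x * I"
      using hplus hminus k by (simp add: refl I_def)
    ultimately have "jump_op (riesz_core \<alpha>) ?h x = 2 * ?h x * I - 2 * (LINT z|lborel. ?h (x + z) * ?k z)"
      using 0 by (simp add: jump_op_def)
    moreover have "\<bar>?h x * I\<bar> \<le> A * I" using A I by (simp add: abs_mult mult_right_mono)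
    ultimately have "\<bar>jump_op (riesz_core \<alpha>) ?h x\<bar> \<le> 2 * (A * I) + 2 * (M * L * I)"
      using P by linarith
    also have "\<dots> \<le> 2 * (1 + L) * I * (A + M)"
      using A0 M0 L I by (simp add: algebra_simps)
    finally show ?thesis .
  qed
  then have "\<bar>jump_op (riesz_core \<alpha>) (diff_quot w v) x\<bar> \<le> (2 * (1 + L) * I + 1) * (A + M)"
    if "tame w" "\<forall>x. \<bar>w x\<bar> \<le> M" "v \<noteq> 0" "norm v \<le> 1"
      "jump_op (riesz \<alpha>) (diff_quot w v) x = 0" "\<bar>diff_quot w v x\<bar> \<le> A"
    for w :: "'a \<Rightarrow> real" and v x M A
  proof -
    have "0 \<le> A + M" using that(6) that(2)[rule_format, of 0] by linarith
    moreover have "\<bar>jump_op (riesz_core \<alpha>) (diff_quot w v) x\<bar> \<le> 2 * (1 + L) * I * (A + M)"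
      by (rule \<open>\<And>x w v M A. \<lbrakk>tame w; \<And>x. \<bar>w x\<bar> \<le> M; v \<noteq> 0; norm v \<le> 1;
         jump_op (riesz \<alpha>) (diff_quot w v) x = 0; \<bar>diff_quot w v x\<bar> \<le> A\<rbrakk>
         \<Longrightarrow> \<bar>jump_op (riesz_core \<alpha>) (diff_quot w v) x\<bar> \<le> 2 * (1 + L) * I * (A + M)\<close>)
        (use that in auto)
    ultimately show ?thesis by (simp add: distrib_right)
  qed
  moreover have "0 < 2 * (1 + L) * I + 1" using L I by (simp add: add_nonneg_pos)
  ultimately show ?thesis by blast
qed

text \<open>Since \<open>norm v \<le> 1\<close>, the equation for \<open>w\<close> in radius
  \<open>3\<close> yields that for the quotient in radius \<open>2\<close>, where
  \<open>holder_core\<close> needs control of the operator.\<close>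

lemma diff_quot_holder:
  assumes \<alpha>: "0 < \<alpha>" "\<alpha> < 2"
  shows "\<exists>K \<gamma>. 0 < K \<and> 0 < \<gamma> \<and> (\<forall>(w::'a::euclidean_space \<Rightarrow> real) v M A. tame w \<longrightarrow> 0 < M \<longrightarrow>
     (\<forall>x. \<bar>w x\<bar> \<le> M) \<longrightarrow> v \<noteq> 0 \<longrightarrow> norm v \<le> 1 \<longrightarrow>
     (\<forall>x\<in>cball 0 3. jump_op (riesz \<alpha>) w x = 0) \<longrightarrow> (\<forall>x\<in>cball 0 3. \<bar>diff_quot w v x\<bar> \<le> A) \<longrightarrow>
     (\<forall>y\<in>cball 0 3. \<bar>diff_quot w v y - diff_quot w v 0\<bar> \<le> K * (A + M) * norm y powr \<gamma>))"
proof -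
  obtain C \<gamma> where C: "0 < C" "0 < \<gamma>" and H: "\<forall>(w::'a \<Rightarrow> real) E. tame w \<longrightarrow> 0 < E \<longrightarrow>
     (\<forall>x\<in>cball 0 3. \<bar>w x\<bar> \<le> E) \<longrightarrow> (\<forall>x\<in>cball 0 2. \<bar>jump_op (riesz_core \<alpha>) w x\<bar> \<le> E) \<longrightarrow>
     (\<forall>y\<in>cball 0 3. \<bar>w y - w 0\<bar> \<le> C * E * norm y powr \<gamma>)"
    using holder_core[OF \<alpha>, where 'a='a] by blast
  obtain K where K: "0 < K" "\<forall>(w::'a \<Rightarrow> real) v x M A. tame w \<longrightarrow> (\<forall>x. \<bar>w x\<bar> \<le> M) \<longrightarrow>
     v \<noteq> 0 \<longrightarrow> norm v \<le> 1 \<longrightarrow> jump_op (riesz \<alpha>) (diff_quot w v) x = 0 \<longrightarrow>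
     \<bar>diff_quot w v x\<bar> \<le> A \<longrightarrow> \<bar>jump_op (riesz_core \<alpha>) (diff_quot w v) x\<bar> \<le> K * (A + M)"
    using diff_quot_core_bound[OF \<alpha>, where 'a='a] by blast
  have "\<bar>diff_quot w v y - diff_quot w v 0\<bar> \<le> C * (K + 1) * (A + M) * norm y powr \<gamma>"
    if w: "tame w" and M: "0 < M" "\<forall>x. \<bar>w x\<bar> \<le> M" and v: "v \<noteq> 0" "norm v \<le> 1"
      and 0: "\<forall>x\<in>cball 0 3. jump_op (riesz \<alpha>) w x = 0"
      and A: "\<forall>x\<in>cball 0 3. \<bar>diff_quot w v x\<bar> \<le> A" and y: "y \<in> cball 0 3"
    for w :: "'a \<Rightarrow> real" and v M A y
  proof -
    have "0 \<le> A" using A[rule_format, of 0] by simp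
    then have AM: "0 < A + M" using M by simp
    let ?E = "(K + 1) * (A + M)"
    have E3: "0 < ?E" using K(1) AM by (intro mult_pos_pos) auto
    moreover have "0 < K * (A + M)" using K(1) AM by simp
    ultimately have E: "A \<le> ?E" "K * (A + M) \<le> ?E" "0 < ?E"
      using AM M by (simp_all add: distrib_right)
    have "\<forall>x\<in>cball 0 3. \<bar>diff_quot w v x\<bar> \<le> ?E" using A E(1) by force
    moreover have "\<forall>x\<in>cball 0 2. \<bar>jump_op (riesz_core \<alpha>) (diff_quot w v) x\<bar> \<le> ?E"
    proof
      fix x :: 'a assume x: "x \<in> cball 0 2"
      then have "norm (x + v) \<le> 3" using v norm_triangle_ineq[of x v] by simp
      then have "jump_op (riesz \<alpha>) (diff_quot w v) x = 0"
        using x 0 by (intro jump_op_diff_quot[OF \<alpha> w]) auto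
      then have "\<bar>jump_op (riesz_core \<alpha>) (diff_quot w v) x\<bar> \<le> K * (A + M)"
        using K(2) w M(2) v A x by simp
      then show "\<bar>jump_op (riesz_core \<alpha>) (diff_quot w v) x\<bar> \<le> ?E" using E(2) by linarith
    qed
    ultimately have "\<bar>diff_quot w v y - diff_quot w v 0\<bar> \<le> C * ?E * norm y powr \<gamma>"
      using H tame_diff_quot[OF w] E(3) y by blast
    then show ?thesis by (simp add: mult.assoc)
  qed
  moreover have "0 < C * (K + 1)" using C K by simp
  ultimately show ?thesis using C(2) by blast
qed


lemma diff_quot_affine:
  assumes "0 < c"
  shows "diff_quot (\<lambda>x. w (t + c *\<^sub>R x)) ((1 / c) *\<^sub>R v) x = c * diff_quot w v (t + c *\<^sub>R x)"
  using assms by (simp add: diff_quot_def algebra_simps)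

lemma diff_quot_telescope:
  assumes v: "v \<noteq> 0"
  shows "w (real m *\<^sub>R v) - w 0 = norm v * (\<Sum>j<m. diff_quot w v (real j *\<^sub>R v))"
proof (induction m)
  case (Suc m)
  have "norm v * diff_quot w v (real m *\<^sub>R v) = w (real (Suc m) *\<^sub>R v) - w (real m *\<^sub>R v)"
    using v by (simp add: diff_quot_def scaleR_left_distrib add.commute)
  then show ?case using Suc by (simp add: distrib_left)
qed simp

text \<open>Interpolating between the Hoelder bound for the quotients and the bound for \<open>w\<close> reproduces
  the weighted supremum of the quotients with a factor \<open>1 / 2\<close>, which can then be absorbed.\<close>

lemma diff_quot_interior_bound:
  assumes \<alpha>: "0 < \<alpha>" "\<alpha> < 2"
  shows "\<exists>C>0. \<forall>(w::'a::euclidean_space \<Rightarrow> real) v M. tame w \<longrightarrow> 0 < M \<longrightarrow>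
     (\<forall>x. \<bar>w x\<bar> \<le> M) \<longrightarrow> v \<noteq> 0 \<longrightarrow> (\<forall>x\<in>ball 0 1. jump_op (riesz \<alpha>) w x = 0) \<longrightarrow>
     (\<forall>x\<in>ball 0 1. (1 - norm x) * \<bar>diff_quot w v x\<bar> \<le> C * M)"
proof -
  obtain K \<gamma> where K: "0 < K" "0 < \<gamma>" and H: "\<forall>(w::'a \<Rightarrow> real) v M A. tame w \<longrightarrow> 0 < M \<longrightarrow>
     (\<forall>x. \<bar>w x\<bar> \<le> M) \<longrightarrow> v \<noteq> 0 \<longrightarrow> norm v \<le> 1 \<longrightarrow>
     (\<forall>x\<in>cball 0 3. jump_op (riesz \<alpha>) w x = 0) \<longrightarrow> (\<forall>x\<in>cball 0 3. \<bar>diff_quot w v x\<bar> \<le> A) \<longrightarrow>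
     (\<forall>y\<in>cball 0 3. \<bar>diff_quot w v y - diff_quot w v 0\<bar> \<le> K * (A + M) * norm y powr \<gamma>)"
    using diff_quot_holder[OF \<alpha>, where 'a='a] by blast
  \<comment> \<open>Over the distance \<open>\<delta>\<close> the Hoelder term is at most a quarter
    of the bounds that enter it, small enough to be absorbed.\<close>
  define \<delta> where "\<delta> = min 1 ((1 / (4 * K)) powr (1 / \<gamma>))"
  have \<delta>: "0 < \<delta>" "\<delta> \<le> 1" using K by (simp_all add: \<delta>_def)
  have "\<delta> powr \<gamma> \<le> ((1 / (4 * K)) powr (1 / \<gamma>)) powr \<gamma>"
    using \<delta> K by (intro powr_mono2) (auto simp: \<delta>_def)
  then have \<delta>K: "K * \<delta> powr \<gamma> \<le> 1 / 4" using K by (simp add: powr_powr field_simps)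
  have "(1 - norm x0) * \<bar>diff_quot w v x0\<bar> \<le> 2 * (32 / \<delta> + 2) * M"
    if w: "tame w" and M: "0 < M" "\<forall>x. \<bar>w x\<bar> \<le> M" and v: "v \<noteq> 0"
      and 0: "\<forall>x\<in>ball 0 1. jump_op (riesz \<alpha>) w x = 0" and x0: "x0 \<in> ball 0 1"
    for w :: "'a \<Rightarrow> real" and v M x0
  proof -
    have triv: "\<bar>diff_quot w v x\<bar> \<le> 2 * M / norm v" for x
    proof -
      have "\<bar>w (x + v) - w x\<bar> \<le> 2 * M" using M(2)[rule_format, of x] M(2)[rule_format, of "x + v"] by linarith
      then show ?thesis by (simp add: diff_quot_def divide_right_mono)
    qed
    let ?g = "\<lambda>x. (1 - norm x) * \<bar>diff_quot w v x\<bar>"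
    \<comment> \<open>The weight compensates for the loss towards the boundary of the ball. The
      supremum is finite by the trivial bound \<open>2 * M / norm v\<close>; that bound depends on
      \<open>v\<close>, the final estimate does not.\<close>
    define A where "A = (SUP x\<in>ball 0 1. ?g x)"
    have bdd: "bdd_above (?g ` ball 0 1)"
    proof (rule bdd_aboveI2)
      fix x :: 'a assume "x \<in> ball 0 1"
      then have "?g x \<le> 1 * (2 * M / norm v)" using triv by (intro mult_mono) auto
      then show "?g x \<le> 2 * M / norm v" by simp
    qed
    have gA: "?g x \<le> A" if "x \<in> ball 0 1" for x
      unfolding A_def using that bdd by (rule cSUP_upper)
    have A0: "0 \<le> A" using gA[of 0] by (simp add: order_trans[OF abs_ge_zero])
    have step: "?g x \<le> A / 2 + (32 / \<delta> + 2) * M" if x: "x \<in> ball 0 1" for x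
    proof -
      define d where "d = 1 - norm x"
      have d: "0 < d" using x by (simp add: d_def)
      \<comment> \<open>The ball of radius \<open>3 * \<rho>\<close> stays where the weight is at
        least \<open>5 * d / 8\<close>, so the rescaled quotients are at most \<open>A / 5\<close>,
        hence at most \<open>A / 4\<close>.\<close>
      define \<rho> where "\<rho> = d / 8"
      have \<rho>: "0 < \<rho>" using d by (simp add: \<rho>_def)
      show ?thesis
      proof (cases "norm v \<le> \<delta> * \<rho>")
        case False
        then have "2 * M / norm v \<le> 2 * M / (\<delta> * \<rho>)"
          using M \<delta> \<rho> by (intro divide_left_mono mult_pos_pos) auto
        then have "\<bar>diff_quot w v x\<bar> \<le> 2 * M / (\<delta> * \<rho>)" using triv[of x] by linarith
        then have "?g x \<le> d * (2 * M / (\<delta> * \<rho>))" unfolding d_def[symmetric] using d by (intro mult_left_mono) auto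
        also have "\<dots> = 16 / \<delta> * M" using d \<delta> by (simp add: \<rho>_def)
        also have "\<dots> \<le> (32 / \<delta> + 2) * M" using M \<delta> by (intro mult_right_mono) (auto simp: field_simps)
        finally show ?thesis using A0 by linarith
      next
        case True
        let ?w = "\<lambda>y. w (x + \<rho> *\<^sub>R y)"
        define v' where "v' = (1 / \<rho>) *\<^sub>R v"
        have v': "v' \<noteq> 0" "norm v' \<le> \<delta>" using True v \<rho> by (auto simp: v'_def field_simps)
        have dq: "diff_quot ?w v' y = \<rho> * diff_quot w v (x + \<rho> *\<^sub>R y)" for y
          unfolding v'_def by (rule diff_quot_affine[OF \<rho>])
        have far: "1 - norm (x + \<rho> *\<^sub>R y) \<ge> 5 * d / 8" if "y \<in> cball 0 3" for y
        proof -
          have "\<rho> * norm y \<le> \<rho> * 3" using that \<rho> by (intro mult_left_mono) auto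
          then show ?thesis
            using norm_triangle_ineq[of x "\<rho> *\<^sub>R y"] \<rho> by (simp add: d_def \<rho>_def)
        qed
        have in1: "x + \<rho> *\<^sub>R y \<in> ball 0 1" if "y \<in> cball 0 3" for y
          using far[OF that] d by simp
        have H': "\<bar>diff_quot ?w v' y - diff_quot ?w v' 0\<bar> \<le> K * (A / 4 + M) * norm y powr \<gamma>"
          if "y \<in> cball 0 3" for y
        proof (rule H[rule_format])
          show "tame ?w" by (rule tame_affine[OF w])
          show "\<bar>w (x + \<rho> *\<^sub>R y)\<bar> \<le> M" for y using M by blast
          show "norm v' \<le> 1" using v' \<delta> by linarith
          show "jump_op (riesz \<alpha>) ?w y = 0" if "y \<in> cball 0 3" for y
            using jump_op_affine[OF w \<rho>, of \<alpha> x y] 0 in1[OF that] by simp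
          show "\<bar>diff_quot ?w v' y\<bar> \<le> A / 4" if y: "y \<in> cball 0 3" for y
          proof -
            let ?q = "\<bar>diff_quot w v (x + \<rho> *\<^sub>R y)\<bar>"
            have "5 * d / 8 * ?q \<le> A"
              using gA[OF in1[OF y]] far[OF y] by (meson abs_ge_zero mult_right_mono order_trans)
            moreover have "\<bar>diff_quot ?w v' y\<bar> = d / 8 * ?q"
              unfolding dq using d by (simp add: abs_mult \<rho>_def)
            ultimately show ?thesis using A0 by simp
          qed
        qed (use M v' that in auto)
        \<comment> \<open>The number of steps \<open>v'\<close> that fit into length
          \<open>\<delta>\<close>; together they cover at least half of it. The quotients along them
          are close to the first, and their sum telescopes to an increment of size at most
          \<open>2 * M\<close>.\<close>
        define m where "m = nat \<lfloor>\<delta> / norm v'\<rfloor>"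
        have q: "1 \<le> \<delta> / norm v'" using v' by (simp add: field_simps)
        have m: "1 \<le> m" "real m \<le> \<delta> / norm v'" "\<delta> / norm v' < real m + 1"
          using q by (auto simp: m_def le_nat_iff le_floor_iff)
        have mv: "real m * norm v' \<le> \<delta>" "\<delta> / 2 \<le> real m * norm v'"
        proof -
          show "real m * norm v' \<le> \<delta>" using m(2) v' by (simp add: field_simps)
          have "\<delta> / norm v' \<le> 2 * real m" using m by linarith
          then show "\<delta> / 2 \<le> real m * norm v'" using v' by (simp add: field_simps)
        qed
        let ?q0 = "diff_quot ?w v' 0"
        define e where "e = K * (A / 4 + M) * \<delta> powr \<gamma>"
        have "\<bar>diff_quot ?w v' (real j *\<^sub>R v') - ?q0\<bar> \<le> e" if "j < m" for j
        proof -
          have "real j * norm v' \<le> real m * norm v'" using that by (intro mult_right_mono) auto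
          then have j: "norm (real j *\<^sub>R v') \<le> \<delta>" using mv by simp
          then have "real j *\<^sub>R v' \<in> cball 0 3" using \<delta> by simp
          from H'[OF this] have "\<bar>diff_quot ?w v' (real j *\<^sub>R v') - ?q0\<bar>
              \<le> K * (A / 4 + M) * norm (real j *\<^sub>R v') powr \<gamma>" .
          also have "\<dots> \<le> e" unfolding e_def
            using j K A0 M by (intro mult_left_mono powr_mono2) auto
          finally show ?thesis .
        qed
        then have "\<bar>\<Sum>j<m. diff_quot ?w v' (real j *\<^sub>R v') - ?q0\<bar> \<le> (\<Sum>j<m. e)"
          by (intro order_trans[OF sum_abs] sum_mono) auto
        then have S: "\<bar>(\<Sum>j<m. diff_quot ?w v' (real j *\<^sub>R v')) - real m * ?q0\<bar> \<le> real m * e"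
          by (simp add: sum_subtractf)
        have tele: "(\<Sum>j<m. diff_quot ?w v' (real j *\<^sub>R v')) = (?w (real m *\<^sub>R v') - ?w 0) / norm v'"
          using diff_quot_telescope[OF v'(1), of ?w m] v' by simp
        have "\<bar>?w (real m *\<^sub>R v') - ?w 0\<bar> \<le> 2 * M"
          using M(2)[rule_format, of "x + \<rho> *\<^sub>R (real m *\<^sub>R v')"] M(2)[rule_format, of "x + \<rho> *\<^sub>R 0"]
          by linarith
        then have "\<bar>\<Sum>j<m. diff_quot ?w v' (real j *\<^sub>R v')\<bar> \<le> 2 * M / norm v'"
          unfolding tele by (simp add: divide_right_mono)
        moreover have "\<bar>real m * ?q0\<bar> = real m * \<bar>?q0\<bar>" by (simp add: abs_mult)
        ultimately have "real m * \<bar>?q0\<bar> \<le> 2 * M / norm v' + real m * e" using S by linarith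
        also have "2 * M / norm v' \<le> real m * (4 * M / \<delta>)"
        proof -
          have "2 * M * (\<delta> / 2) \<le> 2 * M * (real m * norm v')" using mv(2) M by (intro mult_left_mono) auto
          then show ?thesis using v' \<delta> by (simp add: field_simps)
        qed
        finally have "real m * \<bar>?q0\<bar> \<le> real m * (4 * M / \<delta> + e)" by (simp add: distrib_left)
        then have q0: "\<bar>?q0\<bar> \<le> 4 * M / \<delta> + e" using m(1) by simp
        have "e = (K * \<delta> powr \<gamma>) * (A / 4 + M)" by (simp add: e_def)
        also have "\<dots> \<le> 1 / 4 * (A / 4 + M)" using \<delta>K A0 M by (intro mult_right_mono) auto
        finally have e: "e \<le> A / 16 + M / 4" by simp
        \<comment> \<open>Undoing the scale \<open>d / 8\<close> turns \<open>A / 16\<close> into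
          \<open>A / 2\<close>, and \<open>32 / \<delta> + 2\<close> is
          \<open>8 * (4 / \<delta> + 1 / 4)\<close>.\<close>
        have "?g x = 8 * \<bar>?q0\<bar>" unfolding dq using d by (simp add: \<rho>_def d_def abs_mult)
        also have "\<dots> \<le> 8 * (4 * M / \<delta> + (A / 16 + M / 4))"
          by (rule mult_left_mono) (use q0 e in linarith)+
        also have "\<dots> = A / 2 + (32 / \<delta> + 2) * M" by (simp add: algebra_simps)
        finally show ?thesis .
      qed
    qed
    have "A \<le> A / 2 + (32 / \<delta> + 2) * M"
      unfolding A_def by (rule cSUP_least) (use step in \<open>auto simp: A_def\<close>)
    then have "A \<le> 2 * ((32 / \<delta> + 2) * M)" by simp
    then show ?thesis using gA[OF x0] by (simp only: mult.assoc order_trans)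
  qed
  moreover have "0 < 2 * (32 / \<delta> + 2)" using \<delta> by (simp add: add_pos_pos)
  ultimately show ?thesis by blast
qed


text \<open>The interior bound controls the quotients on radius \<open>1 / 2\<close>. After scaling
  by \<open>1 / 16\<close>, a ball of radius \<open>3\<close> fits into that region around every
  centre in the ball of radius \<open>1 / 16\<close>, so \<open>diff_quot_holder\<close> applies at
  each of them.\<close>

lemma diff_quot_unit_ball:
  assumes \<alpha>: "0 < \<alpha>" "\<alpha> < 2"
  shows "\<exists>C \<gamma>. 0 < C \<and> 0 < \<gamma> \<and> (\<forall>(w::'a::euclidean_space \<Rightarrow> real) v M. tame w \<longrightarrow> 0 < M \<longrightarrow>
     (\<forall>x. \<bar>w x\<bar> \<le> M) \<longrightarrow> v \<noteq> 0 \<longrightarrow> norm v \<le> 1 / 16 \<longrightarrow>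
     (\<forall>x\<in>ball 0 1. jump_op (riesz \<alpha>) w x = 0) \<longrightarrow>
     (\<forall>x\<in>ball 0 (1 / 16). \<forall>y\<in>ball 0 (1 / 16). \<bar>diff_quot w v x\<bar> \<le> C * M \<and>
        \<bar>diff_quot w v y - diff_quot w v x\<bar> \<le> C * M * norm (y - x) powr \<gamma>))"
proof -
  obtain K \<gamma> where K: "0 < K" "0 < \<gamma>" and H: "\<forall>(w::'a \<Rightarrow> real) v M A. tame w \<longrightarrow> 0 < M \<longrightarrow>
     (\<forall>x. \<bar>w x\<bar> \<le> M) \<longrightarrow> v \<noteq> 0 \<longrightarrow> norm v \<le> 1 \<longrightarrow>
     (\<forall>x\<in>cball 0 3. jump_op (riesz \<alpha>) w x = 0) \<longrightarrow> (\<forall>x\<in>cball 0 3. \<bar>diff_quot w v x\<bar> \<le> A) \<longrightarrow>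
     (\<forall>y\<in>cball 0 3. \<bar>diff_quot w v y - diff_quot w v 0\<bar> \<le> K * (A + M) * norm y powr \<gamma>)"
    using diff_quot_holder[OF \<alpha>, where 'a='a] by blast
  obtain L where L: "0 < L" "\<forall>(w::'a \<Rightarrow> real) v M. tame w \<longrightarrow> 0 < M \<longrightarrow>
     (\<forall>x. \<bar>w x\<bar> \<le> M) \<longrightarrow> v \<noteq> 0 \<longrightarrow> (\<forall>x\<in>ball 0 1. jump_op (riesz \<alpha>) w x = 0) \<longrightarrow>
     (\<forall>x\<in>ball 0 1. (1 - norm x) * \<bar>diff_quot w v x\<bar> \<le> L * M)"
    using diff_quot_interior_bound[OF \<alpha>, where 'a='a] by blast
  define D where "D = 16 * K * (L + 1) * 16 powr \<gamma>"
  have D: "0 < D" using K L by (simp add: D_def)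
  have "\<bar>diff_quot w v x\<bar> \<le> (2 * L + D) * M \<and>
        \<bar>diff_quot w v y - diff_quot w v x\<bar> \<le> (2 * L + D) * M * norm (y - x) powr \<gamma>"
    if w: "tame w" and M: "0 < M" "\<forall>x. \<bar>w x\<bar> \<le> M" and v: "v \<noteq> 0" "norm v \<le> 1 / 16"
      and 0: "\<forall>x\<in>ball 0 1. jump_op (riesz \<alpha>) w x = 0"
      and x: "x \<in> ball 0 (1 / 16)" and y: "y \<in> ball 0 (1 / 16)"
    for w :: "'a \<Rightarrow> real" and v M x y
  proof -
    have b: "\<bar>diff_quot w v z\<bar> \<le> 2 * L * M" if "norm z \<le> 1 / 2" for z
    proof -
      have "(1 - norm z) * \<bar>diff_quot w v z\<bar> \<le> L * M" using L(2) w M v 0 that by simp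
      moreover have "1 / 2 * \<bar>diff_quot w v z\<bar> \<le> (1 - norm z) * \<bar>diff_quot w v z\<bar>"
        using that by (intro mult_right_mono) auto
      ultimately show ?thesis by linarith
    qed
    let ?w = "\<lambda>s. w (x + (1 / 16) *\<^sub>R s)"
    let ?v = "(1 / (1 / 16)) *\<^sub>R v"
    have dq: "diff_quot ?w ?v s = 1 / 16 * diff_quot w v (x + (1 / 16) *\<^sub>R s)" for s
      by (rule diff_quot_affine) simp
    have near: "norm (x + (1 / 16) *\<^sub>R s) < 1 / 2" if "s \<in> cball 0 3" for s
      using that x norm_triangle_ineq[of x "(1 / 16) *\<^sub>R s"] by simp
    let ?s = "16 *\<^sub>R (y - x)"
    have s: "?s \<in> cball 0 3" using x y norm_triangle_ineq4[of y x] by simp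
    have "\<bar>diff_quot ?w ?v ?s - diff_quot ?w ?v 0\<bar> \<le> K * (L * M + M) * norm ?s powr \<gamma>"
    proof (rule H[rule_format])
      show "tame ?w" by (rule tame_affine[OF w])
      show "\<bar>w (x + (1 / 16) *\<^sub>R s)\<bar> \<le> M" for s using M by blast
      show "jump_op (riesz \<alpha>) ?w s = 0" if "s \<in> cball 0 3" for s
        using jump_op_affine[OF w, of "1 / 16" \<alpha> x s] 0 near[OF that] by simp
      show "\<bar>diff_quot ?w ?v s\<bar> \<le> L * M" if "s \<in> cball 0 3" for s
        unfolding dq using b[OF less_imp_le[OF near[OF that]]] L(1) M(1) by (simp add: abs_mult)
    qed (use M v s in auto)
    then have "\<bar>diff_quot w v y - diff_quot w v x\<bar> \<le> 16 * (K * (L * M + M) * norm ?s powr \<gamma>)"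
      unfolding dq by simp
    also have "norm ?s powr \<gamma> = 16 powr \<gamma> * norm (y - x) powr \<gamma>"
      by (simp add: powr_mult)
    also have "16 * (K * (L * M + M) * (16 powr \<gamma> * norm (y - x) powr \<gamma>)) = D * M * norm (y - x) powr \<gamma>"
      by (simp add: D_def algebra_simps)
    also have "\<dots> \<le> (2 * L + D) * M * norm (y - x) powr \<gamma>"
      using L M by (intro mult_right_mono) auto
    finally have "\<bar>diff_quot w v y - diff_quot w v x\<bar> \<le> (2 * L + D) * M * norm (y - x) powr \<gamma>" .
    moreover have "2 * L * M \<le> (2 * L + D) * M" using D M by (intro mult_right_mono) auto
    then have "\<bar>diff_quot w v x\<bar> \<le> (2 * L + D) * M" using b[of x] x by simp
    ultimately show ?thesis by blast
  qed
  moreover have "0 < 2 * L + D" using L D by simp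
  ultimately show ?thesis using K(2) by blast
qed

text \<open>For a fixed increment the quotients of the approximants converge to those of
  \<open>u\<close>, and their bounds do not depend on the approximant.\<close>

lemma weakly_harmonic_diff_quot:
  fixes u :: "'a::euclidean_space \<Rightarrow> real"
  assumes \<alpha>: "0 < \<alpha>" "\<alpha> < 2" and G: "open G" "x0 \<in> G"
    and u: "weakly_harmonic \<alpha> G u" "\<And>x. \<bar>u x\<bar> \<le> B"
  shows "\<exists>r>0. \<exists>C>0. \<exists>\<gamma>>0. \<forall>x\<in>ball x0 r. \<forall>y\<in>ball x0 r. \<forall>v. v \<noteq> 0 \<longrightarrow> norm v < r \<longrightarrow>
     \<bar>diff_quot u v x\<bar> \<le> C \<and> \<bar>diff_quot u v y - diff_quot u v x\<bar> \<le> C * norm (y - x) powr \<gamma>"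
proof -
  obtain C \<gamma> where C: "0 < C" "0 < \<gamma>" and H: "\<forall>(w::'a \<Rightarrow> real) v M. tame w \<longrightarrow> 0 < M \<longrightarrow>
     (\<forall>x. \<bar>w x\<bar> \<le> M) \<longrightarrow> v \<noteq> 0 \<longrightarrow> norm v \<le> 1 / 16 \<longrightarrow>
     (\<forall>x\<in>ball 0 1. jump_op (riesz \<alpha>) w x = 0) \<longrightarrow>
     (\<forall>x\<in>ball 0 (1 / 16). \<forall>y\<in>ball 0 (1 / 16). \<bar>diff_quot w v x\<bar> \<le> C * M \<and>
        \<bar>diff_quot w v y - diff_quot w v x\<bar> \<le> C * M * norm (y - x) powr \<gamma>)"
    using diff_quot_unit_ball[OF \<alpha>, where 'a='a] by blast
  obtain R0 where R0: "0 < R0" "cball x0 R0 \<subseteq> G" using G open_contains_cball by blast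
  define R where "R = R0 / 2"
  have R: "0 < R" "R0 = 2 * R" using R0 by (simp_all add: R_def)
  define M where "M = \<bar>B\<bar> + R"
  have M: "0 < M" using R by (simp add: M_def)
  define D where "D = C * M / R * (1 + (1 / R) powr \<gamma>)"
  have D: "0 < D" using C M R by (simp add: D_def add_pos_pos)
  have "\<bar>diff_quot u v x\<bar> \<le> D \<and> \<bar>diff_quot u v y - diff_quot u v x\<bar> \<le> D * norm (y - x) powr \<gamma>"
    if x: "x \<in> ball x0 (R / 16)" and y: "y \<in> ball x0 (R / 16)" and v: "v \<noteq> 0" "norm v < R / 16" for x y v
  proof -
    have approx: "\<exists>w. \<bar>diff_quot w v x - diff_quot u v x\<bar> \<le> e \<and> \<bar>diff_quot w v y - diff_quot u v y\<bar> \<le> e \<and>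
        \<bar>diff_quot w v x\<bar> \<le> D \<and> \<bar>diff_quot w v y - diff_quot w v x\<bar> \<le> D * norm (y - x) powr \<gamma>"
      if e: "0 < e" for e
    proof -
      \<comment> \<open>The error may depend on \<open>norm v\<close> because the constant
        \<open>D\<close> does not.\<close>
      define \<delta> where "\<delta> = min R (e * norm v / 2)"
      have \<delta>: "0 < \<delta>" "\<delta> \<le> R" "2 * \<delta> \<le> e * norm v" using e v R by (auto simp: \<delta>_def)
      obtain w where w: "tame w" "\<And>x. \<bar>w x - u x\<bar> \<le> \<delta>"
        "\<And>x. cball x \<delta> \<subseteq> G \<Longrightarrow> jump_op (riesz \<alpha>) w x = 0"
        using u(1) \<delta>(1) unfolding weakly_harmonic_def by blast
      have close: "\<bar>diff_quot w v z - diff_quot u v z\<bar> \<le> e" for z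
      proof -
        have "\<bar>(w (z + v) - w z) - (u (z + v) - u z)\<bar> \<le> e * norm v"
          using w(2)[of z] w(2)[of "z + v"] \<delta>(3) by linarith
        moreover have "diff_quot w v z - diff_quot u v z = ((w (z + v) - w z) - (u (z + v) - u z)) / norm v"
          by (simp add: diff_quot_def diff_divide_distrib)
        ultimately have "\<bar>diff_quot w v z - diff_quot u v z\<bar> \<le> e * norm v / norm v"
          by (simp only: abs_divide abs_norm_cancel divide_right_mono norm_ge_zero)
        then show ?thesis using v by simp
      qed
      let ?w = "\<lambda>s. w (x0 + R *\<^sub>R s)"
      let ?v = "(1 / R) *\<^sub>R v"
      have dq: "diff_quot ?w ?v s = R * diff_quot w v (x0 + R *\<^sub>R s)" for s
        by (rule diff_quot_affine[OF R(1)])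
      define X where "X = (1 / R) *\<^sub>R (x - x0)"
      define Y where "Y = (1 / R) *\<^sub>R (y - x0)"
      have XY: "X \<in> ball 0 (1 / 16)" "Y \<in> ball 0 (1 / 16)" "x0 + R *\<^sub>R X = x" "x0 + R *\<^sub>R Y = y"
      proof -
        have "norm X = norm (x - x0) / R" "norm Y = norm (y - x0) / R"
          using R by (simp_all add: X_def Y_def)
        moreover have "norm (x - x0) < R / 16" "norm (y - x0) < R / 16"
          using x y by (simp_all add: dist_norm norm_minus_commute)
        then have "norm (x - x0) / R < R / 16 / R" "norm (y - x0) / R < R / 16 / R"
          using R(1) by (simp_all only: divide_strict_right_mono)
        ultimately show "X \<in> ball 0 (1 / 16)" "Y \<in> ball 0 (1 / 16)"
          using R(1) by simp_all
        show "x0 + R *\<^sub>R X = x" "x0 + R *\<^sub>R Y = y" using R by (simp_all add: X_def Y_def)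
      qed
      have YX: "Y - X = (1 / R) *\<^sub>R (y - x)" by (simp add: X_def Y_def algebra_simps)
      have "\<bar>diff_quot ?w ?v X\<bar> \<le> C * M \<and>
        \<bar>diff_quot ?w ?v Y - diff_quot ?w ?v X\<bar> \<le> C * M * norm (Y - X) powr \<gamma>"
      proof (rule H[rule_format])
        show "tame ?w" by (rule tame_affine[OF w(1)])
        show "\<bar>w (x0 + R *\<^sub>R s)\<bar> \<le> M" for s
          using w(2)[of "x0 + R *\<^sub>R s"] u(2)[of "x0 + R *\<^sub>R s"] \<delta>(2) by (simp add: M_def)
        show "jump_op (riesz \<alpha>) ?w s = 0" if s: "s \<in> ball 0 1" for s
        proof -
          have "cball (x0 + R *\<^sub>R s) \<delta> \<subseteq> cball x0 R0"
          proof
            fix z assume z: "z \<in> cball (x0 + R *\<^sub>R s) \<delta>"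
            have "dist x0 (x0 + R *\<^sub>R s) \<le> R" using s R by (simp add: dist_norm)
            then show "z \<in> cball x0 R0"
              using z \<delta>(2) R(2) dist_triangle[of x0 z "x0 + R *\<^sub>R s"] by simp
          qed
          then have "cball (x0 + R *\<^sub>R s) \<delta> \<subseteq> G" using R0(2) by blast
          then show ?thesis using jump_op_affine[OF w(1) R(1), of \<alpha> x0 s] w(3) by simp
        qed
      qed (use M v R XY in \<open>auto simp: field_simps\<close>)
      then have 1: "R * \<bar>diff_quot w v x\<bar> \<le> C * M"
        "R * \<bar>diff_quot w v y - diff_quot w v x\<bar> \<le> C * M * norm (Y - X) powr \<gamma>"
        unfolding dq XY(3,4) using R(1) by (simp_all add: abs_mult flip: right_diff_distrib)
      have "norm (Y - X) powr \<gamma> = (1 / R) powr \<gamma> * norm (y - x) powr \<gamma>"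
        unfolding YX using R by (simp add: powr_mult[symmetric])
      then have "\<bar>diff_quot w v x\<bar> \<le> C * M / R"
        "\<bar>diff_quot w v y - diff_quot w v x\<bar> \<le> C * M / R * (1 / R) powr \<gamma> * norm (y - x) powr \<gamma>"
        using 1 R(1) by (simp_all add: field_simps)
      moreover have "C * M / R \<le> D" "C * M / R * (1 / R) powr \<gamma> \<le> D"
        using C M R by (simp_all add: D_def distrib_left)
      ultimately have "\<bar>diff_quot w v x\<bar> \<le> D"
        "\<bar>diff_quot w v y - diff_quot w v x\<bar> \<le> D * norm (y - x) powr \<gamma>"
        by (linarith, meson mult_right_mono order_trans powr_ge_zero)
      then show ?thesis using close by blast
    qed
    show ?thesis
    proof
      show "\<bar>diff_quot u v x\<bar> \<le> D"
      proof (rule field_le_epsilon)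
        fix e :: real assume "0 < e"
        from approx[OF this] show "\<bar>diff_quot u v x\<bar> \<le> D + e" by fastforce
      qed
      show "\<bar>diff_quot u v y - diff_quot u v x\<bar> \<le> D * norm (y - x) powr \<gamma>"
      proof (rule field_le_epsilon)
        fix e :: real assume "0 < e"
        then have "0 < e / 2" by simp
        from approx[OF this] obtain w where "\<bar>diff_quot w v x - diff_quot u v x\<bar> \<le> e / 2"
          "\<bar>diff_quot w v y - diff_quot u v y\<bar> \<le> e / 2"
          "\<bar>diff_quot w v y - diff_quot w v x\<bar> \<le> D * norm (y - x) powr \<gamma>" by blast
        then show "\<bar>diff_quot u v y - diff_quot u v x\<bar> \<le> D * norm (y - x) powr \<gamma> + e" by linarith
      qed
    qed
  qed
  moreover have "0 < R / 16" using R by simp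
  ultimately show ?thesis using D C(2) by blast
qed

subsection \<open>From difference quotients to derivatives\<close>

text \<open>The defect of homogeneity along \<open>v\<close> is additive in the scalar and vanishes
  at integers; it is thus determined by fractional parts and bounded, and a bounded additive
  function is \<open>0\<close>.\<close>

lemma additive_bounded_linear:
  fixes l :: "'a::real_normed_vector \<Rightarrow> real"
  assumes add: "\<And>x y. l (x + y) = l x + l y" and bound: "\<And>x. \<bar>l x\<bar> \<le> C * norm x"
  shows "bounded_linear l"
proof
  show "l (x + y) = l x + l y" for x y by (rule add)
  show "\<exists>K. \<forall>x. norm (l x) \<le> norm x * K" using bound by (auto simp: mult.commute)
  fix c :: real and v :: 'a
  define g where "g = (\<lambda>c::real. l (c *\<^sub>R v) - c * l v)"
  have gadd: "g (a + b) = g a + g b" for a b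
    by (simp add: g_def add scaleR_add_left algebra_simps)
  have g1: "g 1 = 0" and g0: "g 0 = 0" using gadd[of 0 0] by (auto simp: g_def)
  have gnat: "g (real n * a) = real n * g a" for n a
    by (induction n) (simp_all add: g0 gadd distrib_right)
  have gint: "g (of_int k) = 0" for k
  proof -
    have "g (- a) = - g a" for a using gadd[of a "- a"] g0 by simp
    then show ?thesis
      using gnat[of "nat k" 1] gnat[of "nat (- k)" 1] g1 by (cases "k \<ge> 0") auto
  qed
  define B where "B = 2 * \<bar>C\<bar> * norm v"
  have gB: "\<bar>g a\<bar> \<le> B" for a
  proof -
    have s: "0 \<le> frac a" "frac a \<le> 1" by (auto simp: frac_ge_0 less_imp_le[OF frac_lt_1])
    have "g a = g (frac a)" using gadd[of "frac a" "of_int \<lfloor>a\<rfloor>"] gint by (simp add: frac_def)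
    moreover have "\<bar>l (frac a *\<^sub>R v)\<bar> \<le> \<bar>C\<bar> * norm v"
    proof -
      have "\<bar>l (frac a *\<^sub>R v)\<bar> \<le> C * norm (frac a *\<^sub>R v)" by (rule bound)
      also have "\<dots> \<le> \<bar>C\<bar> * norm v"
        using s by (intro mult_mono) (auto intro: mult_left_le_one_le)
      finally show ?thesis .
    qed
    moreover have "\<bar>frac a * l v\<bar> \<le> \<bar>C\<bar> * norm v"
    proof -
      have "\<bar>frac a * l v\<bar> \<le> 1 * \<bar>l v\<bar>" unfolding abs_mult using s by (intro mult_right_mono) auto
      also have "\<dots> \<le> \<bar>C\<bar> * norm v" using bound[of v] by (simp add: order_trans[OF _ mult_right_mono])
      finally show ?thesis .
    qed
    ultimately show ?thesis by (simp add: g_def B_def)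
  qed
  have "g c = 0"
  proof (rule ccontr)
    assume "g c \<noteq> 0"
    then obtain n where "B < real n * \<bar>g c\<bar>" using reals_Archimedean3[of "\<bar>g c\<bar>"] by auto
    then show False using gB[of "real n * c"] by (simp add: gnat abs_mult)
  qed
  then show "l (c *\<^sub>R v) = c *\<^sub>R l v" by (simp add: g_def)
qed

lemma real_linear_inner_representation:
  fixes l :: "'a::euclidean_space \<Rightarrow> real"
  assumes "bounded_linear l"
  shows "l h = (\<Sum>i\<in>Basis. l i *\<^sub>R i) \<bullet> h"
proof -
  interpret bounded_linear l by fact
  have "l h = l (\<Sum>i\<in>Basis. (h \<bullet> i) *\<^sub>R i)" by (simp add: euclidean_representation)
  also have "\<dots> = (\<Sum>i\<in>Basis. (h \<bullet> i) * l i)" by (simp add: sum scaleR)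
  also have "\<dots> = (\<Sum>i\<in>Basis. l i *\<^sub>R i) \<bullet> h"
    by (simp add: inner_sum_left inner_commute[of h] mult.commute)
  finally show ?thesis .
qed

lemma powr_tendsto_zero:
  fixes g :: "'b \<Rightarrow> real"
  assumes "(g \<longlongrightarrow> 0) F" "\<And>x. 0 \<le> g x" "0 < \<gamma>"
  shows "((\<lambda>x. C * g x powr \<gamma>) \<longlongrightarrow> 0) F"
  by (intro tendsto_mult_right_zero tendsto_zero_powrI[OF assms(1) tendsto_const _ assms(3)])
    (simp add: assms(2))

text \<open>Halving the step changes a quotient little by the Hoelder hypothesis, so dyadic
  quotients converge; the limit is additive and bounded, hence linear, with an error of order
  \<open>norm v powr (1 + \<gamma>)\<close>. The dyadic limits stay in the conclusion so that
  gradients at different points can be compared.\<close>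

lemma differentiable_of_diff_quot:
  fixes f :: "'a::euclidean_space \<Rightarrow> real"
  assumes r: "0 < r" and C: "0 < C" and \<gamma>: "0 < \<gamma>" and x: "x \<in> ball x0 r"
    and dq: "\<And>x y v. x \<in> ball x0 r \<Longrightarrow> y \<in> ball x0 r \<Longrightarrow> v \<noteq> 0 \<Longrightarrow> norm v < r \<Longrightarrow>
      \<bar>diff_quot f v x\<bar> \<le> C \<and> \<bar>diff_quot f v y - diff_quot f v x\<bar> \<le> C * norm (y - x) powr \<gamma>"
  shows "\<exists>G. (f has_derivative (\<lambda>h. G \<bullet> h)) (at x) \<and>
    (\<forall>v. (\<lambda>n. 2 ^ n * (f (x + (1 / 2 ^ n) *\<^sub>R v) - f x)) \<longlonglongrightarrow> G \<bullet> v)"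
proof -
  define \<rho> where "\<rho> = r - dist x0 x"
  have \<rho>: "0 < \<rho>" "\<rho> \<le> r" using x by (simp_all add: \<rho>_def)
  have xin: "x + v \<in> ball x0 r" if "norm v < \<rho>" for v
    using that dist_triangle[of x0 "x + v" x] by (simp add: \<rho>_def dist_norm)
  have incr: "f (y + v) - f y = norm v * diff_quot f v y" for y v
    by (cases "v = 0") (simp_all add: diff_quot_def)
  \<comment> \<open>A step \<open>u\<close> is compared with \<open>m\<close> times the first of
    \<open>m\<close> equal substeps; telescoping reduces this to variations of one quotient.\<close>
  have mult: "\<bar>(f (x + u) - f x) - real m * (f (x + (1 / real m) *\<^sub>R u) - f x)\<bar>
      \<le> C * norm u * norm u powr \<gamma>" if m: "1 \<le> m" and u: "norm u < \<rho>" for m u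
  proof (cases "u = 0")
    case False
    define v where "v = (1 / real m) *\<^sub>R u"
    have v: "v \<noteq> 0" "norm v \<le> norm u" "real m *\<^sub>R v = u" "real m * norm v = norm u"
      using False m by (auto simp: v_def field_simps)
    have "f (x + u) - f x = norm v * (\<Sum>j<m. diff_quot (\<lambda>y. f (x + y)) v (real j *\<^sub>R v))"
      using diff_quot_telescope[OF v(1), of "\<lambda>y. f (x + y)" m] v(3) by simp
    moreover have "diff_quot (\<lambda>y. f (x + y)) v y = diff_quot f v (x + y)" for y
      by (simp add: diff_quot_def add.assoc)
    ultimately have "(f (x + u) - f x) - real m * (f (x + v) - f x)
        = norm v * (\<Sum>j<m. diff_quot f v (x + real j *\<^sub>R v) - diff_quot f v x)"
      by (simp add: incr sum_subtractf right_diff_distrib)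
    moreover have "\<bar>\<Sum>j<m. diff_quot f v (x + real j *\<^sub>R v) - diff_quot f v x\<bar>
        \<le> (\<Sum>j<m. C * norm u powr \<gamma>)"
    proof (rule order_trans[OF sum_abs], rule sum_mono)
      fix j assume "j \<in> {..<m}"
      then have "real j * norm v \<le> real m * norm v" by (intro mult_right_mono) auto
      then have j: "norm (real j *\<^sub>R v) \<le> norm u" using v(4) by simp
      then have "x + real j *\<^sub>R v \<in> ball x0 r" using u by (intro xin) linarith
      then have "\<bar>diff_quot f v (x + real j *\<^sub>R v) - diff_quot f v x\<bar> \<le> C * norm (real j *\<^sub>R v) powr \<gamma>"
        using dq[of x "x + real j *\<^sub>R v" v] x v u \<rho> by simp
      also have "\<dots> \<le> C * norm u powr \<gamma>"
        using j C \<gamma> by (intro mult_left_mono powr_mono2) auto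
      finally show "\<bar>diff_quot f v (x + real j *\<^sub>R v) - diff_quot f v x\<bar> \<le> C * norm u powr \<gamma>" .
    qed
    ultimately have "\<bar>(f (x + u) - f x) - real m * (f (x + v) - f x)\<bar>
        \<le> norm v * (real m * (C * norm u powr \<gamma>))"
      by (simp add: abs_mult mult_left_mono)
    also have "\<dots> = C * (real m * norm v) * norm u powr \<gamma>" by simp
    finally show ?thesis unfolding v(4) v_def[symmetric] .
  qed simp
  define q where "q = (\<lambda>n v. 2 ^ n * (f (x + (1 / 2 ^ n) *\<^sub>R v) - f x))"
  define e where "e = (\<lambda>n (v::'a). C * norm v * (norm v / 2 ^ n) powr \<gamma>)"
  have e0: "(\<lambda>n. e n v) \<longlonglongrightarrow> 0" for v :: 'a
  proof -
    have "(\<lambda>n. norm v / 2 ^ n) \<longlonglongrightarrow> 0"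
      using tendsto_mult[OF tendsto_const LIMSEQ_power_zero[of "1 / 2 :: real"], of "norm v"]
      by (simp add: power_divide)
    then show ?thesis unfolding e_def by (rule powr_tendsto_zero) (use \<gamma> in auto)
  qed
  have small: "\<forall>\<^sub>F n in sequentially. norm ((1 / 2 ^ n) *\<^sub>R v) < \<rho>" for v :: 'a
  proof -
    have "(\<lambda>n. norm v / 2 ^ n) \<longlonglongrightarrow> 0"
      using tendsto_mult[OF tendsto_const LIMSEQ_power_zero[of "1 / 2 :: real"], of "norm v"]
      by (simp add: power_divide)
    from order_tendstoD(2)[OF this \<rho>(1)] show ?thesis by simp
  qed
  have qq: "\<bar>q n v - q (n + k) v\<bar> \<le> e n v" if n: "norm ((1 / 2 ^ n) *\<^sub>R v) < \<rho>" for n k v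
  proof -
    let ?u = "(1 / 2 ^ n) *\<^sub>R v"
    have u: "norm ?u = norm v / 2 ^ n" by simp
    have "q n v - q (n + k) v
        = 2 ^ n * ((f (x + ?u) - f x) - 2 ^ k * (f (x + (1 / 2 ^ k) *\<^sub>R ?u) - f x))"
      by (simp add: q_def power_add algebra_simps)
    moreover have "\<bar>(f (x + ?u) - f x) - 2 ^ k * (f (x + (1 / 2 ^ k) *\<^sub>R ?u) - f x)\<bar>
        \<le> C * norm ?u * norm ?u powr \<gamma>"
      using mult[of "2 ^ k" ?u] n by simp
    ultimately have "\<bar>q n v - q (n + k) v\<bar> \<le> 2 ^ n * (C * norm ?u * norm ?u powr \<gamma>)"
      by (simp only: abs_mult power_abs abs_numeral mult_left_mono zero_le_power zero_le_numeral)
    also have "\<dots> = e n v" unfolding u e_def by simp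
    finally show ?thesis .
  qed
  have "Cauchy (\<lambda>n. q n v)" for v
  proof (rule metric_CauchyI)
    fix \<epsilon> :: real assume "0 < \<epsilon>"
    then have "\<forall>\<^sub>F n in sequentially. e n v < \<epsilon> / 2"
      using order_tendstoD(2)[OF e0, of "\<epsilon> / 2"] by simp
    with small[of v] have "\<forall>\<^sub>F n in sequentially. e n v < \<epsilon> / 2 \<and> norm ((1 / 2 ^ n) *\<^sub>R v) < \<rho>"
      by eventually_elim simp
    then obtain n where n: "e n v < \<epsilon> / 2" "norm ((1 / 2 ^ n) *\<^sub>R v) < \<rho>"
      unfolding eventually_sequentially by blast
    show "\<exists>M. \<forall>m\<ge>M. \<forall>k\<ge>M. dist (q m v) (q k v) < \<epsilon>"
    proof (intro exI[of _ n] allI impI)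
      fix m k assume "n \<le> m" "n \<le> k"
      then show "dist (q m v) (q k v) < \<epsilon>"
        using qq[OF n(2), of "m - n"] qq[OF n(2), of "k - n"] n(1) by (simp add: dist_real_def)
    qed
  qed
  then have conv: "convergent (\<lambda>n. q n v)" for v by (simp add: Cauchy_convergent_iff)
  define l where "l = (\<lambda>v. lim (\<lambda>n. q n v))"
  have l: "(\<lambda>n. q n v) \<longlonglongrightarrow> l v" for v
    using conv[of v] by (simp add: l_def convergent_LIMSEQ_iff)
  have qb: "\<bar>q n v\<bar> \<le> C * norm v" if n: "norm ((1 / 2 ^ n) *\<^sub>R v) < \<rho>" for n v
  proof (cases "v = 0")
    case False
    have "\<bar>diff_quot f ((1 / 2 ^ n) *\<^sub>R v) x\<bar> \<le> C"
      using dq[OF x x, of "(1 / 2 ^ n) *\<^sub>R v"] False n \<rho> by simp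
    then have "norm v * \<bar>diff_quot f ((1 / 2 ^ n) *\<^sub>R v) x\<bar> \<le> norm v * C"
      by (rule mult_left_mono) simp
    then show ?thesis by (simp add: q_def incr abs_mult mult.commute)
  qed (simp add: q_def)
  have bl: "bounded_linear l"
  proof (rule additive_bounded_linear)
    fix v v'
    have "(\<lambda>n. q n (v + v') - q n v - q n v') \<longlonglongrightarrow> l (v + v') - l v - l v'"
      by (intro tendsto_diff l)
    \<comment> \<open>The additivity defect is \<open>norm v\<close> times the variation of the
      quotient in direction \<open>v\<close> from \<open>x\<close> to a base point tending to
      \<open>x\<close>.\<close>
    moreover have "(\<lambda>n. q n (v + v') - q n v - q n v') \<longlonglongrightarrow> 0"
    proof (rule tendsto_0_le[where K=1])
      show "(\<lambda>n. C * norm v * (norm v' / 2 ^ n) powr \<gamma>) \<longlonglongrightarrow> 0"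
      proof (cases "v' = 0")
        case False
        have "(\<lambda>n. norm v / norm v' * e n v') \<longlonglongrightarrow> 0"
          using e0[of v'] by (rule tendsto_mult_right_zero)
        then show ?thesis using False by (simp add: e_def mult.assoc mult.left_commute)
      qed simp
      show "\<forall>\<^sub>F n in sequentially. norm (q n (v + v') - q n v - q n v')
          \<le> norm (C * norm v * (norm v' / 2 ^ n) powr \<gamma>) * 1"
        using small[of v] small[of v']
      proof eventually_elim
        fix n assume n: "norm ((1 / 2 ^ n) *\<^sub>R v) < \<rho>" "norm ((1 / 2 ^ n) *\<^sub>R v') < \<rho>"
        let ?v = "(1 / 2 ^ n) *\<^sub>R v" and ?v' = "(1 / 2 ^ n) *\<^sub>R v'"
        have "q n (v + v') - q n v - q n v' = 2 ^ n * ((f (x + ?v' + ?v) - f (x + ?v')) - (f (x + ?v) - f x))"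
          by (simp add: q_def algebra_simps)
        also have "\<dots> = norm v * (diff_quot f ?v (x + ?v') - diff_quot f ?v x)"
          unfolding incr by (simp add: right_diff_distrib)
        finally have eq: "norm (q n (v + v') - q n v - q n v')
            = norm v * \<bar>diff_quot f ?v (x + ?v') - diff_quot f ?v x\<bar>"
          by (simp add: abs_mult)
        also have "\<dots> \<le> norm v * (C * norm ?v' powr \<gamma>)"
        proof (cases "v = 0")
          case False
          then have "\<bar>diff_quot f ?v (x + ?v') - diff_quot f ?v x\<bar> \<le> C * norm ?v' powr \<gamma>"
            using dq[OF x xin[OF n(2)], of ?v] n \<rho> by simp
          then show ?thesis by (rule mult_left_mono) simp
        qed simp
        finally show "norm (q n (v + v') - q n v - q n v')
            \<le> norm (C * norm v * (norm v' / 2 ^ n) powr \<gamma>) * 1"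
          using C by (simp add: abs_mult mult.commute mult.left_commute)
      qed
    qed
    ultimately have "l (v + v') - l v - l v' = 0" by (rule LIMSEQ_unique)
    then show "l (v + v') = l v + l v'" by simp
  next
    fix v
    have "(\<lambda>n. \<bar>q n v\<bar>) \<longlonglongrightarrow> \<bar>l v\<bar>" by (intro tendsto_rabs l)
    then show "\<bar>l v\<bar> \<le> C * norm v"
      by (rule tendsto_upperbound) (use small[of v] in \<open>auto elim!: eventually_mono simp: qb\<close>)
  qed
  have lerr: "\<bar>f (x + v) - f x - l v\<bar> \<le> C * norm v * norm v powr \<gamma>" if "norm v < \<rho>" for v
  proof -
    have "(\<lambda>k. \<bar>q 0 v - q k v\<bar>) \<longlonglongrightarrow> \<bar>q 0 v - l v\<bar>" by (intro tendsto_intros l)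
    then have "\<bar>q 0 v - l v\<bar> \<le> e 0 v"
    proof (rule tendsto_upperbound)
      have "\<bar>q 0 v - q k v\<bar> \<le> e 0 v" for k using qq[of 0 v k] that by simp
      then show "\<forall>\<^sub>F k in sequentially. \<bar>q 0 v - q k v\<bar> \<le> e 0 v" by simp
    qed simp
    then show ?thesis by (simp add: q_def e_def)
  qed
  define G where "G = (\<Sum>i\<in>Basis. l i *\<^sub>R i)"
  have lG: "l = (\<lambda>h. G \<bullet> h)"
    unfolding G_def by (rule ext) (rule real_linear_inner_representation[OF bl])
  have "(f has_derivative l) (at x)"
    unfolding has_derivative_at
  proof (intro conjI bl)
    show "(\<lambda>h. norm (f (x + h) - f x - l h) / norm h) \<midarrow>0\<rightarrow> 0"
    proof (rule tendsto_0_le[where K=1])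
      have "((\<lambda>h::'a. norm h) \<longlongrightarrow> 0) (at 0)"
        using tendsto_norm[OF tendsto_ident_at[of "0::'a" UNIV]] by simp
      then show "((\<lambda>h::'a. C * norm h powr \<gamma>) \<longlongrightarrow> 0) (at 0)"
        by (rule powr_tendsto_zero) (use \<gamma> in auto)
      show "\<forall>\<^sub>F h in at 0. norm (norm (f (x + h) - f x - l h) / norm h) \<le> norm (C * norm h powr \<gamma>) * 1"
        unfolding eventually_at
      proof (intro exI[of _ \<rho>] conjI ballI impI \<rho>(1))
        fix h :: 'a assume h: "h \<noteq> 0 \<and> dist h 0 < \<rho>"
        then have "\<bar>f (x + h) - f x - l h\<bar> / norm h \<le> C * norm h * norm h powr \<gamma> / norm h"
          by (intro divide_right_mono lerr) auto
        then show "norm (norm (f (x + h) - f x - l h) / norm h) \<le> norm (C * norm h powr \<gamma>) * 1"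
          using h C by (simp add: abs_mult)
      qed
    qed
  qed
  then show ?thesis using l unfolding lG q_def by blast
qed

lemma continuously_differentiable_of_diff_quot:
  fixes f :: "'a::euclidean_space \<Rightarrow> real"
  assumes r: "0 < r" and C: "0 < C" and \<gamma>: "0 < \<gamma>"
    and dq: "\<And>x y v. x \<in> ball x0 r \<Longrightarrow> y \<in> ball x0 r \<Longrightarrow> v \<noteq> 0 \<Longrightarrow> norm v < r \<Longrightarrow>
      \<bar>diff_quot f v x\<bar> \<le> C \<and> \<bar>diff_quot f v y - diff_quot f v x\<bar> \<le> C * norm (y - x) powr \<gamma>"
  shows "\<exists>G. (\<forall>x\<in>ball x0 r. (f has_derivative (\<lambda>h. G x \<bullet> h)) (at x)) \<and> continuous_on (ball x0 r) G"
proof -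
  have "\<forall>x\<in>ball x0 r. \<exists>G. (f has_derivative (\<lambda>h. G \<bullet> h)) (at x) \<and>
    (\<forall>v. (\<lambda>n. 2 ^ n * (f (x + (1 / 2 ^ n) *\<^sub>R v) - f x)) \<longlonglongrightarrow> G \<bullet> v)"
    using differentiable_of_diff_quot[OF r C \<gamma> _ dq] by blast
  from bchoice[OF this] obtain G where "\<forall>x\<in>ball x0 r. (f has_derivative (\<lambda>h. G x \<bullet> h)) (at x) \<and>
    (\<forall>v. (\<lambda>n. 2 ^ n * (f (x + (1 / 2 ^ n) *\<^sub>R v) - f x)) \<longlonglongrightarrow> G x \<bullet> v)" ..
  then have G: "\<And>x. x \<in> ball x0 r \<Longrightarrow> (f has_derivative (\<lambda>h. G x \<bullet> h)) (at x)"
    "\<And>x v. x \<in> ball x0 r \<Longrightarrow> (\<lambda>n. 2 ^ n * (f (x + (1 / 2 ^ n) *\<^sub>R v) - f x)) \<longlonglongrightarrow> G x \<bullet> v"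
    by blast+
  have holder: "\<bar>G y \<bullet> i - G x \<bullet> i\<bar> \<le> C * dist y x powr \<gamma>"
    if xy: "x \<in> ball x0 r" "y \<in> ball x0 r" and i: "i \<in> Basis" for x y i
  proof -
    let ?q = "\<lambda>x n. 2 ^ n * (f (x + (1 / 2 ^ n) *\<^sub>R i) - f x)"
    have "(\<lambda>n. 1 / 2 ^ n) \<longlonglongrightarrow> (0::real)"
      using LIMSEQ_power_zero[of "1 / 2 :: real"] by (simp add: power_divide)
    from order_tendstoD(2)[OF this r] have ev: "\<forall>\<^sub>F n in sequentially. 1 / 2 ^ n < r" .
    have "(\<lambda>n. \<bar>?q y n - ?q x n\<bar>) \<longlonglongrightarrow> \<bar>G y \<bullet> i - G x \<bullet> i\<bar>"
      by (intro tendsto_intros G(2) xy)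
    then show ?thesis
    proof (rule tendsto_upperbound)
      show "\<forall>\<^sub>F n in sequentially. \<bar>?q y n - ?q x n\<bar> \<le> C * dist y x powr \<gamma>"
        using ev
      proof eventually_elim
        fix n assume n: "1 / 2 ^ n < r"
        let ?v = "(1 / 2 ^ n) *\<^sub>R i"
        have nv: "norm ?v = 1 / 2 ^ n" "?v \<noteq> 0" using i by (auto simp: nonzero_Basis)
        have "?q z n = diff_quot f ?v z" for z unfolding diff_quot_def nv(1) by simp
        then show "\<bar>?q y n - ?q x n\<bar> \<le> C * dist y x powr \<gamma>"
          using dq[OF xy nv(2)] n nv(1) by (simp add: dist_norm)
      qed
    qed simp
  qed
  have "continuous_on (ball x0 r) G"
    unfolding continuous_on_componentwise[of _ G]
  proof
    fix i :: 'a assume i: "i \<in> Basis"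
    show "continuous_on (ball x0 r) (\<lambda>x. G x \<bullet> i)"
      unfolding continuous_on_def
    proof
      fix x assume x: "x \<in> ball x0 r"
      have "((\<lambda>y. dist y x) \<longlongrightarrow> 0) (at x within ball x0 r)"
        using tendsto_dist[OF tendsto_ident_at[of x "ball x0 r"] tendsto_const[of x]] by simp
      then have 0: "((\<lambda>y. C * dist y x powr \<gamma>) \<longlongrightarrow> 0) (at x within ball x0 r)"
        by (rule powr_tendsto_zero) (use \<gamma> in auto)
      have "((\<lambda>y. G y \<bullet> i - G x \<bullet> i) \<longlongrightarrow> 0) (at x within ball x0 r)"
        by (rule tendsto_0_le[OF 0, where K=1])
          (use holder[OF x _ i] C in \<open>auto simp: eventually_at_filter\<close>)
      then show "((\<lambda>y. G y \<bullet> i) \<longlongrightarrow> G x \<bullet> i) (at x within ball x0 r)"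
        by (simp add: LIM_zero_iff)
    qed
  qed
  then show ?thesis using G(1) by blast
qed

subsection \<open>Mollification\<close>

text \<open>The powers in the denominator make the family closed under differentiation up to linear
  combinations, so all orders can be treated together.\<close>

definition flat_exp :: "nat \<Rightarrow> real \<Rightarrow> real" where
  "flat_exp n s = (if 0 < s then exp (- 1 / s) / s ^ n else 0)"

text \<open>The square makes the derivative at \<open>0\<close> vanish. It comes from
  \<open>(1 + x / m) ^ m \<le> exp x\<close> with \<open>x = 1 / s\<close> and
  \<open>m = n + 2\<close>, which leaves two spare powers of \<open>s\<close>.\<close>

lemma flat_exp_bound: "\<bar>flat_exp n s\<bar> \<le> real (n + 2) ^ (n + 2) * s\<^sup>2"
proof (cases "0 < s")
  case True
  let ?m = "n + 2"
  have "(1 + (1 / s) / real ?m) ^ ?m \<le> exp (1 / s)"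
    using True by (intro exp_ge_one_plus_x_over_n_power_n) (auto intro: order_trans[of _ 0])
  moreover have "(1 / (s * real ?m)) ^ ?m \<le> (1 + (1 / s) / real ?m) ^ ?m"
    using True by (intro power_mono) auto
  ultimately have "(1 / (s * real ?m)) ^ ?m \<le> exp (1 / s)" by linarith
  moreover define P where "P = (s * real ?m) ^ ?m"
  ultimately have "1 / P \<le> exp (1 / s)" by (simp only: power_one_over)
  moreover have "0 < P" unfolding P_def using True by (intro zero_less_power mult_pos_pos) auto
  ultimately have "exp (- 1 / s) \<le> P"
    by (simp add: exp_minus_inverse[symmetric] exp_minus field_simps)
  then have "exp (- 1 / s) \<le> (s * real ?m) ^ ?m" by (simp only: P_def)
  then have "exp (- 1 / s) / s ^ n \<le> (s * real ?m) ^ ?m / s ^ n"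
    using True by (intro divide_right_mono) auto
  also have "\<dots> = real ?m ^ ?m * s\<^sup>2"
    using True by (simp add: power_mult_distrib power_add power2_eq_square)
  finally show ?thesis using True by (simp add: flat_exp_def)
qed (simp add: flat_exp_def)

lemma flat_exp_derivative:
  "(flat_exp n has_real_derivative flat_exp (n + 2) s - real n * flat_exp (n + 1) s) (at s)"
proof -
  consider "0 < s" | "s < 0" | "s = 0" by linarith
  then show ?thesis
  proof cases
    case 1
    have "((\<lambda>s. exp (- 1 / s) / s ^ n) has_real_derivative
        flat_exp (n + 2) s - real n * flat_exp (n + 1) s) (at s)"
    proof (cases n)
      case 0
      then show ?thesis using 1
        by (auto intro!: derivative_eq_intros simp: flat_exp_def power2_eq_square field_simps)
    next
      case (Suc m)
      show ?thesis using 1 unfolding Suc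
        by (auto intro!: derivative_eq_intros simp: flat_exp_def power2_eq_square field_simps)
          (metis One_nat_def power_eq_if)
    qed
    then show ?thesis
      by (rule has_field_derivative_transform_within_open[of _ _ _ "{0<..}"])
        (use 1 in \<open>auto simp: flat_exp_def\<close>)
  next
    case 2
    have "((\<lambda>_. 0) has_real_derivative flat_exp (n + 2) s - real n * flat_exp (n + 1) s) (at s)"
      using 2 by (auto simp: flat_exp_def)
    then show ?thesis
      by (rule has_field_derivative_transform_within_open[of _ _ _ "{..<0}"])
        (use 2 in \<open>auto simp: flat_exp_def\<close>)
  next
    case 3
    let ?K = "real (n + 2) ^ (n + 2)"
    have "((\<lambda>h. flat_exp n h / h) \<longlongrightarrow> 0) (at 0)"
    proof (rule tendsto_0_le[where K = ?K])
      show "((\<lambda>h. h) \<longlongrightarrow> (0::real)) (at 0)" by (rule tendsto_ident_at)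
      have "norm (flat_exp n h / h) \<le> norm h * ?K" if "h \<noteq> 0" for h
      proof -
        have "\<bar>flat_exp n h\<bar> / \<bar>h\<bar> \<le> ?K * h\<^sup>2 / \<bar>h\<bar>"
          by (intro divide_right_mono flat_exp_bound) auto
        also have "?K * h\<^sup>2 / \<bar>h\<bar> = ?K * (h\<^sup>2 / \<bar>h\<bar>)" by simp
        also have "h\<^sup>2 / \<bar>h\<bar> = \<bar>h\<bar>" using that by (auto simp: power2_eq_square abs_if)
        finally show ?thesis by (simp add: mult.commute)
      qed
      then show "\<forall>\<^sub>F h in at 0. norm (flat_exp n h / h) \<le> norm h * ?K"
        by (simp add: eventually_at_filter)
    qed
    then show ?thesis using 3 by (simp add: DERIV_def flat_exp_def)
  qed
qed

text \<open>The partial derivatives of a bump function stay in this class.\<close>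

inductive bumplike :: "'a::euclidean_space \<Rightarrow> real \<Rightarrow> ('a \<Rightarrow> real) \<Rightarrow> bool" for c e where
  base: "bumplike c e (\<lambda>x. flat_exp n (e\<^sup>2 - (x - c) \<bullet> (x - c)))"
| add: "bumplike c e f \<Longrightarrow> bumplike c e g \<Longrightarrow> bumplike c e (\<lambda>x. f x + g x)"
| scale: "bumplike c e f \<Longrightarrow> bumplike c e (\<lambda>x. a * f x)"
| coord: "bumplike c e f \<Longrightarrow> bumplike c e (\<lambda>x. ((x - c) \<bullet> i) * f x)"

lemma bumplike_derivative:
  assumes "bumplike c e f"
  shows "\<exists>f'. (\<forall>x. (f has_derivative f' x) (at x)) \<and> (\<forall>i. bumplike c e (\<lambda>x. f' x i))"
  using assms
proof induction
  case (base n)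
  let ?q = "\<lambda>x. e\<^sup>2 - (x - c) \<bullet> (x - c)"
  let ?f' = "\<lambda>x h. - 2 * (((x - c) \<bullet> h) * (flat_exp (n + 2) (?q x) + (- real n) * flat_exp (n + 1) (?q x)))"
  have "((\<lambda>x. flat_exp n (?q x)) has_derivative ?f' x) (at x)" for x
  proof -
    have q: "(?q has_derivative (\<lambda>h. - 2 * ((x - c) \<bullet> h))) (at x)"
      by (auto intro!: derivative_eq_intros simp: inner_commute)
    have "(flat_exp n has_derivative (\<lambda>s. (flat_exp (n + 2) (?q x) - real n * flat_exp (n + 1) (?q x)) * s))
        (at (?q x))"
      using flat_exp_derivative[of n "?q x"] by (simp only: has_field_derivative_def)
    from has_derivative_compose[OF q this] show ?thesis by (simp add: algebra_simps)
  qed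
  moreover have "bumplike c e (\<lambda>x. ?f' x i)" for i
    by (intro bumplike.intros)
  ultimately show ?case by (intro exI[of _ ?f'] conjI allI)
next
  case (add f g)
  then obtain f' g' where "\<forall>x. (f has_derivative f' x) (at x)" "\<forall>i. bumplike c e (\<lambda>x. f' x i)"
    "\<forall>x. (g has_derivative g' x) (at x)" "\<forall>i. bumplike c e (\<lambda>x. g' x i)" by blast
  then show ?case
    by (intro exI[of _ "\<lambda>x h. f' x h + g' x h"]) (auto intro!: derivative_intros bumplike.intros)
next
  case (scale f a)
  then obtain f' where "\<forall>x. (f has_derivative f' x) (at x)" "\<forall>i. bumplike c e (\<lambda>x. f' x i)" by blast
  then show ?case
    by (intro exI[of _ "\<lambda>x h. a * f' x h"]) (auto intro!: derivative_intros bumplike.intros)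
next
  case (coord f j)
  then obtain f' where f': "\<forall>x. (f has_derivative f' x) (at x)" "\<forall>i. bumplike c e (\<lambda>x. f' x i)" by blast
  have "((\<lambda>x. ((x - c) \<bullet> j) * f x) has_derivative (\<lambda>h. ((x - c) \<bullet> j) * f' x h + (h \<bullet> j) * f x)) (at x)" for x
    by (auto intro!: derivative_eq_intros f'(1)[rule_format])
  moreover have "bumplike c e (\<lambda>x. ((x - c) \<bullet> j) * f' x i + (i \<bullet> j) * f x)" for i
    using f'(2) coord(1) by (intro bumplike.intros) auto
  ultimately show ?case
    by (intro exI[of _ "\<lambda>x h. ((x - c) \<bullet> j) * f' x h + (h \<bullet> j) * f x"]) blast
qed

lemma bumplike_continuous: "bumplike c e f \<Longrightarrow> continuous_on UNIV f"
  using bumplike_derivative[of c e f]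
  by (metis continuous_at_imp_continuous_on has_derivative_continuous)

lemma bumplike_Ck: "bumplike c e f \<Longrightarrow> Ck k f"
proof (induction k arbitrary: f)
  case 0
  then show ?case by (simp add: bumplike_continuous)
next
  case (Suc k)
  obtain f' where f': "\<forall>x. (f has_derivative f' x) (at x)" "\<forall>i. bumplike c e (\<lambda>x. f' x i)"
    using bumplike_derivative[OF Suc.prems] by blast
  then have "frechet_derivative f (at x) = f' x" for x
    using frechet_derivative_at by metis
  moreover have "f differentiable_on UNIV"
    using f'(1) by (auto simp: differentiable_on_def differentiable_def)
  ultimately show ?case using Suc.IH f'(2) by simp
qed

lemma bumplike_support:
  "bumplike c e f \<Longrightarrow> e < dist c x \<Longrightarrow> 0 \<le> e \<Longrightarrow> f x = 0"
proof (induction rule: bumplike.induct)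
  case (base n)
  then have "e\<^sup>2 \<le> (norm (x - c))\<^sup>2"
    by (intro power_mono) (auto simp: dist_norm norm_minus_commute)
  then show ?case by (simp add: flat_exp_def power2_norm_eq_inner)
qed auto

lemma bumplike_bounded:
  assumes "bumplike c e f" "0 \<le> e"
  obtains B where "0 \<le> B" "\<And>x. \<bar>f x\<bar> \<le> B"
proof -
  have "compact (f ` cball c e)"
    by (rule compact_continuous_image[OF continuous_on_subset[OF bumplike_continuous[OF assms(1)]]]) auto
  then obtain B where B: "\<And>x. x \<in> cball c e \<Longrightarrow> \<bar>f x\<bar> \<le> B"
    using compact_imp_bounded bounded_iff by (metis imageI real_norm_def)
  have "\<bar>f x\<bar> \<le> max B 0" for x
    using B[of x] bumplike_support[OF assms(1), of x] assms(2) by (cases "x \<in> cball c e") auto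
  then show ?thesis using that[of "max B 0"] by simp
qed

lemma basis_sum_bound:
  fixes h :: "'a::euclidean_space"
  assumes "\<And>i. \<bar>a i\<bar> \<le> b i"
  shows "\<bar>\<Sum>i\<in>Basis. a i * (i \<bullet> h)\<bar> \<le> (\<Sum>i\<in>Basis. b i) * norm h"
  unfolding sum_distrib_right
proof (rule order_trans[OF sum_abs], rule sum_mono)
  fix i :: 'a assume "i \<in> Basis"
  then have "\<bar>i \<bullet> h\<bar> \<le> norm h" using Basis_le_norm[of i h] by (simp add: inner_commute)
  then show "\<bar>a i * (i \<bullet> h)\<bar> \<le> b i * norm h"
    unfolding abs_mult using order_trans[OF abs_ge_zero assms] by (intro mult_mono assms) auto
qed

lemma bumplike_partials:
  fixes f :: "'a::euclidean_space \<Rightarrow> real"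
  assumes "bumplike c e f"
  obtains f' where "\<And>x. (f has_derivative f' x) (at x)" "\<And>i. bumplike c e (\<lambda>x. f' x i)"
    "\<And>x h. f' x h = (\<Sum>i\<in>Basis. f' x i * (i \<bullet> h))"
proof -
  obtain f' where f': "\<forall>x. (f has_derivative f' x) (at x)" "\<forall>i. bumplike c e (\<lambda>x. f' x i)"
    using bumplike_derivative[OF assms] by blast
  have "f' x h = (\<Sum>i\<in>Basis. f' x i * (i \<bullet> h))" for x h
  proof -
    have "f' x h = (\<Sum>i\<in>Basis. f' x i *\<^sub>R i) \<bullet> h"
      using f'(1) by (intro real_linear_inner_representation has_derivative_bounded_linear) blast
    then show ?thesis by (simp add: inner_sum_left)
  qed
  then show ?thesis using that f' by blast
qed

lemma bumplike_lipschitz: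
  fixes f :: "'a::euclidean_space \<Rightarrow> real"
  assumes f: "bumplike c e f" and e: "0 \<le> e"
  obtains L where "0 \<le> L" "\<And>x y. \<bar>f x - f y\<bar> \<le> L * norm (x - y)"
proof -
  obtain f' where f': "\<And>x. (f has_derivative f' x) (at x)" "\<And>i. bumplike c e (\<lambda>x. f' x i)"
    "\<And>x h. f' x h = (\<Sum>i\<in>Basis. f' x i * (i \<bullet> h))"
    using bumplike_partials[OF f] by blast
  have "\<exists>B. \<forall>x. \<bar>f' x i\<bar> \<le> B" for i
    using bumplike_bounded[OF f'(2) e] by metis
  then obtain B where B: "\<And>i x. \<bar>f' x i\<bar> \<le> B i" by metis
  define L where "L = (\<Sum>i\<in>Basis. B i)"
  have bound: "\<bar>f' x h\<bar> \<le> L * norm h" for x h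
    unfolding f'(3)[of x h] L_def by (rule basis_sum_bound[OF B])
  have "\<bar>f x - f y\<bar> \<le> L * norm (x - y)" for x y
    using differentiable_bound[of UNIV f f' L x y] f'(1) bound
    by (simp add: onorm_le has_derivative_at_withinI)
  moreover have "0 \<le> L" unfolding L_def using order_trans[OF abs_ge_zero B] by (intro sum_nonneg)
  ultimately show ?thesis using that by blast
qed

text \<open>The second difference is the increment from \<open>x - z\<close> to \<open>x\<close> of
  \<open>f (y + z) - f y\<close> as a function of \<open>y\<close>, whose derivative is of size
  \<open>L * norm z\<close> because the partial derivatives of \<open>f\<close> are
  Lipschitz.\<close>

lemma bumplike_tame:
  fixes f :: "'a::euclidean_space \<Rightarrow> real"
  assumes f: "bumplike c e f" and e: "0 \<le> e"
  shows "tame f"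
proof -
  obtain f' where f': "\<And>x. (f has_derivative f' x) (at x)" "\<And>i. bumplike c e (\<lambda>x. f' x i)"
    "\<And>x h. f' x h = (\<Sum>i\<in>Basis. f' x i * (i \<bullet> h))"
    using bumplike_partials[OF f] by blast
  have "\<exists>B. \<forall>x y. \<bar>f' x i - f' y i\<bar> \<le> B * norm (x - y)" for i
    using bumplike_lipschitz[OF f'(2) e] by metis
  then obtain B where B: "\<And>i x y. \<bar>f' x i - f' y i\<bar> \<le> B i * norm (x - y)" by metis
  define L where "L = (\<Sum>i\<in>Basis. B i)"
  have bound: "\<bar>f' x h - f' y h\<bar> \<le> L * norm (x - y) * norm h" for x y h
  proof -
    have "f' x h - f' y h = (\<Sum>i\<in>Basis. (f' x i - f' y i) * (i \<bullet> h))"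
      unfolding f'(3)[of x h] f'(3)[of y h] by (simp add: sum_subtractf left_diff_distrib)
    then show ?thesis
      using basis_sum_bound[of "\<lambda>i. f' x i - f' y i" "\<lambda>i. B i * norm (x - y)" h, OF B]
      by (simp add: L_def sum_distrib_right)
  qed
  have "\<bar>second_diff f x z\<bar> \<le> L * (norm z)\<^sup>2" for x z
  proof -
    let ?F = "\<lambda>y. f (y + z) - f y"
    have "((\<lambda>y. f (y + z)) has_derivative f' (y + z)) (at y)" for y
    proof -
      have "((\<lambda>y. y + z) has_derivative (\<lambda>h. h)) (at y)"
        by (auto intro!: derivative_eq_intros)
      from has_derivative_compose[OF this f'(1)] show ?thesis .
    qed
    then have "(?F has_derivative (\<lambda>h. f' (y + z) h - f' y h)) (at y)" for y
      using f'(1) by (intro derivative_intros) auto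
    moreover have "onorm (\<lambda>h. f' (y + z) h - f' y h) \<le> L * norm z" for y
      using bound[of "y + z" _ y] by (intro onorm_le) simp
    ultimately have "norm (?F x - ?F (x - z)) \<le> L * norm z * norm (x - (x - z))"
      by (intro differentiable_bound[of UNIV ?F "\<lambda>y h. f' (y + z) h - f' y h"])
        (auto simp: has_derivative_at_withinI)
    moreover have "second_diff f x z = ?F x - ?F (x - z)" by (simp add: second_diff_def)
    ultimately show ?thesis by (simp add: power2_eq_square mult.assoc)
  qed
  moreover obtain M where "\<And>x. \<bar>f x\<bar> \<le> M" using bumplike_bounded[OF f e] by blast
  then have "bounded (range f)" by (auto simp: bounded_iff)
  ultimately show ?thesis unfolding tame_def using bumplike_continuous[OF f] by blast
qed

section \<open>From the distributional equation to mollified solutions\<close>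

lemma bump_test_function:
  assumes e: "0 < e" and sub: "cball c e \<subseteq> \<Omega>"
  shows "test_function \<Omega> (\<lambda>x. a * flat_exp 0 (e\<^sup>2 - (x - c) \<bullet> (x - c)))" (is "test_function _ ?f")
proof -
  have f: "bumplike c e ?f" by (intro bumplike.intros)
  have "{x. ?f x \<noteq> 0} \<subseteq> cball c e"
    using bumplike_support[OF f] e by (force simp: not_le[symmetric])
  then have cl: "closure {x. ?f x \<noteq> 0} \<subseteq> cball c e" by (rule closure_minimal) simp
  then have "bounded (closure {x. ?f x \<noteq> 0})" using bounded_cball bounded_subset by blast
  then show ?thesis
    unfolding test_function_def using bumplike_Ck[OF f] cl sub by (auto simp: compact_eq_bounded_closed)
qed

text \<open>Away from the singularity the integral converges and can be averaged with its
  reflection, which creates the second difference and the factor \<open>- 1 / 2\<close>. The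
  truncation is then removed by dominated convergence.\<close>

lemma frac_laplacian_tame:
  fixes \<phi> :: "'a::euclidean_space \<Rightarrow> real"
  assumes \<alpha>: "0 < \<alpha>" "\<alpha> < 2" and \<phi>: "tame \<phi>"
  shows "frac_laplacian \<alpha> \<phi> x = - (frac_laplacian_const DIM('a) \<alpha> / 2) * jump_op (riesz \<alpha>) \<phi> x"
proof -
  have [measurable]: "\<phi> \<in> borel_measurable borel" by (rule tame_measurable[OF \<phi>])
  obtain M where M: "\<And>x. \<bar>\<phi> x\<bar> \<le> M" using tame_bounded[OF \<phi>] by blast
  let ?t = "\<lambda>\<epsilon>. LINT y:{y. norm (x - y) > \<epsilon>}|lborel.
      (\<phi> x - \<phi> y) / norm (x - y) powr (real DIM('a) + \<alpha>)"
  have t: "?t \<epsilon> = (LINT z|lborel. indicator {z. \<epsilon> < norm z} z * (second_diff \<phi> x z * riesz \<alpha> z)) * (- 1 / 2)"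
    if \<epsilon>: "0 < \<epsilon>" for \<epsilon>
  proof -
    let ?g = "\<lambda>z. indicator {z. \<epsilon> < norm z} z * ((\<phi> x - \<phi> (x + z)) * riesz \<alpha> z)"
    have [measurable]: "?g \<in> borel_measurable borel" by measurable
    have g: "integrable lborel ?g"
    proof (rule integrable_bound_measurable)
      show "integrable lborel (\<lambda>z::'a. 2 * M * (indicator {z. \<epsilon> \<le> norm z} z * riesz \<alpha> z))"
        using riesz_tail[OF \<alpha>(1) \<epsilon>, where 'a='a] by simp
      show "\<bar>?g z\<bar> \<le> 2 * M * (indicator {z. \<epsilon> \<le> norm z} z * riesz \<alpha> z)" for z
      proof -
        have "\<bar>\<phi> x - \<phi> (x + z)\<bar> \<le> 2 * M" using M[of x] M[of "x + z"] by linarith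
        then have "\<bar>\<phi> x - \<phi> (x + z)\<bar> * riesz \<alpha> z \<le> 2 * M * riesz \<alpha> z"
          by (rule mult_right_mono) simp
        then show ?thesis using order_trans[OF abs_ge_zero M[of x]] by (auto simp: indicator_def abs_mult)
      qed
    qed measurable
    have "?t \<epsilon> = (LINT y|lborel. ?g (- x + y))"
      unfolding set_lebesgue_integral_def
    proof (rule Bochner_Integration.integral_cong[OF refl])
      fix y
      have "norm (x - y) = norm (- x + y)" by (simp add: norm_minus_commute)
      moreover have "riesz \<alpha> (- x + y) = 1 / norm (- x + y) powr (real DIM('a) + \<alpha>)"
        by (simp only: riesz_def powr_minus_divide)
      ultimately show "indicat_real {y. norm (x - y) > \<epsilon>} y *\<^sub>R ((\<phi> x - \<phi> y) / norm (x - y) powr (real DIM('a) + \<alpha>))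
          = ?g (- x + y)"
        by (simp add: indicator_def)
    qed
    also have "\<dots> = (LINT z|lborel. ?g z)" by (rule lborel_integral_shift) measurable
    finally have 1: "?t \<epsilon> = (LINT z|lborel. ?g z)" .
    have "(LINT z|lborel. ?g z) + (LINT z|lborel. ?g (- z)) = (LINT z|lborel. ?g z + ?g (- z))"
      using g lborel_integrable_reflect[of ?g] by (intro Bochner_Integration.integral_add[symmetric]) auto
    also have "\<dots> = (LINT z|lborel. - (indicator {z. \<epsilon> < norm z} z * (second_diff \<phi> x z * riesz \<alpha> z)))"
      by (intro Bochner_Integration.integral_cong) (auto simp: indicator_def second_diff_def algebra_simps)
    finally show ?thesis unfolding 1 using lborel_integral_reflect[of ?g] by simp
  qed
  have lim: "((\<lambda>\<epsilon>. LINT z|lborel. indicator {z. \<epsilon> < norm z} z * (second_diff \<phi> x z * riesz \<alpha> z))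
      \<longlongrightarrow> jump_op (riesz \<alpha>) \<phi> x) (at_right 0)"
    unfolding tendsto_at_iff_sequentially
  proof (intro allI impI)
    fix X :: "nat \<Rightarrow> real" assume X: "\<forall>i. X i \<in> {0<..} - {0}" "X \<longlonglongrightarrow> 0"
    have "(\<lambda>n. LINT z|lborel. indicator {z. X n < norm z} z * (second_diff \<phi> x z * riesz \<alpha> z))
        \<longlonglongrightarrow> (LINT z|lborel. second_diff \<phi> x z * riesz \<alpha> z)"
    proof (rule integral_dominated_convergence[where w = "\<lambda>z. \<bar>second_diff \<phi> x z * riesz \<alpha> z\<bar>"])
      have [measurable]: "second_diff \<phi> x \<in> borel_measurable borel"
        by (rule second_diff_measurable) measurable
      show "(\<lambda>z. second_diff \<phi> x z * riesz \<alpha> z) \<in> borel_measurable lborel" by measurable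
      show "(\<lambda>z. indicator {z. X n < norm z} z * (second_diff \<phi> x z * riesz \<alpha> z)) \<in> borel_measurable lborel" for n
        by measurable
      show "integrable lborel (\<lambda>z. \<bar>second_diff \<phi> x z * riesz \<alpha> z\<bar>)"
        using jump_op_integrable[OF \<alpha> \<phi> below_riesz_self] by simp
      show "AE z in lborel. norm (indicator {z. X n < norm z} z * (second_diff \<phi> x z * riesz \<alpha> z))
          \<le> \<bar>second_diff \<phi> x z * riesz \<alpha> z\<bar>" for n
        by (intro AE_I2) (auto simp: indicator_def)
      show "AE z in lborel. (\<lambda>n. indicator {z. X n < norm z} z * (second_diff \<phi> x z * riesz \<alpha> z))
          \<longlonglongrightarrow> second_diff \<phi> x z * riesz \<alpha> z"
      proof (intro AE_I2)
        fix z :: 'a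
        show "(\<lambda>n. indicator {z. X n < norm z} z * (second_diff \<phi> x z * riesz \<alpha> z))
          \<longlonglongrightarrow> second_diff \<phi> x z * riesz \<alpha> z"
        proof (cases "z = 0")
          case False
          then have "\<forall>\<^sub>F n in sequentially. X n < norm z" using X(2) by (intro order_tendstoD) auto
          then have "\<forall>\<^sub>F n in sequentially. second_diff \<phi> x z * riesz \<alpha> z
              = indicator {z. X n < norm z} z * (second_diff \<phi> x z * riesz \<alpha> z)"
            by eventually_elim (auto simp: indicator_def)
          then show ?thesis by (rule Lim_transform_eventually[OF tendsto_const])
        qed (simp add: second_diff_def)
      qed
    qed
    then show "((\<lambda>\<epsilon>. LINT z|lborel. indicator {z. \<epsilon> < norm z} z * (second_diff \<phi> x z * riesz \<alpha> z)) \<circ> X)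
        \<longlonglongrightarrow> jump_op (riesz \<alpha>) \<phi> x"
      by (simp add: jump_op_def o_def)
  qed
  have "(?t \<longlongrightarrow> jump_op (riesz \<alpha>) \<phi> x * (- 1 / 2)) (at_right 0)"
  proof (rule Lim_transform_eventually[OF tendsto_mult_right[OF lim, of "- 1 / 2"]])
    show "\<forall>\<^sub>F \<epsilon> in at_right 0. (LINT z|lborel. indicator {z. \<epsilon> < norm z} z * (second_diff \<phi> x z * riesz \<alpha> z))
        * (- 1 / 2) = ?t \<epsilon>"
      using eventually_at_right_less[of "0::real"] by eventually_elim (simp only: t)
  qed
  then have "Lim (at_right 0) ?t = jump_op (riesz \<alpha>) \<phi> x * (- 1 / 2)"
    by (intro tendsto_Lim) (auto simp: trivial_limit_at_right_real)
  then show ?thesis unfolding frac_laplacian_def by simp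
qed


text \<open>The last property is stated for \<open>\<eta> (c - x)\<close>, the function against
  which the convolution at \<open>c\<close> integrates.\<close>

lemma bump_mollifier:
  assumes e: "0 < e"
  obtains \<eta> :: "'a::euclidean_space \<Rightarrow> real" where
    "bumplike 0 e \<eta>" "\<And>x. 0 \<le> \<eta> x" "integrable lborel \<eta>" "(LINT x|lborel. \<eta> x) = 1"
    "\<And>x. \<eta> (- x) = \<eta> x"
    "\<And>c \<Omega>. cball c e \<subseteq> \<Omega> \<Longrightarrow> test_function \<Omega> (\<lambda>x. \<eta> (c - x))"
proof -
  define f where "f = (\<lambda>x::'a. flat_exp 0 (e\<^sup>2 - x \<bullet> x))"
  have f: "bumplike 0 e f" using bumplike.base[of 0 e 0] by (simp add: f_def)
  have f0: "0 \<le> f x" for x by (simp add: f_def flat_exp_def)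
  obtain B where B: "\<And>x. \<bar>f x\<bar> \<le> B" using bumplike_bounded[OF f] e by (metis less_imp_le)
  have "integrable lborel (\<lambda>x. indicator (cball 0 e) x * f x)"
    by (rule bounded_indicator_integrable[OF _ bounded_cball continuous_borel[OF bumplike_continuous[OF f]] B])
      (simp add: borel_closed)
  moreover have "indicator (cball 0 e) x * f x = f x" for x
    using bumplike_support[OF f, of x] e by (auto simp: indicator_def)
  ultimately have int: "integrable lborel f" by simp
  define Z where "Z = (LINT x|lborel. f x)"
  have "Z \<noteq> 0"
  proof
    assume "Z = 0"
    then have "AE x in lborel. f x = 0"
      using int f0 by (simp add: Z_def integral_nonneg_eq_0_iff_AE)
    moreover have "f x \<noteq> 0" if "x \<in> ball 0 e" for x
    proof -
      have "(norm x)\<^sup>2 < e\<^sup>2" using that by (intro power_strict_mono) auto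
      then show ?thesis by (simp add: f_def flat_exp_def power2_norm_eq_inner)
    qed
    ultimately have "AE x in lborel. x \<notin> ball (0::'a) e" by (auto elim!: eventually_mono)
    then have "ball (0::'a) e \<in> null_sets lborel" by (subst AE_iff_null_sets) auto
    then have "emeasure lborel (ball (0::'a) e) = 0" by auto
    then show False using e unit_ball_vol_pos[of "real DIM('a)"]
      by (simp add: emeasure_ball del: unit_ball_vol_pos)
  qed
  moreover have "0 \<le> Z" unfolding Z_def using f0 by (intro integral_nonneg_AE AE_I2)
  ultimately have Z: "0 < Z" by simp
  show ?thesis
  proof (rule that[of "\<lambda>x. (1 / Z) * f x"])
    show "bumplike 0 e (\<lambda>x. (1 / Z) * f x)" by (intro bumplike.scale f)
    show "0 \<le> (1 / Z) * f x" for x using f0 Z by simp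
    show "integrable lborel (\<lambda>x. (1 / Z) * f x)" using int by simp
    show "(LINT x|lborel. (1 / Z) * f x) = 1" using Z by (simp add: Z_def[symmetric])
    show "(1 / Z) * f (- x) = (1 / Z) * f x" for x by (simp add: f_def)
    show "test_function \<Omega> (\<lambda>x. (1 / Z) * f (c - x))" if "cball c e \<subseteq> \<Omega>" for c \<Omega>
    proof -
      have "(c - x) \<bullet> (c - x) = (x - c) \<bullet> (x - c)" for x
        by (simp add: inner_diff_left inner_diff_right)
      then show ?thesis using bump_test_function[OF e that, of "1 / Z"] by (simp add: f_def)
    qed
  qed
qed

text \<open>All regularity comes from \<open>\<eta>\<close> under the integral. Fubini applies
  because the integrand is dominated by a multiple of \<open>\<bar>u y\<bar>\<close> times the
  integrable truncated kernel in \<open>z\<close>.\<close>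

lemma mollify_tame:
  fixes u \<eta> :: "'a::euclidean_space \<Rightarrow> real"
  assumes \<alpha>: "0 < \<alpha>" "\<alpha> < 2"
    and u: "u \<in> borel_measurable borel" "integrable lborel u"
    and \<eta>: "tame \<eta>" "\<And>x y. \<bar>\<eta> x - \<eta> y\<bar> \<le> L * norm (x - y)"
  defines "w \<equiv> \<lambda>x. LINT y|lborel. u y * \<eta> (x - y)"
  shows "tame w" and "jump_op (riesz \<alpha>) w x = (LINT y|lborel. u y * jump_op (riesz \<alpha>) \<eta> (x - y))"
proof -
  note [measurable] = u(1) tame_measurable[OF \<eta>(1)]
  obtain M where M: "\<And>x. \<bar>\<eta> x\<bar> \<le> M" using tame_bounded[OF \<eta>(1)] by blast
  obtain C where C: "0 \<le> C" "\<And>x z. \<bar>second_diff \<eta> x z\<bar> \<le> C * min 1 ((norm z)\<^sup>2)"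
    using tame_second_diff[OF \<eta>(1)] by blast
  have absu: "integrable lborel (\<lambda>y. \<bar>u y\<bar>)" using u(2) by simp
  define I where "I = (LINT y|lborel. \<bar>u y\<bar>)"
  have prod: "integrable lborel (\<lambda>y. u y * g y) \<and> \<bar>LINT y|lborel. u y * g y\<bar> \<le> B * I"
    if g: "g \<in> borel_measurable borel" "\<And>y. \<bar>g y\<bar> \<le> B" for g B
  proof -
    have b: "\<bar>u y * g y\<bar> \<le> B * \<bar>u y\<bar>" for y
      unfolding abs_mult using mult_right_mono[OF g(2)[of y], of "\<bar>u y\<bar>"] by (simp add: mult.commute)
    have i: "integrable lborel (\<lambda>y. u y * g y)"
      by (rule integrable_bound_measurable[OF _ _ b]) (use absu g(1) in auto)
    have "\<bar>LINT y|lborel. u y * g y\<bar> \<le> (LINT y|lborel. B * \<bar>u y\<bar>)"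
      using i absu b by (intro Bochner_Integration.integral_abs_bound_integral) auto
    then show ?thesis using i by (simp add: I_def)
  qed
  have ui: "integrable lborel (\<lambda>y. u y * \<eta> (x - y))" for x
    using prod[of "\<lambda>y. \<eta> (x - y)" M] M by simp
  have sd: "second_diff w x z = (LINT y|lborel. u y * second_diff \<eta> (x - y) z)" for x z
  proof -
    have "(LINT y|lborel. u y * second_diff \<eta> (x - y) z)
        = (LINT y|lborel. u y * \<eta> (x + z - y) + u y * \<eta> (x - z - y) - 2 * (u y * \<eta> (x - y)))"
      by (intro Bochner_Integration.integral_cong) (auto simp: second_diff_def algebra_simps)
    also have "\<dots> = second_diff w x z"
      using ui[of "x + z"] ui[of "x - z"] ui[of x] by (simp add: second_diff_def w_def)
    finally show ?thesis by simp
  qed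
  have lip: "\<bar>w x - w x'\<bar> \<le> L * I * dist x x'" for x x'
  proof -
    have "w x - w x' = (LINT y|lborel. u y * (\<eta> (x - y) - \<eta> (x' - y)))"
      unfolding w_def right_diff_distrib using ui by simp
    also have "\<bar>\<dots>\<bar> \<le> (L * norm (x - x')) * I"
    proof -
      have "\<bar>\<eta> (x - y) - \<eta> (x' - y)\<bar> \<le> L * norm (x - x')" for y
        using \<eta>(2)[of "x - y" "x' - y"] by simp
      then show ?thesis
        using prod[of "\<lambda>y. \<eta> (x - y) - \<eta> (x' - y)" "L * norm (x - x')"] by simp
    qed
    finally show ?thesis by (simp add: dist_norm mult.commute mult.left_commute)
  qed
  have "\<bar>L * I\<bar>-lipschitz_on UNIV w"
  proof (rule lipschitz_onI)
    fix x y :: 'a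
    have "L * I * dist x y \<le> \<bar>L * I\<bar> * dist x y" by (intro mult_right_mono) auto
    then show "dist (w x) (w y) \<le> \<bar>L * I\<bar> * dist x y" using lip[of x y] by (simp add: dist_real_def)
  qed simp
  then have "continuous_on UNIV w" by (rule lipschitz_on_continuous_on)
  moreover have "bounded (range w)"
    using prod[of "\<lambda>y. \<eta> (_ - y)" M] M by (auto simp: bounded_iff w_def)
  moreover have "\<bar>second_diff w x z\<bar> \<le> C * I * (norm z)\<^sup>2" for x z
  proof -
    have "\<bar>second_diff \<eta> y z\<bar> \<le> C * (norm z)\<^sup>2" for y
      using C(2)[of y z] mult_left_mono[OF _ C(1), of "min 1 ((norm z)\<^sup>2)" "(norm z)\<^sup>2"] by simp
    moreover have "(\<lambda>y. second_diff \<eta> (x - y) z) \<in> borel_measurable borel"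
      unfolding second_diff_def by measurable
    ultimately show ?thesis
      unfolding sd using prod[of "\<lambda>y. second_diff \<eta> (x - y) z" "C * (norm z)\<^sup>2"]
      by (simp add: mult.commute mult.left_commute)
  qed
  ultimately show "tame w" unfolding tame_def by blast
  let ?F = "\<lambda>y z. u y * second_diff \<eta> (x - y) z * riesz \<alpha> z"
  have J: "integrable lborel (\<lambda>z::'a. min 1 ((norm z)\<^sup>2) * riesz \<alpha> z)" by (rule riesz_truncated_integrable[OF \<alpha>])
  have meas: "case_prod ?F \<in> borel_measurable (lborel \<Otimes>\<^sub>M lborel)"
    unfolding second_diff_def by measurable
  have dom: "integrable (lborel \<Otimes>\<^sub>M lborel) (\<lambda>(y, z::'a). \<bar>u y\<bar> * (C * (min 1 ((norm z)\<^sup>2) * riesz \<alpha> z)))"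
    using absu J by (intro lborel_pair.Fubini_integrable) (auto simp: abs_mult)
  have int: "integrable (lborel \<Otimes>\<^sub>M lborel) (case_prod ?F)"
  proof (rule Bochner_Integration.integrable_bound[OF dom meas], intro AE_I2)
    fix p :: "'a \<times> 'a"
    obtain y z where p: "p = (y, z)" by (cases p)
    have "\<bar>second_diff \<eta> (x - y) z\<bar> * riesz \<alpha> z \<le> C * min 1 ((norm z)\<^sup>2) * riesz \<alpha> z"
      using C(2) by (intro mult_right_mono) auto
    then have "\<bar>u y\<bar> * (\<bar>second_diff \<eta> (x - y) z\<bar> * riesz \<alpha> z) \<le> \<bar>u y\<bar> * (C * (min 1 ((norm z)\<^sup>2) * riesz \<alpha> z))"
      by (intro mult_left_mono) (auto simp: mult.assoc)
    then show "norm (case_prod ?F p) \<le> norm (case p of (y, z) \<Rightarrow> \<bar>u y\<bar> * (C * (min 1 ((norm z)\<^sup>2) * riesz \<alpha> z)))"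
      using C(1) by (simp add: p abs_mult mult.assoc)
  qed
  have "jump_op (riesz \<alpha>) w x = (LINT z|lborel. LINT y|lborel. ?F y z)"
    unfolding jump_op_def sd by simp
  also have "\<dots> = (LINT y|lborel. LINT z|lborel. ?F y z)"
    by (rule lborel_pair.Fubini_integral[OF int])
  also have "\<dots> = (LINT y|lborel. u y * jump_op (riesz \<alpha>) \<eta> (x - y))"
    by (simp add: jump_op_def mult.assoc)
  finally show "jump_op (riesz \<alpha>) w x = (LINT y|lborel. u y * jump_op (riesz \<alpha>) \<eta> (x - y))" .
qed

lemma frac_laplacian_const_pos:
  assumes "0 < \<alpha>" "\<alpha> < 2" shows "0 < frac_laplacian_const N \<alpha>"
  using assms unfolding frac_laplacian_const_def
  by (intro mult_pos_pos divide_pos_pos Gamma_real_pos) (auto intro: add_nonneg_pos)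

lemma uniformly_continuous_compact_support:
  fixes u :: "'a::euclidean_space \<Rightarrow> real"
  assumes u: "continuous_on UNIV u" and D: "bounded D" and zero: "\<And>x. x \<notin> D \<Longrightarrow> u x = 0" and \<delta>: "0 < \<delta>"
  obtains e where "0 < e" "\<And>x y. dist x y \<le> e \<Longrightarrow> \<bar>u x - u y\<bar> \<le> \<delta>"
proof -
  obtain R where R: "D \<subseteq> ball 0 R" using bounded_subset_ballD[OF D, of 0] by blast
  have "uniformly_continuous_on (cball 0 (R + 1)) u"
    by (rule compact_uniformly_continuous[OF continuous_on_subset[OF u]]) auto
  then obtain d where d: "0 < d" "\<And>x y. x \<in> cball 0 (R + 1) \<Longrightarrow> y \<in> cball 0 (R + 1) \<Longrightarrow> dist y x < d \<Longrightarrow> dist (u y) (u x) < \<delta>"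
    using \<delta> unfolding uniformly_continuous_on_def by metis
  define e where "e = min 1 (d / 2)"
  have e: "0 < e" "e \<le> 1" "e < d" using d(1) by (auto simp: e_def)
  have "\<bar>u x - u y\<bar> \<le> \<delta>" if xy: "dist x y \<le> e" for x y
  proof (cases "norm x \<le> R + 1 \<and> norm y \<le> R + 1")
    case True
    then show ?thesis using d(2)[of y x] xy e(3) by (simp add: dist_real_def)
  next
    case False
    then have "R \<le> norm x" "R \<le> norm y"
      using xy e(2) norm_triangle_ineq3[of x y] by (auto simp: dist_norm)
    then have "u x = 0" "u y = 0" using zero R by fastforce+
    then show ?thesis using \<delta> by simp
  qed
  then show ?thesis using that e(1) by blast
qed

text \<open>The operator on the mollification at \<open>x\<close> is a nonzero multiple of the
  distribution tested with the bump centred at \<open>x\<close>; it vanishes if that bump is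
  supported in the ring.\<close>

lemma solution_P_weakly_harmonic:
  fixes u :: "'a::euclidean_space \<Rightarrow> real"
  assumes \<alpha>: "0 < \<alpha>" "\<alpha> < 2" and D0: "open D0" "bounded D0" and sol: "solution_P \<alpha> D0 D1 u"
  shows "weakly_harmonic \<alpha> (D0 - closure D1) u"
  unfolding weakly_harmonic_def
proof (intro allI impI)
  fix \<delta> :: real assume \<delta>: "0 < \<delta>"
  have cont: "continuous_on UNIV u" and zero: "\<And>x. x \<notin> D0 \<Longrightarrow> u x = 0"
    and test: "\<And>\<phi>. test_function (D0 - closure D1) \<phi> \<Longrightarrow> frac_laplacian_distr \<alpha> u \<phi> = 0"
    using sol by (auto simp: solution_P_def)
  obtain B where B: "\<And>x. \<bar>u x\<bar> \<le> B" using sol by (auto simp: solution_P_def bounded_iff)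
  have meas [measurable]: "u \<in> borel_measurable borel" by (rule continuous_borel[OF cont])
  have "integrable lborel (\<lambda>x. indicator D0 x * u x)"
    by (rule bounded_indicator_integrable[OF _ D0(2) meas B]) (simp add: D0 borel_open)
  moreover have "indicator D0 x * u x = u x" for x using zero by (auto simp: indicator_def)
  ultimately have int: "integrable lborel u" by simp
  obtain e0 where e0: "0 < e0" "\<And>x y. dist x y \<le> e0 \<Longrightarrow> \<bar>u x - u y\<bar> \<le> \<delta>"
    using uniformly_continuous_compact_support[OF cont D0(2) zero \<delta>] by blast
  \<comment> \<open>The mollification scale respects both the modulus of continuity of
    \<open>u\<close> and the margin \<open>\<delta>\<close>.\<close>
  define e where "e = min e0 \<delta>"
  have e: "0 < e" "e \<le> \<delta>" "e \<le> e0" using e0 \<delta> by (auto simp: e_def)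
  obtain \<eta> :: "'a \<Rightarrow> real" where \<eta>: "bumplike 0 e \<eta>" "\<And>x. 0 \<le> \<eta> x" "integrable lborel \<eta>"
    "(LINT x|lborel. \<eta> x) = 1" "\<And>x. \<eta> (- x) = \<eta> x"
    "\<And>c \<Omega>. cball c e \<subseteq> \<Omega> \<Longrightarrow> test_function \<Omega> (\<lambda>x. \<eta> (c - x))"
    using bump_mollifier[OF e(1), where 'a='a] by blast
  have t\<eta>: "tame \<eta>" using bumplike_tame[OF \<eta>(1)] e by simp
  have [measurable]: "\<eta> \<in> borel_measurable borel" by (rule tame_measurable[OF t\<eta>])
  obtain L where L: "\<And>x y. \<bar>\<eta> x - \<eta> y\<bar> \<le> L * norm (x - y)"
    using bumplike_lipschitz[OF \<eta>(1)] e by (metis less_imp_le)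
  define w where "w = (\<lambda>x. LINT y|lborel. u y * \<eta> (x - y))"
  note moll = mollify_tame[OF \<alpha> meas int t\<eta> L, folded w_def]
  have "\<bar>w x - u x\<bar> \<le> \<delta>" for x
  proof -
    have "w x = (LINT y|lborel. u (x + y) * \<eta> (- y))"
      unfolding w_def using lborel_integral_shift[of "\<lambda>y. u y * \<eta> (x - y)" x] by simp
    also have "\<dots> = (LINT y|lborel. u (x + y) * \<eta> y)" by (simp add: \<eta>(5))
    finally have wx: "w x = (LINT y|lborel. u (x + y) * \<eta> y)" .
    have b: "\<bar>u (x + y) * \<eta> y\<bar> \<le> B * \<eta> y" for y
      unfolding abs_mult using B \<eta>(2) by (auto intro: mult_right_mono)
    have i: "integrable lborel (\<lambda>y. u (x + y) * \<eta> y)"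
      by (rule integrable_bound_measurable[OF _ _ b]) (use \<eta>(3) in auto)
    have "w x - u x = (LINT y|lborel. (u (x + y) - u x) * \<eta> y)"
      unfolding wx left_diff_distrib using i \<eta>(3,4) by simp
    also have "\<bar>\<dots>\<bar> \<le> (LINT y|lborel. \<delta> * \<eta> y)"
    proof (rule Bochner_Integration.integral_abs_bound_integral)
      show "integrable lborel (\<lambda>y. (u (x + y) - u x) * \<eta> y)"
        unfolding left_diff_distrib using i \<eta>(3) by simp
      show "integrable lborel (\<lambda>y. \<delta> * \<eta> y)" using \<eta>(3) by simp
      show "\<bar>(u (x + y) - u x) * \<eta> y\<bar> \<le> \<delta> * \<eta> y" for y
      proof (cases "e < dist 0 y")
        case True
        then show ?thesis using bumplike_support[OF \<eta>(1) True] e by simp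
      next
        case False
        then have "\<bar>u (x + y) - u x\<bar> \<le> \<delta>" using e by (intro e0(2)) (simp add: dist_norm)
        then show ?thesis unfolding abs_mult using \<eta>(2) by (auto intro: mult_right_mono)
      qed
    qed
    also have "\<dots> = \<delta>" using \<eta>(3,4) by simp
    finally show ?thesis .
  qed
  moreover have "jump_op (riesz \<alpha>) w x = 0" if x: "cball x \<delta> \<subseteq> D0 - closure D1" for x
  proof -
    have "cball x e \<subseteq> D0 - closure D1" using x e(2) by (meson order_trans subset_cball)
    then have "frac_laplacian_distr \<alpha> u (\<lambda>y. \<eta> (x - y)) = 0" by (intro test \<eta>(6))
    moreover have "tame (\<lambda>y. \<eta> (x - y))" using tame_affine[OF t\<eta>, of x "- 1"] by simp
    note frac_laplacian_tame[OF \<alpha> this]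
    moreover have "jump_op (riesz \<alpha>) (\<lambda>y. \<eta> (x - y)) y = jump_op (riesz \<alpha>) \<eta> (x - y)" for y
      unfolding jump_op_def by (intro Bochner_Integration.integral_cong) (auto simp: second_diff_def algebra_simps)
    ultimately have "(LINT y|lborel. u y * (- (frac_laplacian_const DIM('a) \<alpha> / 2) * jump_op (riesz \<alpha>) \<eta> (x - y))) = 0"
      by (simp add: frac_laplacian_distr_def)
    moreover have "(LINT y|lborel. u y * (- (frac_laplacian_const DIM('a) \<alpha> / 2) * jump_op (riesz \<alpha>) \<eta> (x - y)))
        = - (frac_laplacian_const DIM('a) \<alpha> / 2) * (LINT y|lborel. u y * jump_op (riesz \<alpha>) \<eta> (x - y))"
      by (subst Bochner_Integration.integral_mult_right_zero[symmetric]) (simp add: mult.left_commute)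
    ultimately show ?thesis
      using frac_laplacian_const_pos[OF \<alpha>, of "DIM('a)"] by (simp add: moll(2))
  qed
  ultimately show "\<exists>w. tame w \<and> (\<forall>x. \<bar>w x - u x\<bar> \<le> \<delta>) \<and>
      (\<forall>x. cball x \<delta> \<subseteq> D0 - closure D1 \<longrightarrow> jump_op (riesz \<alpha>) w x = 0)"
    using moll(1) by blast
qed

subsection \<open>Starshaped superlevel sets\<close>

text \<open>The cosine of the angle between \<open>x\<close> and \<open>\<nu>\<close> is
  \<open>x \<bullet> \<nu> / norm x\<close>. Half of it, taken as \<open>\<delta>\<close>, puts both
  radial directions into the cones where the definition of the normal decides membership.\<close>

lemma exterior_normal_radial:
  assumes \<nu>: "exterior_unit_normal A x \<nu>" and pos: "0 < x \<bullet> \<nu>"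
  obtains h where "0 < h" "\<And>\<tau>. 0 < \<tau> \<Longrightarrow> \<tau> < h \<Longrightarrow> (1 + \<tau>) *\<^sub>R x \<notin> A \<and> (1 - \<tau>) *\<^sub>R x \<in> A"
proof -
  have x: "0 < norm x" using pos by auto
  define \<delta> where "\<delta> = (x \<bullet> \<nu>) / (2 * norm x)"
  have \<delta>: "0 < \<delta>" "\<delta> * norm x < x \<bullet> \<nu>" using pos x by (simp_all add: \<delta>_def)
  obtain r where r: "0 < r" "\<And>y. y \<in> ball x r \<Longrightarrow> (y - x) \<bullet> \<nu> < - \<delta> * norm (y - x) \<Longrightarrow> y \<in> A"
    "\<And>y. y \<in> ball x r \<Longrightarrow> (y - x) \<bullet> \<nu> > \<delta> * norm (y - x) \<Longrightarrow> y \<notin> A"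
    using \<nu> \<delta>(1) unfolding exterior_unit_normal_def by blast
  have "(1 + \<tau>) *\<^sub>R x \<notin> A \<and> (1 - \<tau>) *\<^sub>R x \<in> A" if \<tau>: "0 < \<tau>" "\<tau> < r / norm x" for \<tau>
  proof
    have d: "(1 + \<tau>) *\<^sub>R x - x = \<tau> *\<^sub>R x" "(1 - \<tau>) *\<^sub>R x - x = - (\<tau> *\<^sub>R x)"
      by (simp_all add: algebra_simps)
    have in_ball: "(1 + \<tau>) *\<^sub>R x \<in> ball x r" "(1 - \<tau>) *\<^sub>R x \<in> ball x r"
      using \<tau> x by (simp_all add: dist_norm norm_minus_commute[of x] d field_simps)
    have less: "\<tau> * (\<delta> * norm x) < \<tau> * (x \<bullet> \<nu>)" using \<tau>(1) \<delta>(2) by simp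
    show "(1 + \<tau>) *\<^sub>R x \<notin> A"
      using less \<tau> by (intro r(3)[OF in_ball(1)]) (simp add: d mult.left_commute)
    show "(1 - \<tau>) *\<^sub>R x \<in> A"
      using less \<tau> by (intro r(2)[OF in_ball(2)]) (simp add: d mult.left_commute)
  qed
  then show ?thesis using that[of "r / norm x"] r(1) x by simp
qed

lemma uniformly_starshaped_radial:
  assumes "uniformly_starshaped A" "x \<in> frontier A"
  obtains h where "0 < h" "\<And>\<tau>. 0 < \<tau> \<Longrightarrow> \<tau> < h \<Longrightarrow> (1 + \<tau>) *\<^sub>R x \<notin> A \<and> (1 - \<tau>) *\<^sub>R x \<in> A"
proof -
  obtain \<nu> \<epsilon> where "\<forall>x\<in>frontier A. exterior_unit_normal A x (\<nu> x)" "\<epsilon> > 0" "\<forall>x\<in>frontier A. x \<bullet> \<nu> x \<ge> \<epsilon>"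
    using assms(1) unfolding uniformly_starshaped_def by blast
  then have "exterior_unit_normal A x (\<nu> x)" "0 < x \<bullet> \<nu> x"
    using assms(2) by (auto intro: less_le_trans)
  then show ?thesis using exterior_normal_radial that by blast
qed

text \<open>If the ray entered \<open>D\<close>, the last point outside \<open>D\<close> before
  \<open>t x\<close> would be a boundary point, and there the normal keeps the ray outside for a
  while longer.\<close>

lemma uniformly_starshaped_outward:
  assumes D: "uniformly_starshaped D" "open D" and x: "x \<notin> D" and t: "1 \<le> t"
  shows "t *\<^sub>R x \<notin> D"
proof
  assume tx: "t *\<^sub>R x \<in> D"
  define S where "S = {1..t} \<inter> (\<lambda>s. s *\<^sub>R x) -` (- D)"
  have "closed S"
    unfolding S_def using D(2)
    by (intro continuous_closed_preimage continuous_intros) auto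
  then have "compact S" unfolding S_def using bounded_subset[OF bounded_closed_interval[of 1 t]]
    by (auto simp: compact_eq_bounded_closed)
  note attains = compact_attains_sup[OF this] compact_attains_inf[OF this]
  have "S \<noteq> {}" using x t by (auto simp: S_def)
  then obtain m where m: "m \<in> S" "\<And>s. s \<in> S \<Longrightarrow> s \<le> m" using attains by blast
  have m1: "1 \<le> m" "m *\<^sub>R x \<notin> D" "m < t" using m(1) tx by (auto simp: S_def less_le)
  have inD: "s *\<^sub>R x \<in> D" if "m < s" "s \<le> t" for s
    using that m(2)[of s] m1(1) by (force simp: S_def)
  have "m *\<^sub>R x \<in> closure D"
    unfolding closure_approachable
  proof (intro allI impI)
    fix e :: real assume e: "0 < e"
    define \<tau> where "\<tau> = min (t - m) (e / (2 * (norm x + 1)))"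
    have \<tau>: "0 < \<tau>" "\<tau> \<le> t - m" "\<tau> \<le> e / (2 * (norm x + 1))"
      using m1 e by (auto simp: \<tau>_def intro!: divide_pos_pos mult_pos_pos add_nonneg_pos)
    have "0 < 2 * (norm x + 1)" by (simp add: add_nonneg_pos)
    then have "\<tau> * (2 * (norm x + 1)) \<le> e" using \<tau>(3) by (simp only: pos_le_divide_eq)
    moreover have "\<tau> * (2 * (norm x + 1)) = 2 * (\<tau> * norm x) + 2 * \<tau>" by (simp add: algebra_simps)
    moreover have "0 \<le> \<tau> * norm x" using \<tau>(1) by simp
    ultimately have "\<tau> * norm x < e" using \<tau>(1) by linarith
    then have "dist ((m + \<tau>) *\<^sub>R x) (m *\<^sub>R x) < e"
      using \<tau>(1) by (simp add: dist_norm scaleR_left_distrib)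
    moreover have "(m + \<tau>) *\<^sub>R x \<in> D" using \<tau> by (intro inD) auto
    ultimately show "\<exists>y\<in>D. dist y (m *\<^sub>R x) < e" by blast
  qed
  then have "m *\<^sub>R x \<in> frontier D" using m1(2) D(2) by (simp add: frontier_def interior_open)
  then obtain h where h: "0 < h" "\<And>\<tau>. 0 < \<tau> \<Longrightarrow> \<tau> < h \<Longrightarrow> (1 + \<tau>) *\<^sub>R m *\<^sub>R x \<notin> D"
    using uniformly_starshaped_radial[OF D(1)] by metis
  define \<tau> where "\<tau> = min (h / 2) ((t - m) / m)"
  have \<tau>: "0 < \<tau>" "\<tau> < h" "\<tau> \<le> (t - m) / m" using h(1) m1 by (auto simp: \<tau>_def)
  have "\<tau> * m \<le> t - m" using \<tau>(3) m1 by (simp add: field_simps)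
  moreover have "0 < \<tau> * m" using \<tau>(1) m1(1) by simp
  ultimately have "((1 + \<tau>) * m) *\<^sub>R x \<in> D" by (intro inD) (auto simp: distrib_right)
  then show False using h(2)[OF \<tau>(1,2)] by simp
qed

text \<open>Otherwise \<open>t x\<close> is a boundary point and the normal puts points of the ray
  just before it into \<open>D\<close>, against \<open>uniformly_starshaped_outward\<close> applied
  at \<open>x\<close>.\<close>

lemma uniformly_starshaped_inward:
  assumes D: "uniformly_starshaped D" "open D" and tx: "t *\<^sub>R x \<in> closure D" and t: "1 \<le> t"
  shows "x \<in> closure D"
proof (rule ccontr)
  assume x: "x \<notin> closure D"
  then have t1: "1 < t" using tx t by (cases "t = 1") auto
  have xD: "x \<notin> D" using x closure_subset by blast
  then have "t *\<^sub>R x \<in> frontier D"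
    using tx uniformly_starshaped_outward[OF D xD t] D(2) by (simp add: frontier_def interior_open)
  then obtain h where h: "0 < h" "\<And>\<tau>. 0 < \<tau> \<Longrightarrow> \<tau> < h \<Longrightarrow> (1 - \<tau>) *\<^sub>R t *\<^sub>R x \<in> D"
    using uniformly_starshaped_radial[OF D(1)] by metis
  define \<tau> where "\<tau> = min (h / 2) ((t - 1) / t)"
  have \<tau>: "0 < \<tau>" "\<tau> < h" "\<tau> \<le> (t - 1) / t" using h(1) t1 by (auto simp: \<tau>_def)
  have "\<tau> * t \<le> t - 1" using \<tau>(3) t1 by (simp add: field_simps)
  then have "((1 - \<tau>) * t) *\<^sub>R x \<notin> D"
    by (intro uniformly_starshaped_outward[OF D xD]) (simp add: left_diff_distrib)
  then show False using h(2)[OF \<tau>(1,2)] by simp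
qed

text \<open>A superlevel set has its exterior normal against the gradient: an error of at most
  \<open>\<delta> * norm G\<close> per unit length in the linear approximation cannot change its
  sign off the cone of opening \<open>\<delta>\<close>.\<close>

lemma exterior_normal_superlevel:
  fixes u :: "'a::euclidean_space \<Rightarrow> real"
  assumes der: "(u has_derivative (\<lambda>h. G \<bullet> h)) (at x)" and G: "G \<noteq> 0"
  shows "exterior_unit_normal {y. u x \<le> u y} x (- (1 / norm G) *\<^sub>R G)"
  unfolding exterior_unit_normal_def
proof (intro conjI allI impI)
  show "norm (- (1 / norm G) *\<^sub>R G) = 1" using G by simp
  fix \<delta> :: real assume \<delta>: "0 < \<delta>"
  define e where "e = \<delta> * norm G"
  have e: "0 < e" using \<delta> G by (simp add: e_def)
  obtain r where r: "0 < r" "\<And>y. norm (y - x) < r \<Longrightarrow> \<bar>u y - u x - G \<bullet> (y - x)\<bar> \<le> e * norm (y - x)"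
  proof -
    have "\<forall>e>0. \<exists>d>0. \<forall>y. norm (y - x) < d \<longrightarrow> norm (u y - u x - G \<bullet> (y - x)) \<le> e * norm (y - x)"
      using der unfolding has_derivative_at_alt by blast
    then show ?thesis using e that unfolding real_norm_def by blast
  qed
  show "\<exists>r>0. \<forall>y\<in>ball x r.
      ((y - x) \<bullet> (- (1 / norm G) *\<^sub>R G) < - \<delta> * norm (y - x) \<longrightarrow> y \<in> {y. u x \<le> u y}) \<and>
      ((y - x) \<bullet> (- (1 / norm G) *\<^sub>R G) > \<delta> * norm (y - x) \<longrightarrow> y \<notin> {y. u x \<le> u y})"
  proof (intro exI[of _ r] conjI ballI impI r(1))
    fix y assume "y \<in> ball x r"
    then have est: "\<bar>u y - u x - G \<bullet> (y - x)\<bar> \<le> e * norm (y - x)"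
      by (intro r(2)) (simp add: dist_norm norm_minus_commute)
    have eq: "(y - x) \<bullet> (- (1 / norm G) *\<^sub>R G) = - (G \<bullet> (y - x)) / norm G"
      by (simp add: inner_commute)
    {
      assume "(y - x) \<bullet> (- (1 / norm G) *\<^sub>R G) < - \<delta> * norm (y - x)"
      then have "e * norm (y - x) < G \<bullet> (y - x)"
        unfolding eq e_def using G by (simp add: field_simps)
      then show "y \<in> {y. u x \<le> u y}" using est by auto
    next
      assume "(y - x) \<bullet> (- (1 / norm G) *\<^sub>R G) > \<delta> * norm (y - x)"
      then have "e * norm (y - x) < - (G \<bullet> (y - x))"
        unfolding eq e_def using G by (simp add: field_simps)
      then show "y \<notin> {y. u x \<le> u y}" using est by auto
    }
  qed
qed

text \<open>By continuity the frontier lies in the level set, whose compactness turns the strict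
  inequality for the normalized gradient into a uniform \<open>\<epsilon>\<close>.\<close>

lemma superlevel_uniformly_starshaped:
  fixes u :: "'a::euclidean_space \<Rightarrow> real"
  assumes u: "continuous_on UNIV u" and K: "compact {x. u x = l}"
    and der: "\<And>x. u x = l \<Longrightarrow> (u has_derivative (\<lambda>h. G x \<bullet> h)) (at x)"
    and G: "continuous_on {x. u x = l} G" and neg: "\<And>x. u x = l \<Longrightarrow> x \<bullet> G x < 0"
  shows "uniformly_starshaped {x. l \<le> u x}"
proof -
  let ?K = "{x. u x = l}"
  have fr: "u x = l" if "x \<in> frontier {x. l \<le> u x}" for x
  proof (rule ccontr)
    have "closed {x. l \<le> u x}" by (intro closed_Collect_le continuous_intros u)
    then have 1: "l \<le> u x" "x \<notin> interior {x. l \<le> u x}" using that by (auto simp: frontier_def)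
    assume "u x \<noteq> l"
    then have "x \<in> {x. l < u x}" using 1 by simp
    moreover have "open {x. l < u x}" by (intro open_Collect_less continuous_intros u)
    moreover have "{x. l < u x} \<subseteq> {x. l \<le> u x}" by auto
    ultimately show False using 1 interior_maximal by blast
  qed
  have G0: "G x \<noteq> 0" if "u x = l" for x using neg[OF that] by auto
  have "\<exists>\<epsilon>>0. \<forall>x\<in>?K. \<epsilon> \<le> x \<bullet> (- (1 / norm (G x)) *\<^sub>R G x)"
  proof (cases "?K = {}")
    case False
    have "continuous_on ?K (\<lambda>x. x \<bullet> (- (1 / norm (G x)) *\<^sub>R G x))"
      using G0 by (intro continuous_intros G) auto
    then obtain a where a: "a \<in> ?K" "\<And>x. x \<in> ?K \<Longrightarrow>
        a \<bullet> (- (1 / norm (G a)) *\<^sub>R G a) \<le> x \<bullet> (- (1 / norm (G x)) *\<^sub>R G x)"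
      using continuous_attains_inf[OF K False] by blast
    moreover have "0 < a \<bullet> (- (1 / norm (G a)) *\<^sub>R G a)"
      using neg[of a] G0[of a] a(1) by (simp add: divide_neg_pos)
    ultimately show ?thesis by blast
  qed (auto intro: zero_less_one)
  moreover have "exterior_unit_normal {x. l \<le> u x} x (- (1 / norm (G x)) *\<^sub>R G x)" if "u x = l" for x
    using exterior_normal_superlevel[OF der[OF that] G0[OF that]] that by simp
  ultimately show ?thesis
    unfolding uniformly_starshaped_def using fr
    by (intro exI[of _ "\<lambda>x. - (1 / norm (G x)) *\<^sub>R G x"]) blast
qed

section \<open>Strict decrease along rays, and the conclusion\<close>

lemma compact_support_integrable:
  fixes u :: "'a::euclidean_space \<Rightarrow> real"
  assumes "continuous_on UNIV u" "bounded D" "\<And>x. x \<notin> D \<Longrightarrow> u x = 0" "\<And>x. \<bar>u x\<bar> \<le> B"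
  shows "integrable lborel u"
proof -
  obtain R where R: "D \<subseteq> ball 0 R" using bounded_subset_ballD[OF assms(2), of 0] by blast
  have "integrable lborel (\<lambda>x. indicator (ball 0 R) x * u x)"
    by (rule bounded_indicator_integrable[OF _ bounded_ball continuous_borel[OF assms(1)] assms(4)])
      (simp add: borel_open)
  moreover have "indicator (ball 0 R) x * u x = u x" for x
    using assms(3)[of x] subsetD[OF R, of x] by (cases "x \<in> D") auto
  ultimately show ?thesis by simp
qed

text \<open>The total mass of \<open>u x - u (t x)\<close> is known exactly by scaling, only a small part of it lies
  near \<open>x0\<close>, and Harnack's inequality carries the rest to \<open>x0\<close>.\<close>

lemma radial_derivative_negative:
  fixes u :: "'a::euclidean_space \<Rightarrow> real"
  assumes \<alpha>: "0 < \<alpha>" "\<alpha> < 2"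
    and u: "continuous_on UNIV u" "\<And>x. \<bar>u x\<bar> \<le> 1" "0 < (LINT x|lborel. u x)"
    and D: "bounded D" "\<And>x. x \<notin> D \<Longrightarrow> u x = 0" and nonneg: "\<And>x. 0 \<le> u x"
    and G: "open G" "x0 \<in> G" "weakly_harmonic \<alpha> G u"
    and mono: "\<And>x t. 1 \<le> t \<Longrightarrow> u (t *\<^sub>R x) \<le> u x"
    and der: "(u has_derivative (\<lambda>h. g \<bullet> h)) (at x0)"
  shows "x0 \<bullet> g < 0"
proof -
  let ?N = "DIM('a)"
  let ?V = "unit_ball_vol (real ?N)"
  define I where "I = (LINT x|lborel. u x)"
  have I: "0 < I" using u(3) by (simp add: I_def)
  have int: "integrable lborel u" by (rule compact_support_integrable[OF u(1) D u(2)])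
  have [measurable]: "u \<in> borel_measurable borel" by (rule continuous_borel[OF u(1)])
  obtain r1 C \<gamma> where r1: "0 < r1" "0 < C" and dq: "\<forall>x\<in>ball x0 r1. \<forall>y\<in>ball x0 r1. \<forall>v. v \<noteq> 0 \<longrightarrow> norm v < r1 \<longrightarrow>
     \<bar>diff_quot u v x\<bar> \<le> C \<and> \<bar>diff_quot u v y - diff_quot u v x\<bar> \<le> C * norm (y - x) powr \<gamma>"
    using weakly_harmonic_diff_quot[OF \<alpha> G u(2)] by blast
  have lip: "\<bar>u (x + v) - u x\<bar> \<le> C * norm v" if "x \<in> ball x0 r1" "norm v < r1" for x v
  proof (cases "v = 0")
    case False
    then have "\<bar>diff_quot u v x\<bar> \<le> C" using dq that by blast
    then show ?thesis using False by (simp add: diff_quot_def field_simps)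
  qed simp
  obtain \<rho> where \<rho>: "0 < \<rho>" "cball x0 \<rho> \<subseteq> G" using G open_contains_cball by blast
  \<comment> \<open>The bound by \<open>\<rho> / 4\<close> keeps the ball of radius
    \<open>2 * r\<close> and its dilates in \<open>G\<close>; the last bound limits the mass of
    \<open>v\<close> near \<open>x0\<close> to \<open>s * I / 4\<close>.\<close>
  define r where "r = min (min 1 (r1 / 2)) (min (\<rho> / 4) (I / (4 * ?V * C * (norm x0 + 1))))"
  have den: "0 < 4 * ?V * C * (norm x0 + 1)"
    using r1(2) by (intro mult_pos_pos) (auto intro: add_nonneg_pos)
  have r: "0 < r" "r \<le> 1" "r < r1" "4 * r \<le> \<rho>" "r \<le> I / (4 * ?V * C * (norm x0 + 1))"
    using I den r1 \<rho> by (auto simp: r_def)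
  obtain R where R: "0 < R" "D \<subseteq> ball x0 R"
    using bounded_subset_ballD[OF D(1), of x0] by blast
  obtain K where K: "0 \<le> K" and harnack: "\<forall>v (x0::'a). continuous_on UNIV v \<longrightarrow> (\<forall>x. 0 \<le> v x) \<longrightarrow>
     weakly_harmonic \<alpha> (ball x0 (2 * r)) v \<longrightarrow>
     (LINT y|lborel. indicator {y. r \<le> dist x0 y \<and> dist x0 y \<le> R} y * v y) \<le> K * v x0"
    using weakly_harmonic_harnack[OF \<alpha> r(1) R(1), where 'a='a] by blast
  \<comment> \<open>For \<open>s < s0\<close>, dilation by \<open>1 + s\<close> moves each point of
    the ball of radius \<open>2 * r\<close> by less than \<open>r1\<close> and
    \<open>2 * r\<close>.\<close>
  define s0 where "s0 = min 1 (min r1 (2 * r) / (norm x0 + 2))"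
  have s0: "0 < s0" "s0 \<le> 1" "s0 * (norm x0 + 2) \<le> r1" "s0 * (norm x0 + 2) \<le> 2 * r"
  proof -
    have n: "0 < norm x0 + 2" by (simp add: add_nonneg_pos)
    show "0 < s0" "s0 \<le> 1" using n r1 r by (auto simp: s0_def)
    have "s0 \<le> min r1 (2 * r) / (norm x0 + 2)" by (simp add: s0_def)
    then have "s0 * (norm x0 + 2) \<le> min r1 (2 * r)" using n by (simp add: pos_le_divide_eq)
    then show "s0 * (norm x0 + 2) \<le> r1" "s0 * (norm x0 + 2) \<le> 2 * r" by auto
  qed
  have key: "I / 4 / (K + 1) \<le> - ((u (x0 + s *\<^sub>R x0) - u x0) / s)" if s: "0 < s" "s < s0" for s
  proof -
    define v where "v = (\<lambda>x. 1 * u x + (- 1) * u ((1 + s) *\<^sub>R x) + 0)"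
    have shift: "(1 + s) *\<^sub>R x = x + s *\<^sub>R x" for x :: 'a by (simp add: scaleR_left_distrib)
    have v0: "0 \<le> v x" for x using mono[of "1 + s" x] s by (simp add: v_def)
    have uts: "continuous_on UNIV (\<lambda>x. u ((1 + s) *\<^sub>R x))"
      by (rule continuous_on_compose2[OF u(1)]) (auto intro!: continuous_intros)
    have vc: "continuous_on UNIV v" unfolding v_def by (intro continuous_intros u(1) uts)
    have small: "s * norm x < r1" "s * norm x < 2 * r" if "x \<in> ball x0 (2 * r)" for x
    proof -
      have "norm x \<le> norm x0 + 2"
        using that r(2) norm_triangle_ineq2[of x x0] by (simp add: dist_norm norm_minus_commute)
      then have "s * norm x \<le> s * (norm x0 + 2)" using s by (intro mult_left_mono) auto
      also have "\<dots> < s0 * (norm x0 + 2)" using s by (intro mult_strict_right_mono) (auto intro: add_nonneg_pos)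
      finally show "s * norm x < r1" "s * norm x < 2 * r" using s0 by auto
    qed
    have "weakly_harmonic \<alpha> (G \<inter> {x. (1 + s) *\<^sub>R x \<in> G}) v"
      unfolding v_def using s
      by (intro weakly_harmonic_combine[OF \<alpha> G(3)] weakly_harmonic_scale[OF G(3)]) auto
    moreover have "ball x0 (2 * r) \<subseteq> G \<inter> {x. (1 + s) *\<^sub>R x \<in> G}"
    proof
      fix x assume x: "x \<in> ball x0 (2 * r)"
      have "dist x0 ((1 + s) *\<^sub>R x) \<le> dist x0 x + s * norm x"
        using dist_triangle[of x0 "(1 + s) *\<^sub>R x" x] s(1) by (simp add: shift dist_norm)
      then have "dist x0 ((1 + s) *\<^sub>R x) \<le> \<rho>" "dist x0 x \<le> \<rho>" using x small[OF x] r(1,4) by auto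
      then show "x \<in> G \<inter> {x. (1 + s) *\<^sub>R x \<in> G}" using \<rho>(2) by auto
    qed
    ultimately have "weakly_harmonic \<alpha> (ball x0 (2 * r)) v" by (rule weakly_harmonic_mono)
    then have H: "(LINT y|lborel. indicator {y. r \<le> dist x0 y \<and> dist x0 y \<le> R} y * v y) \<le> K * v x0"
      using harnack vc v0 by blast
    have uti: "integrable lborel (\<lambda>x. u ((1 + s) *\<^sub>R x))"
      using lborel_integrable_affine_iff[of u "1 + s" 0] int s by simp
    have vi: "integrable lborel v" unfolding v_def using int uti by simp
    have "I = (1 + s) ^ ?N * (LINT x|lborel. u ((1 + s) *\<^sub>R x))"
      unfolding I_def using lborel_integral_affine[of u "1 + s" 0] s by simp
    \<comment> \<open>Dilation divides the mass by at least \<open>1 + s\<close> in every dimension,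
      so \<open>v\<close> has mass at least \<open>s * I / (1 + s)\<close>, and
      \<open>s \<le> 1\<close> gives \<open>s * I / 2\<close>.\<close>
    moreover have "(1 + s) ^ 1 \<le> (1 + s) ^ ?N"
      using s by (intro power_increasing) (auto simp: Suc_le_eq)
    moreover have "0 \<le> (LINT x|lborel. u ((1 + s) *\<^sub>R x))"
    proof (rule ccontr)
      assume "\<not> ?thesis"
      then have "(1 + s) ^ ?N * (LINT x|lborel. u ((1 + s) *\<^sub>R x)) < 0"
        using s by (intro mult_pos_neg) auto
      then show False using I calculation(1) by simp
    qed
    ultimately have "(1 + s) * (LINT x|lborel. u ((1 + s) *\<^sub>R x)) \<le> I"
      by (metis mult_right_mono power_one_right)
    moreover have "(LINT x|lborel. v x) = I - (LINT x|lborel. u ((1 + s) *\<^sub>R x))"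
      unfolding v_def I_def using int uti by simp
    then have "(1 + s) * (LINT x|lborel. v x) = (1 + s) * I - (1 + s) * (LINT x|lborel. u ((1 + s) *\<^sub>R x))"
      by (simp only: right_diff_distrib)
    moreover have "(1 + s) * I = I + s * I" by (simp add: distrib_right)
    ultimately have "s * I \<le> (1 + s) * (LINT x|lborel. v x)" by linarith
    also have "\<dots> \<le> 2 * (LINT x|lborel. v x)"
      using s s0(2) v0 by (intro mult_right_mono integral_nonneg_AE) auto
    finally have total: "s * I / 2 \<le> (LINT x|lborel. v x)" by simp
    have vzero: "v x = 0" if "R < dist x0 x" for x
    proof -
      have "u x = 0" using that R(2) by (intro D(2)) auto
      moreover have "u ((1 + s) *\<^sub>R x) \<le> u x" using s by (intro mono) auto
      ultimately show ?thesis using nonneg[of "(1 + s) *\<^sub>R x"] by (simp add: v_def)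
    qed
    let ?A = "{y. r \<le> dist x0 y \<and> dist x0 y \<le> R}"
    define b where "b = C * (s * (norm x0 + 1))"
    have vb: "v x \<le> b" if x: "x \<in> ball x0 r" for x
    proof -
      have "norm x \<le> norm x0 + 1"
        using x r(2) norm_triangle_ineq2[of x x0] by (simp add: dist_norm norm_minus_commute)
      then have n: "norm (s *\<^sub>R x) \<le> s * (norm x0 + 1)" using s by (simp add: mult_left_mono)
      have "x \<in> ball x0 (2 * r)" using x r(1) by auto
      from small(1)[OF this] have "\<bar>u (x + s *\<^sub>R x) - u x\<bar> \<le> C * norm (s *\<^sub>R x)"
        using x r(3) s by (intro lip) auto
      also have "\<dots> \<le> b" unfolding b_def using n r1(2) by (intro mult_left_mono) auto
      finally show ?thesis by (simp add: v_def shift)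
    qed
    have [measurable]: "v \<in> borel_measurable borel" by (rule continuous_borel[OF vc])
    have vabs: "\<bar>v x\<bar> \<le> 2" for x
      using u(2)[of x] u(2)[of "(1 + s) *\<^sub>R x"] unfolding v_def by linarith
    have "closed ?A" by (intro closed_Collect_conj closed_Collect_le continuous_intros)
    then have A: "?A \<in> sets borel" "bounded ?A"
      by (rule borel_closed) (rule bounded_subset[OF bounded_cball[of x0 R]], auto)
    have iA: "integrable lborel (\<lambda>y. indicator ?A y * v y)"
      by (rule bounded_indicator_integrable[OF A]) (use vabs in auto)
    have iB: "integrable lborel (\<lambda>y. indicator (ball x0 r) y * v y)"
      by (rule bounded_indicator_integrable) (use vabs in \<open>auto simp: borel_open\<close>)
    have iC: "integrable lborel (\<lambda>y. indicator (ball x0 r) y * b)"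
      by (rule bounded_indicator_integrable) (auto simp: borel_open)
    have "v y = indicator ?A y * v y + indicator (ball x0 r) y * v y" for y
      using vzero[of y] by (auto simp: indicator_def)
    then have "(LINT y|lborel. v y) = (LINT y|lborel. indicator ?A y * v y + indicator (ball x0 r) y * v y)"
      by (rule arg_cong[OF ext])
    also have "\<dots> = (LINT y|lborel. indicator ?A y * v y) + (LINT y|lborel. indicator (ball x0 r) y * v y)"
      by (rule Bochner_Integration.integral_add[OF iA iB])
    also have "(LINT y|lborel. indicator (ball x0 r) y * v y) \<le> (LINT y|lborel. indicator (ball x0 r) y * b)"
      using vb by (intro integral_mono iB iC) (auto simp: indicator_def)
    also have "(LINT y|lborel. indicator (ball x0 r) y * b) = ?V * r ^ ?N * b"
      using r(1) by (simp add: content_ball)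
    \<comment> \<open>The part near \<open>x0\<close> uses at most half of the lower bound
      \<open>s * I / 2\<close>; the rest lies on the annulus and is carried to
      \<open>x0\<close>.\<close>
    also have "?V * r ^ ?N * b \<le> s * I / 4"
    proof -
      have "r ^ ?N \<le> r ^ 1" using r by (intro power_decreasing) (auto simp: Suc_le_eq)
      then have "?V * r ^ ?N * b \<le> ?V * r * b"
        using s r1(2) by (intro mult_right_mono mult_left_mono) (auto simp: b_def less_imp_le)
      also have "\<dots> = s * (r * (4 * ?V * C * (norm x0 + 1))) / 4" by (simp add: b_def)
      also have "\<dots> \<le> s * I / 4"
        using s r(5) den by (intro divide_right_mono mult_left_mono) (auto simp: pos_le_divide_eq)
      finally show ?thesis .
    qed
    finally have "s * I / 4 \<le> K * v x0" using total H by linarith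
    also have "\<dots> \<le> (K + 1) * v x0" using v0 by (intro mult_right_mono) auto
    finally have "s * I / 4 \<le> (K + 1) * v x0" .
    then have "I / 4 / (K + 1) \<le> v x0 / s" using s K by (simp add: field_simps)
    also have "v x0 / s = - ((u (x0 + s *\<^sub>R x0) - u x0) / s)"
      by (simp add: v_def shift diff_divide_distrib)
    finally show ?thesis .
  qed
  have "((\<lambda>s. x0 + s *\<^sub>R x0) has_derivative (\<lambda>s. s *\<^sub>R x0)) (at (0::real))"
    by (auto intro!: derivative_eq_intros)
  from has_derivative_compose[OF this, of u "\<lambda>h. g \<bullet> h"] der
  have "((\<lambda>s. u (x0 + s *\<^sub>R x0)) has_derivative (\<lambda>s. (x0 \<bullet> g) * s)) (at 0)"
    by (simp add: inner_commute mult.commute)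
  then have "((\<lambda>s. u (x0 + s *\<^sub>R x0)) has_real_derivative (x0 \<bullet> g)) (at 0)"
    by (simp only: has_field_derivative_def)
  then have "((\<lambda>s. (u (x0 + s *\<^sub>R x0) - u x0) / s) \<longlongrightarrow> x0 \<bullet> g) (at 0)"
    by (simp add: DERIV_def)
  then have "((\<lambda>s. - ((u (x0 + s *\<^sub>R x0) - u x0) / s)) \<longlongrightarrow> - (x0 \<bullet> g)) (at_right 0)"
    by (intro tendsto_minus) (rule tendsto_mono[OF at_le[OF subset_UNIV]])
  then have "I / 4 / (K + 1) \<le> - (x0 \<bullet> g)"
  proof (rule tendsto_lowerbound)
    show "\<forall>\<^sub>F s in at_right 0. I / 4 / (K + 1) \<le> - ((u (x0 + s *\<^sub>R x0) - u x0) / s)"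
      by (rule eventually_at_rightI[of 0 s0]) (use key s0(1) in simp_all)
  qed simp
  moreover have "0 < I / 4 / (K + 1)" using I K by simp
  ultimately show ?thesis by linarith
qed

text \<open>Uniqueness of the derivative identifies a gradient chosen point by point with the local
  continuous gradients.\<close>

lemma weakly_harmonic_continuously_differentiable:
  fixes u :: "'a::euclidean_space \<Rightarrow> real"
  assumes \<alpha>: "0 < \<alpha>" "\<alpha> < 2" and G: "open G"
    and u: "weakly_harmonic \<alpha> G u" "\<And>x. \<bar>u x\<bar> \<le> B"
  obtains g where "\<And>x. x \<in> G \<Longrightarrow> (u has_derivative (\<lambda>h. g x \<bullet> h)) (at x)" "continuous_on G g"
proof -
  have loc: "\<exists>r>0. \<exists>f. (\<forall>x\<in>ball x0 r. (u has_derivative (\<lambda>h. f x \<bullet> h)) (at x)) \<and> continuous_on (ball x0 r) f"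
    if x0: "x0 \<in> G" for x0
  proof -
    obtain r C \<gamma> where r: "0 < r" "0 < C" "0 < \<gamma>" and dq: "\<forall>x\<in>ball x0 r. \<forall>y\<in>ball x0 r. \<forall>v. v \<noteq> 0 \<longrightarrow> norm v < r \<longrightarrow>
     \<bar>diff_quot u v x\<bar> \<le> C \<and> \<bar>diff_quot u v y - diff_quot u v x\<bar> \<le> C * norm (y - x) powr \<gamma>"
      using weakly_harmonic_diff_quot[OF \<alpha> G x0 u] by blast
    have "\<exists>f. (\<forall>x\<in>ball x0 r. (u has_derivative (\<lambda>h. f x \<bullet> h)) (at x)) \<and> continuous_on (ball x0 r) f"
      by (rule continuously_differentiable_of_diff_quot[OF r]) (use dq in blast)
    then show ?thesis using r(1) by blast
  qed
  define g where "g = (\<lambda>x. SOME f. (u has_derivative (\<lambda>h. f \<bullet> h)) (at x))"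
  have g: "(u has_derivative (\<lambda>h. g x \<bullet> h)) (at x)" if "(u has_derivative (\<lambda>h. f \<bullet> h)) (at x)" for x f
    unfolding g_def using that by (rule someI)
  have "continuous_on G g"
    unfolding continuous_on_eq_continuous_at[OF G]
  proof
    fix x0 assume "x0 \<in> G"
    then obtain r f where r: "0 < r" "\<forall>x\<in>ball x0 r. (u has_derivative (\<lambda>h. f x \<bullet> h)) (at x)"
      "continuous_on (ball x0 r) f" using loc by blast
    have "f x = g x" if "x \<in> ball x0 r" for x
    proof -
      have "(\<lambda>h. f x \<bullet> h) = (\<lambda>h. g x \<bullet> h)"
        using has_derivative_unique r(2) that g by blast
      then show ?thesis by (metis vector_eq_rdot)
    qed
    then have "continuous_on (ball x0 r) g" using continuous_on_eq[OF r(3)] by blast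
    then show "isCont g x0" using r(1) by (simp add: continuous_on_eq_continuous_at)
  qed
  moreover have "(u has_derivative (\<lambda>h. g x \<bullet> h)) (at x)" if x: "x \<in> G" for x
  proof -
    obtain r f where "0 < r" "\<forall>y\<in>ball x r. (u has_derivative (\<lambda>h. f y \<bullet> h)) (at y)"
      using loc[OF x] by blast
    then show ?thesis using g[of "f x" x] by simp
  qed
  ultimately show ?thesis using that by blast
qed

theorem theorem1p5:
  fixes D0 D1 :: "(real ^ 'n) set" and u :: "real ^ 'n \<Rightarrow> real" and \<alpha> :: real
  assumes "0 < \<alpha>" and "\<alpha> < 2"
    and "open D0" and "bounded D0"
    and "open D1" and "bounded D1"
    and "0 \<in> D1" and "closure D1 \<subseteq> D0"
    and "uniformly_starshaped D0" and "uniformly_starshaped D1"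
    and "C11_domain (D0 - closure D1)"
    and "solution_P \<alpha> D0 D1 u"
  shows "\<forall>l\<in>{0<..<1}. uniformly_starshaped {x. u x \<ge> l}"
proof
  note \<alpha> = assms(1,2)
  define \<Omega> where "\<Omega> = D0 - closure D1"
  have \<Omega>: "open \<Omega>" "bounded \<Omega>"
    using assms(3,4) by (auto simp: \<Omega>_def intro: open_Diff bounded_subset)
  have cont: "continuous_on UNIV u" and zero: "\<And>x. x \<notin> D0 \<Longrightarrow> u x = 0"
    and one: "\<And>x. x \<in> closure D1 \<Longrightarrow> u x = 1"
    using assms(12) by (auto simp: solution_P_def)
  have harm: "weakly_harmonic \<alpha> \<Omega> u"
    unfolding \<Omega>_def by (rule solution_P_weakly_harmonic[OF \<alpha> assms(3,4,12)])
  have nonneg: "0 \<le> u x" for x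
  proof (rule weakly_harmonic_minimum[OF \<alpha> \<Omega> cont _ harm])
    show "0 \<le> u x" if "x \<notin> \<Omega>" for x
      using that zero[of x] one[of x] by (auto simp: \<Omega>_def)
  qed
  \<comment> \<open>The function \<open>1 - u\<close>, written in the form of
    \<open>weakly_harmonic_combine\<close>.\<close>
  have "0 \<le> (- 1) * u x + 0 * u x + 1" for x
  proof (rule weakly_harmonic_minimum[OF \<alpha> \<Omega>, where v = "\<lambda>x. (- 1) * u x + 0 * u x + 1"])
    show "continuous_on UNIV (\<lambda>x. (- 1) * u x + 0 * u x + 1)" by (intro continuous_intros cont)
    show "0 \<le> (- 1) * u x + 0 * u x + 1" if "x \<notin> \<Omega>" for x
      using that zero[of x] one[of x] by (auto simp: \<Omega>_def)
    show "weakly_harmonic \<alpha> \<Omega> (\<lambda>x. (- 1) * u x + 0 * u x + 1)"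
      using weakly_harmonic_combine[OF \<alpha> harm harm, of "- 1" 0 1] by simp
  qed
  then have le1: "u x \<le> 1" for x by (simp add: algebra_simps)
  have mono: "u (t *\<^sub>R x) \<le> u x" if t: "1 \<le> t" for x t
  proof -
    \<comment> \<open>Where both \<open>u\<close> and its dilate solve the equation. Elsewhere one
      of the two takes the value \<open>0\<close> or \<open>1\<close>, and starshapedness of
      \<open>D0\<close> and \<open>D1\<close> decides the sign of the difference.\<close>
    let ?G = "\<Omega> \<inter> {x. t *\<^sub>R x \<in> \<Omega>}"
    let ?v = "\<lambda>x. 1 * u x + (- 1) * u (t *\<^sub>R x) + 0"
    have "0 \<le> ?v x"
    proof (rule weakly_harmonic_minimum[OF \<alpha>, where v = ?v and G = ?G])
      have "open ((\<lambda>x. t *\<^sub>R x) -` \<Omega>)" by (intro open_vimage \<Omega> continuous_intros)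
      then show "open ?G" using \<Omega>(1) by (auto simp: vimage_def)
      show "bounded ?G" using \<Omega>(2) by (rule bounded_subset) auto
      have "continuous_on UNIV (\<lambda>x. u (t *\<^sub>R x))"
        by (rule continuous_on_compose2[OF cont]) (auto intro!: continuous_intros)
      then show "continuous_on UNIV ?v" by (intro continuous_intros cont)
      show "weakly_harmonic \<alpha> ?G ?v"
        by (intro weakly_harmonic_combine[OF \<alpha> harm] weakly_harmonic_scale[OF harm t])
      show "0 \<le> ?v x" if x: "x \<notin> ?G" for x
      proof (cases "x \<in> \<Omega>")
        case True
        then have "t *\<^sub>R x \<notin> D0 \<or> t *\<^sub>R x \<in> closure D1" using x by (auto simp: \<Omega>_def)
        moreover have "t *\<^sub>R x \<notin> closure D1"
          using uniformly_starshaped_inward[OF assms(10,5) _ t, of x] True by (auto simp: \<Omega>_def)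
        ultimately show ?thesis using zero nonneg[of x] by simp
      next
        case False
        then consider "x \<notin> D0" | "x \<in> closure D1" by (auto simp: \<Omega>_def)
        then show ?thesis
        proof cases
          case 1
          then show ?thesis using zero uniformly_starshaped_outward[OF assms(9,3) 1 t] by simp
        next
          case 2
          then show ?thesis using one le1[of "t *\<^sub>R x"] by simp
        qed
      qed
    qed
    then show ?thesis by simp
  qed
  have abs1: "\<bar>u x\<bar> \<le> 1" for x using nonneg[of x] le1[of x] by simp
  have int: "integrable lborel u"
    by (rule compact_support_integrable[OF cont assms(4) zero abs1])
  have pos: "0 < (LINT x|lborel. u x)"
  proof -
    obtain e where e: "0 < e" "ball 0 e \<subseteq> D1" using assms(5,7) open_contains_ball by blast
    have "0 < (LINT x|lborel. indicator (ball (0::real^'n) e) x :: real)"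
      using e(1) by (simp add: content_ball)
    also have "\<dots> \<le> (LINT x|lborel. u x)"
    proof (rule integral_mono[OF _ int])
      show "integrable lborel (indicator (ball (0::real^'n) e) :: _ \<Rightarrow> real)"
        using emeasure_bounded_finite[OF bounded_ball[of "0 :: real^'n" e]]
        by (intro integrable_real_indicator) (auto simp: borel_open)
      show "indicator (ball 0 e) x \<le> u x" for x
      proof (cases "x \<in> ball 0 e")
        case True
        then have "u x = 1" using e(2) closure_subset[of D1] by (intro one) blast
        then show ?thesis by (simp add: indicator_def)
      qed (simp add: nonneg)
    qed
    finally show ?thesis .
  qed
  obtain g where g: "\<And>x. x \<in> \<Omega> \<Longrightarrow> (u has_derivative (\<lambda>h. g x \<bullet> h)) (at x)" "continuous_on \<Omega> g"
    using weakly_harmonic_continuously_differentiable[OF \<alpha> \<Omega>(1) harm abs1] by blast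
  fix l :: real assume "l \<in> {0<..<1}"
  then have l: "0 < l" "l < 1" by auto
  \<comment> \<open>Excluding the values \<open>0\<close> and \<open>1\<close> puts the level set
    where \<open>u\<close> is differentiable and its radial derivative is negative.\<close>
  have K\<Omega>: "{x. u x = l} \<subseteq> \<Omega>"
  proof
    fix x assume "x \<in> {x. u x = l}"
    then have "u x \<noteq> 0" "u x \<noteq> 1" using l by auto
    then show "x \<in> \<Omega>" using zero[of x] one[of x] by (auto simp: \<Omega>_def)
  qed
  show "uniformly_starshaped {x. u x \<ge> l}"
  proof (rule superlevel_uniformly_starshaped[OF cont])
    have "closed {x. u x = l}" by (intro closed_Collect_eq cont continuous_intros)
    moreover have "bounded {x. u x = l}" using \<Omega>(2) K\<Omega> by (rule bounded_subset)
    ultimately show "compact {x. u x = l}" by (simp add: compact_eq_bounded_closed)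
    show "continuous_on {x. u x = l} g" using g(2) K\<Omega> by (rule continuous_on_subset)
    fix x assume "u x = l"
    then have x: "x \<in> \<Omega>" using K\<Omega> by blast
    show "(u has_derivative (\<lambda>h. g x \<bullet> h)) (at x)" by (rule g(1)[OF x])
    show "x \<bullet> g x < 0"
      by (rule radial_derivative_negative[OF \<alpha> cont abs1 pos assms(4) zero nonneg \<Omega>(1) x harm mono g(1)[OF x]])
  qed
qed

end
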